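(* Let $P\ne\tilde P$ be points of $\mathbb P$, $u$ a coordinate with $u(\tilde P)=0$, $u(P)=\infty$, and $\tilde u=1/u$. Under the identifications $U\mathfrak g_P/\langle U^+\mathbf g\rangle=U\mathfrak g_{P,-}$ and $U\mathfrak g_{\tilde P}/\langle U^+\mathbf g\rangle=U\mathfrak g_{\tilde P,-}$, for $\nu$ a meromorphic map $\mathbb P\to\mathbf g$ and $z\in\mathbb P\setminus\{P,\tilde P\}$ not a pole of $\nu$, one has the equalities $$\tilde\epsilon^{\nu(z)}(z)=\epsilon^{\nu(z)}(z)-\nu(z)\frac{d\tilde u_z}{\tilde u(z)}:\ U\mathfrak g_{P,\tilde P}/\langle U^+\mathbf g\rangle\to\{U\mathfrak g_{P,\tilde P}/\langle U^+\mathbf g\rangle\}\otimes K_z,$$ $$\tilde\iota^{\nu(z)}(z)=\iota^{\nu(z)}(z)+\nu(z)\frac{d\tilde u_z}{\tilde u(z)}:\ U\mathfrak g^z_{P,\tilde P}/\langle U^+\mathbf g\rangle\to\{U\mathfrak g^z_{P,\tilde P}/\langle U^+\mathbf g\rangle\}\otimes K_z .$$ In particular $\tilde j^{\nu(z)}(z)=j^{\nu(z)}(z)$.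
   Context: $\mathbb P$ is a complex projective line with canonical bundle $K$; a coordinate is a meromorphic function with exactly one pole, which is simple. $\mathbf g$ is a complex Lie algebra with a nondegenerate invariant symmetric bilinear form $(\cdot,\cdot)$. $\mathfrak g_P$ is the Lie algebra of meromorphic maps $\mathbb P\to\mathbf g$ regular at $P$, $\mathfrak g_{P,-}\subset\mathfrak g_P$ the ideal of those vanishing at $P$; $\mathbf g\subset\mathfrak g_P$ as constant maps. $\mathfrak g_{P,\tilde P}$ is the algebra of maps regular at both $P$ and $\tilde P$; a superscript $z$ means moreover regular at $z$. $U^+\mathbf g\subset U\mathbf g$ is the augmentation ideal and $\langle U^+\mathbf g\rangle$ the left ideal it generates; by PBW the inclusion induces $U\mathfrak g_{P,-}\cong U\mathfrak g_P/\langle U^+\mathbf g\rangle$ (and similarly with superscript $z$ or with $\tilde P$), and $U\mathfrak g_{P,\tilde P}/\langle U^+\mathbf g\rangle$ is a subspace of both $U\mathfrak g_P/\langle U^+\mathbf g\rangle$ and $U\mathfrak g_{\tilde P}/\langle U^+\mathbf g\rangle$. In the equalities $\nu(z)\in\mathbf g$ acts by left multiplication. For $a\in\mathbf g$ and $z\ne P$: $\epsilon^a(z):U\mathfrak g_{P,-}\to U\mathfrak g_{P,-}\otimes K_z$ is left multiplication by $\frac{a}{u-u(z)}\otimes du_z$, and $\iota^a(z):U\mathfrak g_{P,-}^z\to U\mathfrak g_{P,-}^z\otimes K_z$ is defined (simultaneously for all $a$) by $\iota^a(z)\mathbf 1=0$ and, for $\alpha\in\mathfrak g_{P,-}^z$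 acting by left multiplication, $$\iota^a(z)\circ\alpha-\alpha\circ\iota^a(z)=-[\epsilon^a(z),\alpha]-(a,d\alpha(z))+\iota^{[a,\alpha(z)]}(z)+\epsilon^{[a,\alpha(z)]}(z).$$ $j^a(z)=\epsilon^a(z)+\iota^a(z)$. The fields $\tilde\epsilon,\tilde\iota,\tilde j$ are defined in the same way with $P$ replaced by $\tilde P$ and $u$ by $\tilde u$, so $\tilde\epsilon^a(z)$ is left multiplication by $\frac{a}{\tilde u-\tilde u(z)}\otimes d\tilde u_z$. *)

theory Defs
  imports
    "HOL-Complex_Analysis.Complex_Analysis"
    "HOL-Library.Poly_Mapping"
    "HOL-Algebra.QuotRing"
    "HOL-Algebra.Generated_Groups"
begin

section \<open>Complex Lie algebras with an invariant form\<close>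

class complex_vector = ab_group_add +
  fixes scaleC :: "complex \<Rightarrow> 'a \<Rightarrow> 'a" (infixr "*\<^sub>C" 75)
  assumes scaleC_add_right: "c *\<^sub>C (x + y) = c *\<^sub>C x + c *\<^sub>C y"
    and scaleC_add_left: "(c + d) *\<^sub>C x = c *\<^sub>C x + d *\<^sub>C x"
    and scaleC_scaleC: "c *\<^sub>C (d *\<^sub>C x) = (c * d) *\<^sub>C x"
    and scaleC_one: "1 *\<^sub>C x = x"

class complex_lie_algebra = complex_vector +
  fixes lie :: "'a \<Rightarrow> 'a \<Rightarrow> 'a"
  assumes lie_add_left: "lie (x + y) z = lie x z + lie y z"
    and lie_add_right: "lie x (y + z) = lie x y + lie x z"
    and lie_scaleC_left: "lie (c *\<^sub>C x) y = c *\<^sub>C lie x y"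
    and lie_scaleC_right: "lie x (c *\<^sub>C y) = c *\<^sub>C lie x y"
    and lie_self: "lie x x = 0"
    and jacobi: "lie x (lie y z) + lie y (lie z x) + lie z (lie x y) = 0"

class metrized_lie_algebra = complex_lie_algebra +
  fixes form :: "'a \<Rightarrow> 'a \<Rightarrow> complex"
  assumes form_add_left: "form (x + y) z = form x z + form y z"
    and form_scaleC_left: "form (c *\<^sub>C x) y = c * form x y"
    and form_sym: "form x y = form y x"
    and form_invariant: "form (lie x y) z = form x (lie y z)"
    and form_nondegenerate: "(\<forall>y. form x y = 0) \<Longrightarrow> x = 0"

instantiation complex :: complex_vector
begin
definition scaleC_complex :: "complex \<Rightarrow> complex \<Rightarrow> complex" where
  "scaleC_complex = (*)"
instance
  by standard (simp_all add: scaleC_complex_def algebra_simps)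
end

lemma scaleC_zero_right [simp]: "c *\<^sub>C (0 :: 'a :: complex_vector) = 0"
  using scaleC_add_right[of c 0 "0 :: 'a"] by simp

lemma scaleC_sum_right:
  "c *\<^sub>C (\<Sum>i\<in>A. f i :: 'a :: complex_vector) = (\<Sum>i\<in>A. c *\<^sub>C f i)"
  by (induction A rule: infinite_finite_induct) (simp_all add: scaleC_add_right)

lemma scaleC_minus_one: "(- 1) *\<^sub>C x = - (x :: 'a :: complex_vector)"
proof -
  have "0 *\<^sub>C x = 0"
    using scaleC_add_left[of 0 0 x] by simp
  then show ?thesis
    using scaleC_add_left[of "- 1" 1 x] by (simp add: scaleC_one eq_neg_iff_add_eq_0)
qed

lemma lie_zero_left [simp]: "lie 0 (x :: 'a :: complex_lie_algebra) = 0"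
  using lie_add_left[of 0 0 x] by simp

lemma lie_zero_right [simp]: "lie (x :: 'a :: complex_lie_algebra) 0 = 0"
  using lie_add_right[of x 0 0] by simp

lemma lie_sum_left:
  "lie (\<Sum>i\<in>A. f i) (x :: 'a :: complex_lie_algebra) = (\<Sum>i\<in>A. lie (f i) x)"
  by (induction A rule: infinite_finite_induct) (simp_all add: lie_add_left)

lemma lie_sum_right:
  "lie (x :: 'a :: complex_lie_algebra) (\<Sum>i\<in>A. f i) = (\<Sum>i\<in>A. lie x (f i))"
  by (induction A rule: infinite_finite_induct) (simp_all add: lie_add_right)

lemma form_add_right:
  "form (x :: 'a :: metrized_lie_algebra) (y + z) = form x y + form x z"
  using form_add_left[of y z x] by (simp add: form_sym)

lemma form_scaleC_right:
  "form (x :: 'a :: metrized_lie_algebra) (c *\<^sub>C y) = c * form x y"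
  using form_scaleC_left[of c y x] by (simp add: form_sym)

lemma form_sum_right:
  "form (x :: 'a :: metrized_lie_algebra) (\<Sum>i\<in>A. f i) = (\<Sum>i\<in>A. form x (f i))"
proof -
  have "form x 0 = 0"
    using form_add_right[of x 0 0] by simp
  then show ?thesis
    by (induction A rule: infinite_finite_induct) (simp_all add: form_add_right)
qed


section \<open>Meromorphic maps on the projective line\<close>

text \<open>The projective line is the Riemann sphere; \<open>loc z\<close> is the inverse of the standard local
  coordinate centred at \<open>z\<close>.\<close>

datatype sphere = Pt complex | Infty

fun loc :: "sphere \<Rightarrow> complex \<Rightarrow> sphere" where
  "loc (Pt a) w = Pt (a + w)"
| "loc Infty w = (if w = 0 then Infty else Pt (1 / w))"

definition mero_fun :: "(sphere \<Rightarrow> complex) \<Rightarrow> bool" where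
  "mero_fun f \<longleftrightarrow> (\<forall>z. (\<lambda>w. f (loc z w)) meromorphic_on {0})"

text \<open>No finiteness of dimension is assumed: a meromorphic map takes its values in a
  finite-dimensional subspace, with meromorphic components. As \<^const>\<open>meromorphic_on\<close> does not
  constrain the values at isolated points, a meromorphic map is a class of such functions modulo
  equality outside a finite subset of the (compact) sphere.\<close>

definition is_mero :: "(sphere \<Rightarrow> 'a :: complex_vector) \<Rightarrow> bool" where
  "is_mero \<alpha> \<longleftrightarrow> (\<exists>(n :: nat) f b. (\<forall>i<n. mero_fun (f i)) \<and>
      finite {x. \<alpha> x \<noteq> (\<Sum>i<n. f i x *\<^sub>C b i)})"

definition mero_eq :: "(sphere \<Rightarrow> 'a :: complex_vector) \<Rightarrow> (sphere \<Rightarrow> 'a) \<Rightarrow> bool" where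
  "mero_eq \<alpha> \<beta> \<longleftrightarrow> is_mero \<alpha> \<and> is_mero \<beta> \<and> finite {x. \<alpha> x \<noteq> \<beta> x}"

lemma mero_fun_const: "mero_fun (\<lambda>_. c)"
  unfolding mero_fun_def by (auto intro!: meromorphic_intros)

lemma mero_fun_add: "mero_fun f \<Longrightarrow> mero_fun g \<Longrightarrow> mero_fun (\<lambda>x. f x + g x)"
  unfolding mero_fun_def by (auto intro!: meromorphic_intros)

lemma mero_fun_mult: "mero_fun f \<Longrightarrow> mero_fun g \<Longrightarrow> mero_fun (\<lambda>x. f x * g x)"
  unfolding mero_fun_def by (auto intro!: meromorphic_intros)

lemma mero_fun_inverse: "mero_fun f \<Longrightarrow> mero_fun (\<lambda>x. inverse (f x))"
  unfolding mero_fun_def by (auto intro!: meromorphic_intros)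

lemma mero_fun_sum: "(\<And>i. i \<in> A \<Longrightarrow> mero_fun (f i)) \<Longrightarrow> mero_fun (\<lambda>x. \<Sum>i\<in>A. f i x)"
  unfolding mero_fun_def by (auto intro!: meromorphic_intros)

lemma inj_loc: "inj (loc z)"
  by (cases z) (auto simp: inj_def split: if_splits)

lemma mero_fun_cong:
  assumes "mero_fun f" "finite {x. g x \<noteq> f x}"
  shows "mero_fun g"
  unfolding mero_fun_def
proof
  fix z
  have "finite (loc z -` {x. g x \<noteq> f x})"
    using assms(2) inj_loc by (rule finite_vimageI)
  then have "eventually (\<lambda>w. w \<notin> loc z -` {x. g x \<noteq> f x}) (at 0)"
    by (metis islimpt_finite islimpt_iff_eventually)
  then have "eventually (\<lambda>w. g (loc z w) = f (loc z w)) (at 0)"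
    by (rule eventually_mono) auto
  then have "(\<lambda>w. g (loc z w)) meromorphic_on {0} \<longleftrightarrow> (\<lambda>w. f (loc z w)) meromorphic_on {0}"
    by (intro meromorphic_on_cong) auto
  with assms(1) show "(\<lambda>w. g (loc z w)) meromorphic_on {0}"
    by (simp add: mero_fun_def)
qed

lemma is_mero_cong:
  assumes "is_mero \<alpha>" "finite {x. \<beta> x \<noteq> \<alpha> x}"
  shows "is_mero \<beta>"
proof -
  obtain n :: nat and f b where *: "\<forall>i<n. mero_fun (f i)"
      "finite {x. \<alpha> x \<noteq> (\<Sum>i<n. f i x *\<^sub>C b i)}"
    using assms(1) unfolding is_mero_def by blast
  have "finite {x. \<beta> x \<noteq> (\<Sum>i<n. f i x *\<^sub>C b i)}"
    by (rule finite_subset[OF _ finite_UnI[OF assms(2) *(2)]]) auto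
  with * show ?thesis
    unfolding is_mero_def by blast
qed

lemma is_mero_zero: "is_mero (\<lambda>_. 0)"
  unfolding is_mero_def by (rule exI[of _ 0]) auto

lemma is_mero_add_term:
  assumes "is_mero \<alpha>" "mero_fun f"
  shows "is_mero (\<lambda>x. \<alpha> x + f x *\<^sub>C b)"
proof -
  obtain n :: nat and g c where *: "\<forall>i<n. mero_fun (g i)"
      "finite {x. \<alpha> x \<noteq> (\<Sum>i<n. g i x *\<^sub>C c i)}"
    using assms(1) unfolding is_mero_def by blast
  have eq: "(\<Sum>i<Suc n. (g(n := f)) i x *\<^sub>C (c(n := b)) i) =
      (\<Sum>i<n. g i x *\<^sub>C c i) + f x *\<^sub>C b" for x
    by (auto intro!: sum.cong)
  have "\<forall>i<Suc n. mero_fun ((g(n := f)) i)"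
    using * assms(2) by (auto simp: less_Suc_eq)
  moreover have "finite {x. \<alpha> x + f x *\<^sub>C b \<noteq> (\<Sum>i<Suc n. (g(n := f)) i x *\<^sub>C (c(n := b)) i)}"
    unfolding eq using *(2) by simp
  ultimately show ?thesis
    unfolding is_mero_def by blast
qed

lemma is_mero_term: "mero_fun f \<Longrightarrow> is_mero (\<lambda>x. f x *\<^sub>C b)"
  using is_mero_add_term[OF is_mero_zero] by simp

lemma is_mero_add_terms:
  assumes "is_mero \<alpha>" "\<And>i. i < n \<Longrightarrow> mero_fun (f i)"
  shows "is_mero (\<lambda>x. \<alpha> x + (\<Sum>i<n::nat. f i x *\<^sub>C b i))"
  using assms(2)
proof (induction n)
  case 0
  then show ?case using assms(1) by simp
next
  case (Suc n)
  then have "is_mero (\<lambda>x. (\<alpha> x + (\<Sum>i<n. f i x *\<^sub>C b i)) + f n x *\<^sub>C b n)"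
    by (intro is_mero_add_term) auto
  then show ?case by (simp add: add.assoc)
qed

lemma is_mero_add:
  assumes "is_mero \<alpha>" "is_mero \<beta>"
  shows "is_mero (\<lambda>x. \<alpha> x + \<beta> x)"
proof -
  obtain n :: nat and g c where *: "\<forall>i<n. mero_fun (g i)"
      "finite {x. \<beta> x \<noteq> (\<Sum>i<n. g i x *\<^sub>C c i)}"
    using assms(2) unfolding is_mero_def by blast
  have "is_mero (\<lambda>x. \<alpha> x + (\<Sum>i<n. g i x *\<^sub>C c i))"
    using assms(1) * by (intro is_mero_add_terms) auto
  then show ?thesis
    by (rule is_mero_cong) (use *(2) in simp)
qed

lemma is_mero_sum:
  "(\<And>i. i \<in> A \<Longrightarrow> is_mero (\<alpha> i)) \<Longrightarrow> is_mero (\<lambda>x. \<Sum>i\<in>A. \<alpha> i x)"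
  by (induction A rule: infinite_finite_induct) (auto simp: is_mero_zero intro!: is_mero_add)

lemma is_mero_complex: "is_mero (f :: sphere \<Rightarrow> complex) \<longleftrightarrow> mero_fun f"
proof
  assume "is_mero f"
  then obtain n :: nat and g c where *: "\<forall>i<n. mero_fun (g i)"
      "finite {x. f x \<noteq> (\<Sum>i<n. g i x *\<^sub>C c i)}"
    unfolding is_mero_def by blast
  show "mero_fun f"
    by (rule mero_fun_cong[OF _ *(2)])
      (use *(1) in \<open>auto simp: scaleC_complex_def intro!: mero_fun_sum mero_fun_mult mero_fun_const\<close>)
next
  assume "mero_fun f"
  from is_mero_term[OF this, of "1 :: complex"] show "is_mero f"
    by (simp add: scaleC_complex_def)
qed

lemma is_mero_const: "is_mero (\<lambda>_. b)"
  using is_mero_term[OF mero_fun_const[of 1], of b] by (simp add: scaleC_one)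

lemma is_mero_smult:
  assumes "is_mero (f :: sphere \<Rightarrow> complex)" "is_mero \<alpha>"
  shows "is_mero (\<lambda>x. f x *\<^sub>C \<alpha> x)"
proof -
  obtain n :: nat and g c where *: "\<forall>i<n. mero_fun (g i)"
      "finite {x. \<alpha> x \<noteq> (\<Sum>i<n. g i x *\<^sub>C c i)}"
    using assms(2) unfolding is_mero_def by blast
  have "is_mero (\<lambda>x. \<Sum>i<n. (f x * g i x) *\<^sub>C c i)"
    using assms(1) *(1) by (auto intro!: is_mero_sum is_mero_term mero_fun_mult simp: is_mero_complex)
  then have "is_mero (\<lambda>x. f x *\<^sub>C (\<Sum>i<n. g i x *\<^sub>C c i))"
    by (simp add: scaleC_sum_right scaleC_scaleC)
  then show ?thesis
    by (rule is_mero_cong) (rule finite_subset[OF _ *(2)], auto)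
qed

lemma is_mero_scaleC: "is_mero \<alpha> \<Longrightarrow> is_mero (\<lambda>x. c *\<^sub>C \<alpha> x)"
  by (rule is_mero_smult[OF is_mero_const])

lemma is_mero_uminus: "is_mero \<alpha> \<Longrightarrow> is_mero (\<lambda>x. - \<alpha> x)"
  using is_mero_scaleC[of \<alpha> "- 1"] by (simp add: scaleC_minus_one)

lemma is_mero_minus: "is_mero \<alpha> \<Longrightarrow> is_mero \<beta> \<Longrightarrow> is_mero (\<lambda>x. \<alpha> x - \<beta> x)"
  using is_mero_add[of \<alpha> "\<lambda>x. - \<beta> x"] is_mero_uminus[of \<beta>] by simp

lemma is_mero_lie:
  fixes \<alpha> \<beta> :: "sphere \<Rightarrow> 'a :: complex_lie_algebra"
  assumes "is_mero \<alpha>" "is_mero \<beta>"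
  shows "is_mero (\<lambda>x. lie (\<alpha> x) (\<beta> x))"
proof -
  obtain n :: nat and f b where f: "\<forall>i<n. mero_fun (f i)"
      "finite {x. \<alpha> x \<noteq> (\<Sum>i<n. f i x *\<^sub>C b i)}"
    using assms(1) unfolding is_mero_def by blast
  obtain m :: nat and g c where g: "\<forall>i<m. mero_fun (g i)"
      "finite {x. \<beta> x \<noteq> (\<Sum>i<m. g i x *\<^sub>C c i)}"
    using assms(2) unfolding is_mero_def by blast
  have "is_mero (\<lambda>x. \<Sum>j<m. \<Sum>i<n. (g j x * f i x) *\<^sub>C lie (b i) (c j))"
    using f g by (auto intro!: is_mero_sum is_mero_term mero_fun_mult)
  then have "is_mero (\<lambda>x. lie (\<Sum>i<n. f i x *\<^sub>C b i) (\<Sum>j<m. g j x *\<^sub>C c j))"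
    by (simp add: lie_sum_left lie_sum_right lie_scaleC_left lie_scaleC_right scaleC_sum_right
        scaleC_scaleC)
  then show ?thesis
    by (rule is_mero_cong) (rule finite_subset[OF _ finite_UnI[OF f(2) g(2)]], auto)
qed

lemma is_mero_form:
  fixes \<alpha> :: "sphere \<Rightarrow> 'a :: metrized_lie_algebra"
  assumes "is_mero \<alpha>"
  shows "is_mero (\<lambda>x. form a (\<alpha> x))"
proof -
  obtain n :: nat and f b where f: "\<forall>i<n. mero_fun (f i)"
      "finite {x. \<alpha> x \<noteq> (\<Sum>i<n. f i x *\<^sub>C b i)}"
    using assms unfolding is_mero_def by blast
  have "is_mero (\<lambda>x. form a (\<Sum>i<n. f i x *\<^sub>C b i))"
    using f by (auto simp: form_sum_right form_scaleC_right is_mero_complex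
        intro!: mero_fun_sum mero_fun_mult mero_fun_const)
  then show ?thesis
    by (rule is_mero_cong) (rule finite_subset[OF _ f(2)], auto)
qed

lemma mero_eq_trans:
  assumes "mero_eq \<alpha> \<beta>" "mero_eq \<beta> \<gamma>"
  shows "mero_eq \<alpha> \<gamma>"
proof -
  have "finite ({x. \<alpha> x \<noteq> \<beta> x} \<union> {x. \<beta> x \<noteq> \<gamma> x})"
    using assms by (simp add: mero_eq_def)
  then have "finite {x. \<alpha> x \<noteq> \<gamma> x}"
    by (rule rev_finite_subset) auto
  then show ?thesis
    using assms by (simp add: mero_eq_def)
qed

quotient_type (overloaded) 'a mero = "sphere \<Rightarrow> 'a :: complex_vector" / partial: mero_eq
proof (rule part_equivpI)
  show "\<exists>\<alpha> :: sphere \<Rightarrow> 'a. mero_eq \<alpha> \<alpha>"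
    by (rule exI[of _ "\<lambda>_. 0"]) (simp add: mero_eq_def is_mero_zero)
  show "symp (mero_eq :: (sphere \<Rightarrow> 'a) \<Rightarrow> _)"
    by (auto simp: symp_def mero_eq_def eq_commute)
  show "transp (mero_eq :: (sphere \<Rightarrow> 'a) \<Rightarrow> _)"
    using mero_eq_trans by (auto simp: transp_def)
qed

lemma mero_eq_lift2:
  assumes "mero_eq \<alpha> \<alpha>'" "mero_eq \<beta> \<beta>'"
    and "\<And>\<alpha> \<beta>. is_mero \<alpha> \<Longrightarrow> is_mero \<beta> \<Longrightarrow> is_mero (\<lambda>x. F (\<alpha> x) (\<beta> x))"
  shows "mero_eq (\<lambda>x. F (\<alpha> x) (\<beta> x)) (\<lambda>x. F (\<alpha>' x) (\<beta>' x))"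
proof -
  have "finite ({x. \<alpha> x \<noteq> \<alpha>' x} \<union> {x. \<beta> x \<noteq> \<beta>' x})"
    using assms by (simp add: mero_eq_def)
  then have "finite {x. F (\<alpha> x) (\<beta> x) \<noteq> F (\<alpha>' x) (\<beta>' x)}"
    by (rule rev_finite_subset) auto
  then show ?thesis
    using assms by (simp add: mero_eq_def)
qed

lemma mero_eq_lift1:
  assumes "mero_eq \<alpha> \<alpha>'" "\<And>\<alpha>. is_mero \<alpha> \<Longrightarrow> is_mero (\<lambda>x. F (\<alpha> x))"
  shows "mero_eq (\<lambda>x. F (\<alpha> x)) (\<lambda>x. F (\<alpha>' x))"
  using mero_eq_lift2[OF assms(1) assms(1), of "\<lambda>y _. F y"] assms(2) by simp

instantiation mero :: (complex_vector) complex_vector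
begin

lift_definition zero_mero :: "'a mero" is "\<lambda>_. 0"
  by (simp add: mero_eq_def is_mero_zero)
lift_definition plus_mero :: "'a mero \<Rightarrow> 'a mero \<Rightarrow> 'a mero" is "\<lambda>\<alpha> \<beta> x. \<alpha> x + \<beta> x"
  by (rule mero_eq_lift2) (auto intro: is_mero_add)
lift_definition minus_mero :: "'a mero \<Rightarrow> 'a mero \<Rightarrow> 'a mero" is "\<lambda>\<alpha> \<beta> x. \<alpha> x - \<beta> x"
  by (rule mero_eq_lift2) (auto intro: is_mero_minus)
lift_definition uminus_mero :: "'a mero \<Rightarrow> 'a mero" is "\<lambda>\<alpha> x. - \<alpha> x"
  by (rule mero_eq_lift1) (auto intro: is_mero_uminus)
lift_definition scaleC_mero :: "complex \<Rightarrow> 'a mero \<Rightarrow> 'a mero" is "\<lambda>c \<alpha> x. c *\<^sub>C \<alpha> x"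
  by (rule mero_eq_lift1) (auto intro: is_mero_scaleC)

instance
proof
  fix \<alpha> \<beta> \<gamma> :: "'a mero" and c d :: complex
  show "\<alpha> + \<beta> + \<gamma> = \<alpha> + (\<beta> + \<gamma>)"
    by transfer (auto simp: mero_eq_def add.assoc intro!: is_mero_add)
  show "\<alpha> + \<beta> = \<beta> + \<alpha>"
    by transfer (auto simp: mero_eq_def add.commute intro!: is_mero_add)
  show "0 + \<alpha> = \<alpha>"
    by transfer (auto simp: mero_eq_def)
  show "- \<alpha> + \<alpha> = 0"
    by transfer (auto simp: mero_eq_def is_mero_zero)
  show "\<alpha> - \<beta> = \<alpha> + - \<beta>"
    by transfer (auto simp: mero_eq_def is_mero_minus)
  show "c *\<^sub>C (\<alpha> + \<beta>) = c *\<^sub>C \<alpha> + c *\<^sub>C \<beta>"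
    by transfer (auto simp: mero_eq_def scaleC_add_right intro!: is_mero_add is_mero_scaleC)
  show "(c + d) *\<^sub>C \<alpha> = c *\<^sub>C \<alpha> + d *\<^sub>C \<alpha>"
    by transfer (auto simp: mero_eq_def scaleC_add_left intro!: is_mero_add is_mero_scaleC)
  show "c *\<^sub>C (d *\<^sub>C \<alpha>) = (c * d) *\<^sub>C \<alpha>"
    by transfer (auto simp: mero_eq_def scaleC_scaleC intro!: is_mero_scaleC)
  show "1 *\<^sub>C \<alpha> = \<alpha>"
    by transfer (auto simp: mero_eq_def scaleC_one)
qed

end

instantiation mero :: (complex_lie_algebra) complex_lie_algebra
begin

lift_definition lie_mero :: "'a mero \<Rightarrow> 'a mero \<Rightarrow> 'a mero" is "\<lambda>\<alpha> \<beta> x. lie (\<alpha> x) (\<beta> x)"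
  by (rule mero_eq_lift2) (auto intro: is_mero_lie)

instance
proof
  fix \<alpha> \<beta> \<gamma> :: "'a mero" and c :: complex
  show "lie (\<alpha> + \<beta>) \<gamma> = lie \<alpha> \<gamma> + lie \<beta> \<gamma>"
    by transfer (auto simp: mero_eq_def lie_add_left intro!: is_mero_add is_mero_lie)
  show "lie \<alpha> (\<beta> + \<gamma>) = lie \<alpha> \<beta> + lie \<alpha> \<gamma>"
    by transfer (auto simp: mero_eq_def lie_add_right intro!: is_mero_add is_mero_lie)
  show "lie (c *\<^sub>C \<alpha>) \<beta> = c *\<^sub>C lie \<alpha> \<beta>"
    by transfer (auto simp: mero_eq_def lie_scaleC_left intro!: is_mero_scaleC is_mero_lie)
  show "lie \<alpha> (c *\<^sub>C \<beta>) = c *\<^sub>C lie \<alpha> \<beta>"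
    by transfer (auto simp: mero_eq_def lie_scaleC_right intro!: is_mero_scaleC is_mero_lie)
  show "lie \<alpha> \<alpha> = 0"
    by transfer (auto simp: mero_eq_def lie_self is_mero_zero)
  show "lie \<alpha> (lie \<beta> \<gamma>) + lie \<beta> (lie \<gamma> \<alpha>) + lie \<gamma> (lie \<alpha> \<beta>) = 0"
    by transfer (auto simp: mero_eq_def jacobi is_mero_zero)
qed

end

lift_definition mconst :: "'a :: complex_vector \<Rightarrow> 'a mero" is "\<lambda>a _. a"
  by (simp add: mero_eq_def is_mero_const)

lift_definition msmult :: "complex mero \<Rightarrow> 'a :: complex_vector mero \<Rightarrow> 'a mero" (infixr "\<odot>" 75)
  is "\<lambda>f \<alpha> x. f x *\<^sub>C \<alpha> x"
  by (rule mero_eq_lift2) (auto intro: is_mero_smult)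

lift_definition minverse :: "complex mero \<Rightarrow> complex mero" is "\<lambda>f x. inverse (f x)"
  by (rule mero_eq_lift1) (auto simp: is_mero_complex intro: mero_fun_inverse)

lift_definition mform :: "'g :: metrized_lie_algebra \<Rightarrow> 'g mero \<Rightarrow> complex mero"
  is "\<lambda>a \<alpha> x. form a (\<alpha> x)"
  by (rule mero_eq_lift1) (auto intro: is_mero_form)


text \<open>Regularity and values do not refer to the value of an arbitrary representative at \<open>z\<close>:
  a removable singularity is removed by a suitable choice of the \<open>f i\<close>.\<close>

definition has_value :: "'a :: complex_vector mero \<Rightarrow> sphere \<Rightarrow> 'a \<Rightarrow> bool" where
  "has_value \<alpha> z v \<longleftrightarrow> (\<exists>(n :: nat) f b.
      (\<forall>i<n. mero_fun (f i) \<and> (\<lambda>w. f i (loc z w)) analytic_on {0}) \<and>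
      \<alpha> = abs_mero (\<lambda>x. \<Sum>i<n. f i x *\<^sub>C b i) \<and> v = (\<Sum>i<n. f i z *\<^sub>C b i))"

definition regular :: "'a :: complex_vector mero \<Rightarrow> sphere \<Rightarrow> bool" where
  "regular \<alpha> z \<longleftrightarrow> (\<exists>v. has_value \<alpha> z v)"

definition mval :: "'a :: complex_vector mero \<Rightarrow> sphere \<Rightarrow> 'a" where
  "mval \<alpha> z = (THE v. has_value \<alpha> z v)"

text \<open>The next two notions depend only on the behaviour in a punctured neighbourhood, hence not on
  the representative.\<close>

definition has_pole :: "complex mero \<Rightarrow> sphere \<Rightarrow> bool" where
  "has_pole u z \<longleftrightarrow> is_pole (\<lambda>w. rep_mero u (loc z w)) 0"

definition is_coordinate :: "complex mero \<Rightarrow> bool" where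
  "is_coordinate u \<longleftrightarrow>
     (\<exists>p. {z. has_pole u z} = {p} \<and> zorder (\<lambda>w. rep_mero u (loc p w)) 0 = - 1)"

text \<open>The tangent space at \<open>z\<close>, as derivations at \<open>z\<close> of the local ring of functions regular at
  \<open>z\<close> (extended by \<open>0\<close> to other functions). The fibre \<open>K\<^sub>z\<close> is its dual, with \<open>df\<^sub>z (\<delta>) = \<delta> f\<close>;
  since it is one-dimensional, \<open>V \<otimes> K\<^sub>z = Hom (tangent z, V)\<close>. Below, an operator with values in
  \<open>V \<otimes> K\<^sub>z\<close> is therefore an operator with values in \<open>V\<close> depending on \<open>\<delta> \<in> tangent z\<close>.\<close>

definition tangent :: "sphere \<Rightarrow> (complex mero \<Rightarrow> complex) set" where
  "tangent z = {\<delta>.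
     (\<forall>f g. regular f z \<longrightarrow> regular g z \<longrightarrow>
        \<delta> (f + g) = \<delta> f + \<delta> g \<and> \<delta> (f \<odot> g) = mval f z * \<delta> g + mval g z * \<delta> f) \<and>
     (\<forall>c f. regular f z \<longrightarrow> \<delta> (c *\<^sub>C f) = c * \<delta> f) \<and>
     (\<forall>f. \<not> regular f z \<longrightarrow> \<delta> f = 0)}"

definition reg_maps :: "sphere set \<Rightarrow> 'g :: complex_vector mero set" where
  "reg_maps S = {\<alpha>. \<forall>s\<in>S. regular \<alpha> s}"

definition van_maps :: "sphere \<Rightarrow> sphere set \<Rightarrow> 'g :: complex_vector mero set" where
  "van_maps P S = {\<alpha> \<in> reg_maps (insert P S). mval \<alpha> P = 0}"


section \<open>Universal enveloping algebras\<close>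

text \<open>With words as a monoid under concatenation, \<^typ>\<open>'l list \<Rightarrow>\<^sub>0 complex\<close> is the free
  unital associative algebra on the set \<^typ>\<open>'l\<close>.\<close>

instantiation list :: (type) monoid_add
begin
definition zero_list :: "'a list" where "zero_list = []"
definition plus_list :: "'a list \<Rightarrow> 'a list \<Rightarrow> 'a list" where "plus_list = (@)"
instance
  by standard (simp_all add: zero_list_def plus_list_def)
end

definition gen :: "'l \<Rightarrow> ('l list \<Rightarrow>\<^sub>0 complex)" where
  "gen x = Poly_Mapping.single [x] 1"

definition scal :: "complex \<Rightarrow> ('l list \<Rightarrow>\<^sub>0 complex)" where
  "scal c = Poly_Mapping.single [] c"

definition free_alg :: "'l set \<Rightarrow> ('l list \<Rightarrow>\<^sub>0 complex) ring" where
  "free_alg L = \<lparr>carrier = {p. Poly_Mapping.keys p \<subseteq> lists L}, mult = (*), one = 1, zero = 0, add = (+)\<rparr>"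

definition env_rels :: "'l :: complex_lie_algebra set \<Rightarrow> ('l list \<Rightarrow>\<^sub>0 complex) set" where
  "env_rels L =
     {gen (x + y) - (gen x + gen y) | x y. x \<in> L \<and> y \<in> L} \<union>
     {gen (c *\<^sub>C x) - scal c * gen x | c x. x \<in> L} \<union>
     {gen x * gen y - gen y * gen x - gen (lie x y) | x y. x \<in> L \<and> y \<in> L}"

definition env_ideal :: "'l :: complex_lie_algebra set \<Rightarrow> ('l list \<Rightarrow>\<^sub>0 complex) set" where
  "env_ideal L = Idl\<^bsub>free_alg L\<^esub> (env_rels L)"

text \<open>\<open>env L\<close> is \<open>U L\<close>, for a Lie subalgebra \<open>L\<close> of the ambient type.\<close>

definition env :: "'l :: complex_lie_algebra set \<Rightarrow> ('l list \<Rightarrow>\<^sub>0 complex) set ring" where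
  "env L = free_alg L Quot env_ideal L"

definition env_class :: "'l :: complex_lie_algebra set \<Rightarrow> ('l list \<Rightarrow>\<^sub>0 complex) \<Rightarrow>
    ('l list \<Rightarrow>\<^sub>0 complex) set" where
  "env_class L p = env_ideal L +>\<^bsub>free_alg L\<^esub> p"

definition env_gen :: "'l :: complex_lie_algebra set \<Rightarrow> 'l \<Rightarrow> ('l list \<Rightarrow>\<^sub>0 complex) set" where
  "env_gen L x = env_class L (gen x)"

definition env_scal :: "'l :: complex_lie_algebra set \<Rightarrow> complex \<Rightarrow> ('l list \<Rightarrow>\<^sub>0 complex) set" where
  "env_scal L c = env_class L (scal c)"

text \<open>The homomorphism to \<open>U M\<close> induced by an inclusion \<open>L \<subseteq> M\<close>, for \<open>X \<in> U L\<close>.\<close>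

definition env_map :: "'l :: complex_lie_algebra set \<Rightarrow> ('l list \<Rightarrow>\<^sub>0 complex) set \<Rightarrow>
    ('l list \<Rightarrow>\<^sub>0 complex) set" where
  "env_map M X = (\<Union>p\<in>X. env_class M p)"

text \<open>The relations have no constant term, so the constant term of a representative depends only
  on its class; this is the augmentation \<open>U L \<rightarrow> \<complex>\<close>.\<close>

definition augmentation :: "('l list \<Rightarrow>\<^sub>0 complex) set \<Rightarrow> complex" where
  "augmentation X = (THE c. \<forall>p\<in>X. Poly_Mapping.lookup p [] = c)"

definition aug_ideal :: "'l :: complex_lie_algebra set \<Rightarrow> ('l list \<Rightarrow>\<^sub>0 complex) set set" where
  "aug_ideal L = {X \<in> carrier (env L). augmentation X = 0}"

definition left_ideal :: "('r, 'm) ring_scheme \<Rightarrow> 'r set \<Rightarrow> 'r set" where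
  "left_ideal R S = generate (add_monoid R) {x \<otimes>\<^bsub>R\<^esub> s | x s. x \<in> carrier R \<and> s \<in> S}"


section \<open>The quotients by the augmentation ideal of the constant maps\<close>

definition const_ideal :: "'g :: complex_lie_algebra mero set \<Rightarrow> ('g mero list \<Rightarrow>\<^sub>0 complex) set set"
  where "const_ideal L = left_ideal (env L) (env_map L ` aug_ideal (range mconst))"

type_synonym 'g vac = "('g mero list \<Rightarrow>\<^sub>0 complex) set set"

text \<open>\<open>vac L\<close> is \<open>U L / \<langle>U\<^sup>+ \<g>\<rangle>\<close>, for \<open>L\<close> containing the constant maps.\<close>

definition vac :: "'g :: complex_lie_algebra mero set \<Rightarrow> 'g vac set" where
  "vac L = a_rcosets\<^bsub>env L\<^esub> (const_ideal L)"

definition vac_class :: "'g :: complex_lie_algebra mero set \<Rightarrow> ('g mero list \<Rightarrow>\<^sub>0 complex) set \<Rightarrow> 'g vac"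
  where "vac_class L X = const_ideal L +>\<^bsub>env L\<^esub> X"

definition vac_diff :: "'g :: complex_lie_algebra mero set \<Rightarrow> 'g vac \<Rightarrow> 'g vac \<Rightarrow> 'g vac" where
  "vac_diff L Y Z = Y <+>\<^bsub>env L\<^esub> a_set_inv\<^bsub>env L\<^esub> Z"

definition vac_add :: "'g :: complex_lie_algebra mero set \<Rightarrow> 'g vac \<Rightarrow> 'g vac \<Rightarrow> 'g vac" where
  "vac_add L Y Z = Y <+>\<^bsub>env L\<^esub> Z"

definition vac_act :: "'g :: complex_lie_algebra mero set \<Rightarrow> ('g mero list \<Rightarrow>\<^sub>0 complex) set \<Rightarrow>
    'g vac \<Rightarrow> 'g vac" where
  "vac_act L X Y = (\<Union>W\<in>Y. vac_class L (X \<otimes>\<^bsub>env L\<^esub> W))"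

text \<open>The map induced by an inclusion \<open>L \<subseteq> M\<close>, for \<open>Y \<in> vac L\<close>; it is injective by the
  Poincare-Birkhoff-Witt theorem, and makes \<open>vac L\<close> a subspace of \<open>vac M\<close>.\<close>

definition vac_map :: "'g :: complex_lie_algebra mero set \<Rightarrow> 'g vac \<Rightarrow> 'g vac" where
  "vac_map M Y = (\<Union>X\<in>Y. vac_class M (env_map M X))"

text \<open>For \<open>L\<^sub>- = van_maps P S\<close> and \<open>L = reg_maps (insert P S)\<close>, the identification
  \<open>U L\<^sub>- \<cong> U L / \<langle>U\<^sup>+ \<g>\<rangle>\<close> induced by the inclusion.\<close>

definition ident :: "sphere \<Rightarrow> sphere set \<Rightarrow> ('g :: complex_lie_algebra mero list \<Rightarrow>\<^sub>0 complex) set \<Rightarrow>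
    'g vac" where
  "ident P S X =
     vac_class (reg_maps (insert P S)) (env_map (reg_maps (insert P S)) X)"

definition unident :: "sphere \<Rightarrow> sphere set \<Rightarrow> 'g :: complex_lie_algebra vac \<Rightarrow>
    ('g mero list \<Rightarrow>\<^sub>0 complex) set" where
  "unident P S = inv_into (carrier (env (van_maps P S))) (ident P S)"


section \<open>The fields\<close>

text \<open>The map \<open>a / (u - u(z))\<close>.\<close>

definition eps_map :: "complex mero \<Rightarrow> sphere \<Rightarrow> 'g :: complex_vector \<Rightarrow> 'g mero" where
  "eps_map u z a = minverse (u - mconst (mval u z)) \<odot> mconst a"

definition eps :: "sphere \<Rightarrow> complex mero \<Rightarrow> sphere \<Rightarrow> (complex mero \<Rightarrow> complex) \<Rightarrow>
    'g :: complex_lie_algebra \<Rightarrow> ('g mero list \<Rightarrow>\<^sub>0 complex) set \<Rightarrow> ('g mero list \<Rightarrow>\<^sub>0 complex) set" where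
  "eps P u z \<delta> a X =
     (let L = van_maps P {} in
      env_scal L (\<delta> u) \<otimes>\<^bsub>env L\<^esub> (env_gen L (eps_map u z a) \<otimes>\<^bsub>env L\<^esub> X))"

text \<open>The defining relations of \<open>\<iota>\<close>. The two terms \<open>- [\<epsilon>\<^sup>a(z), \<alpha>] + \<epsilon>\<^bsup>[a, \<alpha>(z)]\<^esup>(z)\<close> of the
  commutation relation are, taken together, left multiplication by
  \<open>(- [a / (u - u(z)), \<alpha>] + [a, \<alpha>(z)] / (u - u(z))) \<otimes> du\<^sub>z\<close>. This map is regular at \<open>z\<close> and
  acts on \<open>U \<g>\<^sup>z\<^sub>P\<^sub>,\<^sub>-\<close>, whereas its two summands have a pole at \<open>z\<close>. The last factor of
  \<open>(a, d\<alpha>(z))\<close> is the differential at \<open>z\<close> of the function \<open>(a, \<alpha>)\<close>.\<close>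

definition is_iota :: "sphere \<Rightarrow> complex mero \<Rightarrow> sphere \<Rightarrow> (complex mero \<Rightarrow> complex) \<Rightarrow>
    ('g :: metrized_lie_algebra \<Rightarrow> ('g mero list \<Rightarrow>\<^sub>0 complex) set \<Rightarrow> ('g mero list \<Rightarrow>\<^sub>0 complex) set) \<Rightarrow>
    bool" where
  "is_iota P u z \<delta> J \<longleftrightarrow> (let L = van_maps P {z}; U = env L in
     (\<forall>a. J a \<in> carrier U \<rightarrow>\<^sub>E carrier U) \<and>
     (\<forall>a. \<forall>X\<in>carrier U. \<forall>Y\<in>carrier U. J a (X \<oplus>\<^bsub>U\<^esub> Y) = J a X \<oplus>\<^bsub>U\<^esub> J a Y) \<and>
     (\<forall>a c. \<forall>X\<in>carrier U. J a (env_scal L c \<otimes>\<^bsub>U\<^esub> X) = env_scal L c \<otimes>\<^bsub>U\<^esub> J a X) \<and>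
     (\<forall>a. J a \<one>\<^bsub>U\<^esub> = \<zero>\<^bsub>U\<^esub>) \<and>
     (\<forall>a. \<forall>\<alpha>\<in>L. \<forall>X\<in>carrier U.
        J a (env_gen L \<alpha> \<otimes>\<^bsub>U\<^esub> X) \<ominus>\<^bsub>U\<^esub> env_gen L \<alpha> \<otimes>\<^bsub>U\<^esub> J a X =
          env_scal L (\<delta> u) \<otimes>\<^bsub>U\<^esub>
            (env_gen L (- lie (eps_map u z a) \<alpha> + eps_map u z (lie a (mval \<alpha> z))) \<otimes>\<^bsub>U\<^esub> X)
          \<ominus>\<^bsub>U\<^esub> env_scal L (\<delta> (mform a \<alpha>)) \<otimes>\<^bsub>U\<^esub> X
          \<oplus>\<^bsub>U\<^esub> J (lie a (mval \<alpha> z)) X))"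

definition iota :: "sphere \<Rightarrow> complex mero \<Rightarrow> sphere \<Rightarrow> (complex mero \<Rightarrow> complex) \<Rightarrow>
    'g :: metrized_lie_algebra \<Rightarrow> ('g mero list \<Rightarrow>\<^sub>0 complex) set \<Rightarrow> ('g mero list \<Rightarrow>\<^sub>0 complex) set" where
  "iota P u z \<delta> = (THE J. is_iota P u z \<delta> J)"

text \<open>\<open>j = \<epsilon> + \<iota>\<close>, from \<open>U \<g>\<^sup>z\<^sub>P\<^sub>,\<^sub>-\<close> to \<open>U \<g>\<^sub>P\<^sub>,\<^sub>- \<otimes> K\<^sub>z\<close>.\<close>

definition jay :: "sphere \<Rightarrow> complex mero \<Rightarrow> sphere \<Rightarrow> (complex mero \<Rightarrow> complex) \<Rightarrow>
    'g :: metrized_lie_algebra \<Rightarrow> ('g mero list \<Rightarrow>\<^sub>0 complex) set \<Rightarrow> ('g mero list \<Rightarrow>\<^sub>0 complex) set" where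
  "jay P u z \<delta> a X =
     (let L = van_maps P {} in
      eps P u z \<delta> a (env_map L X) \<oplus>\<^bsub>env L\<^esub> env_map L (iota P u z \<delta> a X))"

text \<open>The same operators on \<open>U \<g>\<^sub>P / \<langle>U\<^sup>+ \<g>\<rangle>\<close> and \<open>U \<g>\<^sup>z\<^sub>P / \<langle>U\<^sup>+ \<g>\<rangle>\<close>.\<close>

definition eps_vac :: "sphere \<Rightarrow> complex mero \<Rightarrow> sphere \<Rightarrow> (complex mero \<Rightarrow> complex) \<Rightarrow>
    'g :: complex_lie_algebra \<Rightarrow> 'g vac \<Rightarrow> 'g vac" where
  "eps_vac P u z \<delta> a Y = ident P {} (eps P u z \<delta> a (unident P {} Y))"

definition iota_vac :: "sphere \<Rightarrow> complex mero \<Rightarrow> sphere \<Rightarrow> (complex mero \<Rightarrow> complex) \<Rightarrow>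
    'g :: metrized_lie_algebra \<Rightarrow> 'g vac \<Rightarrow> 'g vac" where
  "iota_vac P u z \<delta> a Y = ident P {z} (iota P u z \<delta> a (unident P {z} Y))"

definition jay_vac :: "sphere \<Rightarrow> complex mero \<Rightarrow> sphere \<Rightarrow> (complex mero \<Rightarrow> complex) \<Rightarrow>
    'g :: metrized_lie_algebra \<Rightarrow> 'g vac \<Rightarrow> 'g vac" where
  "jay_vac P u z \<delta> a Y = ident P {} (jay P u z \<delta> a (unident P {z} Y))"

text \<open>\<open>R : vac M \<rightarrow> vac M'\<close> is the restriction of \<open>T : vac L \<rightarrow> vac L'\<close> to the subspaces
  \<open>vac M \<subseteq> vac L\<close> and \<open>vac M' \<subseteq> vac L'\<close>, where \<open>M \<subseteq> L\<close> and \<open>M' \<subseteq> L'\<close>.\<close>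

definition is_restriction :: "'g :: complex_lie_algebra mero set \<Rightarrow> 'g mero set \<Rightarrow>
    'g mero set \<Rightarrow> 'g mero set \<Rightarrow> ('g vac \<Rightarrow> 'g vac) \<Rightarrow> ('g vac \<Rightarrow> 'g vac) \<Rightarrow> bool" where
  "is_restriction M M' L L' T R \<longleftrightarrow>
     (\<forall>Y\<in>vac M. R Y \<in> vac M' \<and> vac_map L' (R Y) = T (vac_map L Y))"

end

theory Submission
  imports Defs
begin

text \<open>
By Liouville's theorem, \<open>u = c p + d\<close> for the standard function \<open>p\<close> with a simple pole at \<open>P\<close>
(\<open>coordinate_normal_form\<close>); the other coordinate is \<open>u' = 1 / u\<close>. A partial fraction
computation then shows that the kernels \<open>du\<^sub>z / (u - u(z))\<close> and \<open>du'\<^sub>z / (u' - u'(z))\<close>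
differ by the constant \<open>s = du'\<^sub>z / u'(z)\<close>. The maps \<open>\<epsilon>\<close> are left multiplications by
\<open>a\<close> times the kernel, which gives the first equality.

For \<open>\<iota>\<close>, everything is done on representatives, that is, on noncommutative polynomials in
meromorphic maps. One recursion over words defines an operator \<open>J\<close> with
\<open>[J a, \<alpha>] = D a \<alpha> - (a, d\<alpha>(z)) + J [a, \<alpha>(z)]\<close>, where \<open>D a \<alpha>\<close> is the combination
\<open>- [a h, \<alpha>] + [a, \<alpha>(z)] h\<close> for the kernel \<open>h\<close>, regular at \<open>z\<close>. The Jacobi
identity, the invariance of the form and the Leibniz rule make the right hand side a cocycle in
\<open>\<alpha>\<close>, so that \<open>J\<close> descends to enveloping algebras (\<open>comm_data.J_rel_ideal\<close>). On maps that
vanish at \<open>P\<close> it is \<open>\<iota>\<close> (\<open>iota_on_class\<close>). On constant maps both correction terms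
vanish, so that \<open>J\<close> also descends to the quotients by \<open>\<langle>U\<^sup>+ \<g>\<rangle>\<close>; it is then the
operator obtained from \<open>\<iota>\<close> by transport (\<open>iota_vac_vcl\<close>).

The transport rests on the decomposition of the maps regular at \<open>P\<close> as a semidirect product of the
ideal of the vanishing ones with the constants. The vanishing maps act on their own enveloping
algebra by left multiplication, the constants act on it by derivations, and the action of an element
on \<open>1\<close> gives the inverse of the identification (\<open>red\<close>).

Finally, adding a constant \<open>- s\<close> to the kernel changes \<open>J a\<close> by left multiplication by \<open>s a\<close>.
The commutators of both sides with any \<open>\<alpha>\<close> agree, and on \<open>1\<close> both sides give \<open>0\<close> because
\<open>a\<close> lies in \<open>\<langle>U\<^sup>+ \<g>\<rangle>\<close> (\<open>two_kernels.J_shift\<close>). This is the second equality, and the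
two shifts cancel in \<open>j = \<epsilon> + \<iota>\<close>.
\<close>

section \<open>Linear maps on free algebras\<close>

type_synonym 'l ncpoly = "'l list \<Rightarrow>\<^sub>0 complex"

definition word :: "'l list \<Rightarrow> 'l ncpoly" where
  "word w = Poly_Mapping.single w 1"

definition lin :: "('l list \<Rightarrow> 'm ncpoly) \<Rightarrow> 'l ncpoly \<Rightarrow> 'm ncpoly" where
  "lin T p = (\<Sum>w\<in>Poly_Mapping.keys p. scal (Poly_Mapping.lookup p w) * T w)"

lemma word_Nil [simp]: "word [] = 1"
  by (simp add: word_def zero_list_def flip: single_one)

lemma word_Cons: "word (x # w) = gen x * word w"
  by (simp add: word_def gen_def mult_single plus_list_def)

lemma word_append: "word (v @ w) = word v * word w"
  by (simp add: word_def mult_single plus_list_def)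

lemma word_singleton: "word [x] = gen x"
  by (simp add: word_def gen_def)

lemma scal_0 [simp]: "scal 0 = 0"
  by (simp add: scal_def)

lemma scal_1 [simp]: "scal 1 = 1"
  by (simp add: scal_def zero_list_def flip: single_one)

lemma scal_add: "scal (c + d) = scal c + scal d"
  by (simp add: scal_def single_add)

lemma scal_mult: "scal (c * d) = scal c * scal d"
  by (simp add: scal_def mult_single plus_list_def)

lemma scal_minus: "scal (- c) = - scal c"
  by (simp add: scal_def single_uminus)

lemma scal_diff: "scal (c - d) = scal c - scal d"
  by (simp add: scal_def single_diff)

lemma single_conv_word: "Poly_Mapping.single w c = scal c * word w"
  by (simp add: scal_def word_def mult_single plus_list_def)

lemma ncpoly_expand: "p = (\<Sum>w\<in>Poly_Mapping.keys p. scal (Poly_Mapping.lookup p w) * word w)"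
proof (rule poly_mapping_eqI)
  fix v
  have "(\<Sum>w\<in>Poly_Mapping.keys p. Poly_Mapping.lookup p w when w = v) =
      (Poly_Mapping.lookup p v)"
    by (auto simp: when_def in_keys_iff)
  then show "Poly_Mapping.lookup p v =
      Poly_Mapping.lookup (\<Sum>w\<in>Poly_Mapping.keys p. scal (Poly_Mapping.lookup p w) * word w) v"
    by (simp add: lookup_sum lookup_single flip: single_conv_word)
qed

lemma ncpoly_induct [case_names zero add monomial]:
  assumes "Q 0" "\<And>p q. Q p \<Longrightarrow> Q q \<Longrightarrow> Q (p + q)" "\<And>c w. Q (scal c * word w)"
  shows "Q (p :: 'l ncpoly)"
proof -
  have "Q (\<Sum>w\<in>A. scal (Poly_Mapping.lookup p w) * word w)" for A
    by (induction A rule: infinite_finite_induct) (auto intro: assms)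
  then show ?thesis
    by (subst ncpoly_expand)
qed

lemma scal_commute: "p * scal c = scal c * (p :: 'l ncpoly)"
proof (induction p rule: ncpoly_induct)
  case (monomial d w)
  show ?case
    by (simp add: scal_def word_def mult_single plus_list_def mult.commute)
qed (simp_all add: algebra_simps)

lemma scal_left_commute: "p * (scal c * q) = scal c * (p * (q :: 'l ncpoly))"
  by (metis mult.assoc scal_commute)

lemma lin_add: "lin T (p + q) = lin T p + lin T q"
proof -
  have *: "lin T r = (\<Sum>w\<in>Poly_Mapping.keys p \<union> Poly_Mapping.keys q. scal (Poly_Mapping.lookup r w) * T w)"
    if "Poly_Mapping.keys r \<subseteq> Poly_Mapping.keys p \<union> Poly_Mapping.keys q" for r
    unfolding lin_def
    by (rule sum.mono_neutral_left) (use that in \<open>auto simp: in_keys_iff\<close>)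
  show ?thesis
    by (subst (1 2 3) *) (auto simp: lookup_add scal_add distrib_right sum.distrib
        dest: subsetD[OF keys_add])
qed

lemma lin_0 [simp]: "lin T 0 = 0"
  by (simp add: lin_def)

lemma lin_monomial: "lin T (scal c * word w) = scal c * T w"
  by (cases "c = 0") (simp_all add: lin_def flip: single_conv_word)

lemma lin_word [simp]: "lin T (word w) = T w"
  using lin_monomial[of T 1 w] by simp

lemma lin_one [simp]: "lin T 1 = T []"
  using lin_word[of T "[]"] by simp

lemma lin_scal: "lin T (scal c * p) = scal c * lin T p"
proof (induction p rule: ncpoly_induct)
  case (monomial d w)
  show ?case
    using lin_monomial[of T "c * d" w] by (simp add: lin_monomial scal_mult mult.assoc)
qed (simp_all add: lin_add distrib_left)

lemma lin_minus: "lin T (- p) = - lin T p"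
  using lin_scal[of T "- 1" p] by (simp add: scal_minus)

lemma lin_diff: "lin T (p - q) = lin T p - lin T q"
  using lin_add[of T p "- q"] by (simp add: lin_minus)

lemma ncpoly_linear_ext:
  fixes F G :: "'l ncpoly \<Rightarrow> 'm ncpoly"
  assumes "\<And>p q. F (p + q) = F p + F q" "\<And>c p. F (scal c * p) = scal c * F p"
    and "\<And>p q. G (p + q) = G p + G q" "\<And>c p. G (scal c * p) = scal c * G p"
    and "\<And>w. F (word w) = G (word w)"
  shows "F p = G p"
proof (induction p rule: ncpoly_induct)
  case zero
  show ?case using assms(2)[of 0 0] assms(4)[of 0 0] by simp
qed (simp_all add: assms)

abbreviation free :: "'l set \<Rightarrow> 'l ncpoly set" where
  "free L \<equiv> carrier (free_alg L)"

lemma free_iff: "p \<in> free L \<longleftrightarrow> Poly_Mapping.keys p \<subseteq> lists L"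
  by (simp add: free_alg_def)

lemma free_alg_ops [simp]:
  "mult (free_alg L) = (*)" "one (free_alg L) = 1" "zero (free_alg L) = 0" "add (free_alg L) = (+)"
  by (simp_all add: free_alg_def)

lemma free_0 [simp]: "0 \<in> free L"
  by (simp add: free_iff)

lemma free_scal [simp]: "scal c \<in> free L"
  by (simp add: free_iff scal_def)

lemma free_1 [simp]: "1 \<in> free L"
  using free_scal[of 1] by simp

lemma free_word: "w \<in> lists L \<Longrightarrow> word w \<in> free L"
  by (simp add: free_iff word_def)

lemma free_gen: "x \<in> L \<Longrightarrow> gen x \<in> free L"
  by (simp add: free_iff gen_def)

lemma free_add: "p \<in> free L \<Longrightarrow> q \<in> free L \<Longrightarrow> p + q \<in> free L"
  using keys_add[of p q] by (auto simp: free_iff)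

lemma free_mult: "p \<in> free L \<Longrightarrow> q \<in> free L \<Longrightarrow> p * q \<in> free L"
  using keys_mult[of p q] by (fastforce simp: free_iff plus_list_def)

lemma free_minus: "p \<in> free L \<Longrightarrow> - p \<in> free L"
  by (simp add: free_iff)

lemma free_diff: "p \<in> free L \<Longrightarrow> q \<in> free L \<Longrightarrow> p - q \<in> free L"
  using free_add[of p L "- q"] free_minus[of q L] by simp

lemmas free_closed = free_add free_mult free_minus free_diff free_gen

lemma free_mono: "L \<subseteq> M \<Longrightarrow> p \<in> free L \<Longrightarrow> p \<in> free M"
  by (auto simp: free_iff)

text \<open>Words grow at their left end here, which is the direction of all the recursions below: an operator
is known once its value at \<open>1\<close> and its commutators with the generators are known.\<close>

lemma free_induct [consumes 1, case_names zero one add scal gen]: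
  assumes "p \<in> free L"
    and Q0: "Q 0" and Q1: "Q 1"
    and Qadd: "\<And>p q. p \<in> free L \<Longrightarrow> q \<in> free L \<Longrightarrow> Q p \<Longrightarrow> Q q \<Longrightarrow> Q (p + q)"
    and Qscal: "\<And>c p. p \<in> free L \<Longrightarrow> Q p \<Longrightarrow> Q (scal c * p)"
    and Qgen: "\<And>x p. x \<in> L \<Longrightarrow> p \<in> free L \<Longrightarrow> Q p \<Longrightarrow> Q (gen x * p)"
  shows "Q p"
proof -
  have "Q (word w)" if "w \<in> lists L" for w
    using that by (induction w) (auto simp: Q1 word_Cons intro: Qgen free_word)
  then have mono: "Q (scal c * word w)" if "w \<in> lists L" for c w
    using that by (simp add: Qscal free_word)
  have "(\<Sum>w\<in>A. scal (Poly_Mapping.lookup p w) * word w) \<in> free L \<and>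
      Q (\<Sum>w\<in>A. scal (Poly_Mapping.lookup p w) * word w)" if "finite A" "A \<subseteq> lists L" for A
    using that
  proof (induction A rule: finite_induct)
    case (insert w A)
    then show ?case
      by (auto intro!: free_add free_mult Qadd mono free_word)
  qed (simp add: Q0)
  from this[of "Poly_Mapping.keys p"] show ?thesis
    using assms(1) ncpoly_expand[of p] by (simp add: free_iff)
qed

text \<open>For families of linear maps, indexed by \<open>a\<close>, with values in a subspace \<open>I\<close> that is to be shown:
only the commutation with generators needs an argument. Differences of two sides of a congruence are
families of this kind.\<close>

lemma linear_mod_induct [consumes 1, case_names add scal closed_add closed_scal one gen]:
  fixes F :: "'b \<Rightarrow> 'l ncpoly \<Rightarrow> 'm ncpoly"
  assumes p: "p \<in> free L"
    and lin: "\<And>a p q. F a (p + q) = F a p + F a q" "\<And>a k p. F a (scal k * p) = scal k * F a p"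
    and I: "\<And>p q. p \<in> I \<Longrightarrow> q \<in> I \<Longrightarrow> p + q \<in> I" "\<And>k p. p \<in> I \<Longrightarrow> scal k * p \<in> I"
    and one: "\<And>a. F a 1 \<in> I"
    and gen: "\<And>a x p. x \<in> L \<Longrightarrow> p \<in> free L \<Longrightarrow> (\<And>a. F a p \<in> I) \<Longrightarrow> F a (gen x * p) \<in> I"
  shows "F a p \<in> I"
  using p
proof (induction arbitrary: a rule: free_induct)
  case zero
  show ?case
    using I(2)[OF one[of a], of 0] lin(2)[of a 0 1] by simp
qed (simp_all add: lin I one gen)

section \<open>The ideal of an enveloping algebra\<close>

definition lie_subalgebra :: "'l :: complex_lie_algebra set \<Rightarrow> bool" where
  "lie_subalgebra L \<longleftrightarrow> 0 \<in> L \<and> (\<forall>x\<in>L. \<forall>y\<in>L. x + y \<in> L) \<and> (\<forall>c. \<forall>x\<in>L. c *\<^sub>C x \<in> L) \<and>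
     (\<forall>x\<in>L. \<forall>y\<in>L. lie x y \<in> L)"

text \<open>The two-sided ideal of relations in a form suited to induction. Right factors are attached to the
relations, left factors come one generator at a time; so an operator with given commutators with
the generators preserves the ideal as soon as it maps every \<open>r * q\<close> into it.\<close>

inductive_set rel_ideal :: "'l :: complex_lie_algebra set \<Rightarrow> 'l ncpoly set" for L where
  zero: "0 \<in> rel_ideal L"
| rel: "r \<in> env_rels L \<Longrightarrow> q \<in> free L \<Longrightarrow> r * q \<in> rel_ideal L"
| add: "p \<in> rel_ideal L \<Longrightarrow> q \<in> rel_ideal L \<Longrightarrow> p + q \<in> rel_ideal L"
| scal: "p \<in> rel_ideal L \<Longrightarrow> scal c * p \<in> rel_ideal L"
| gen: "x \<in> L \<Longrightarrow> p \<in> rel_ideal L \<Longrightarrow> gen x * p \<in> rel_ideal L"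

lemma env_rels_free: "lie_subalgebra L \<Longrightarrow> r \<in> env_rels L \<Longrightarrow> r \<in> free L"
  unfolding env_rels_def lie_subalgebra_def
  by (auto intro!: free_closed)

lemma rel_ideal_free:
  assumes "p \<in> rel_ideal L" "lie_subalgebra L"
  shows "p \<in> free L"
  using assms by (induction rule: rel_ideal.induct) (auto intro!: free_closed simp: env_rels_free)

lemma rel_ideal_minus: "p \<in> rel_ideal L \<Longrightarrow> - p \<in> rel_ideal L"
  using rel_ideal.scal[of p L "- 1"] by (simp add: scal_minus)

lemma rel_ideal_diff: "p \<in> rel_ideal L \<Longrightarrow> q \<in> rel_ideal L \<Longrightarrow> p - q \<in> rel_ideal L"
  using rel_ideal.add[of p L "- q"] by (simp add: rel_ideal_minus)

lemma rel_ideal_left: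
  assumes "p \<in> free L" "r \<in> rel_ideal L"
  shows "p * r \<in> rel_ideal L"
  using assms(1)
  by (induction rule: free_induct)
    (simp_all add: distrib_right mult.assoc assms(2) rel_ideal.intros)

lemma rel_ideal_right:
  assumes "r \<in> rel_ideal L" "p \<in> free L"
  shows "r * p \<in> rel_ideal L"
  using assms(1)
  by (induction rule: rel_ideal.induct)
    (simp_all add: distrib_right mult.assoc rel_ideal.intros free_mult assms(2))

lemma rel_ideal_rel: "r \<in> env_rels L \<Longrightarrow> r \<in> rel_ideal L"
  using rel_ideal.rel[of r L 1] by simp

lemma env_rels_mono: "L \<subseteq> M \<Longrightarrow> env_rels L \<subseteq> env_rels M"
  unfolding env_rels_def by (intro Un_mono Collect_mono) fast+

lemma rel_ideal_mono:
  assumes "p \<in> rel_ideal L" "L \<subseteq> M"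
  shows "p \<in> rel_ideal M"
  using assms
proof (induction rule: rel_ideal.induct)
  case (rel r q)
  then have "r \<in> env_rels M"
    using env_rels_mono[of L M] by blast
  with rel show ?case by (auto intro: rel_ideal.rel free_mono)
qed (auto intro: rel_ideal.intros)

lemma rel_ideal_gen_add:
  "x \<in> L \<Longrightarrow> y \<in> L \<Longrightarrow> gen (x + y) - (gen x + gen y) \<in> rel_ideal L"
  by (rule rel_ideal_rel) (unfold env_rels_def, blast)

lemma rel_ideal_gen_scal: "x \<in> L \<Longrightarrow> gen (c *\<^sub>C x) - scal c * gen x \<in> rel_ideal L"
  by (rule rel_ideal_rel) (unfold env_rels_def, blast)

lemma rel_ideal_gen_lie:
  "x \<in> L \<Longrightarrow> y \<in> L \<Longrightarrow> gen x * gen y - gen y * gen x - gen (lie x y) \<in> rel_ideal L"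
  by (rule rel_ideal_rel) (unfold env_rels_def, blast)

lemma rel_ideal_gen_0: "lie_subalgebra L \<Longrightarrow> gen 0 \<in> rel_ideal L"
  using rel_ideal_minus[OF rel_ideal_gen_add[of 0 L 0]] by (simp add: lie_subalgebra_def del: minus_diff_eq)

lemma ring_free_alg: "ring (free_alg L)"
proof (rule ringI)
  show "abelian_group (free_alg L)"
  proof (rule abelian_groupI)
    fix p assume "p \<in> free L"
    then show "\<exists>q\<in>free L. q \<oplus>\<^bsub>free_alg L\<^esub> p = \<zero>\<^bsub>free_alg L\<^esub>"
      by (intro bexI[of _ "- p"]) (auto intro: free_minus)
  qed (auto intro: free_add simp: add.assoc add.commute)
  show "monoid (free_alg L)"
    by (rule monoidI) (auto intro: free_mult simp: mult.assoc)
qed (simp_all add: distrib_left distrib_right)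

lemma free_alg_a_inv:
  assumes "p \<in> free L"
  shows "a_inv (free_alg L) p = - p"
proof -
  interpret ring "free_alg L" by (rule ring_free_alg)
  show ?thesis
    using minus_equality[of "- p" p] assms by (auto intro: free_minus)
qed

lemma env_ideal_eq:
  assumes "lie_subalgebra L"
  shows "env_ideal L = rel_ideal L"
proof
  interpret ring "free_alg L" by (rule ring_free_alg)
  have rels: "env_rels L \<subseteq> free L"
    using assms env_rels_free by blast
  have "ideal (rel_ideal L) (free_alg L)"
  proof (rule idealI)
    show "ring (free_alg L)" by (rule ring_free_alg)
    show "subgroup (rel_ideal L) (add_monoid (free_alg L))"
    proof (rule add.subgroupI)
      show "rel_ideal L \<subseteq> free L"
        using assms rel_ideal_free[of _ L] by blast
      show "rel_ideal L \<noteq> {}"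
        using rel_ideal.zero by blast
    next
      fix p assume "p \<in> rel_ideal L"
      then show "a_inv (free_alg L) p \<in> rel_ideal L"
        using assms by (simp add: free_alg_a_inv rel_ideal_free rel_ideal_minus)
    qed (simp add: rel_ideal.add)
  qed (simp_all add: rel_ideal_left rel_ideal_right)
  then show "env_ideal L \<subseteq> rel_ideal L"
    unfolding env_ideal_def by (rule genideal_minimal) (auto intro: rel_ideal_rel)
  interpret I: ideal "env_ideal L" "free_alg L"
    unfolding env_ideal_def by (rule genideal_ideal[OF rels])
  have sub: "env_rels L \<subseteq> env_ideal L"
    unfolding env_ideal_def by (rule genideal_self[OF rels])
  show "rel_ideal L \<subseteq> env_ideal L"
  proof
    fix p assume "p \<in> rel_ideal L"
    then show "p \<in> env_ideal L"
    proof (induction rule: rel_ideal.induct)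
      case zero
      show ?case using I.zero_closed by simp
    next
      case (rel r q)
      then show ?case using I.I_r_closed[of r q] sub by auto
    next
      case (add p q)
      then show ?case using I.a_closed[of p q] by simp
    next
      case (scal p c)
      then show ?case using I.I_l_closed[of p "scal c"] by simp
    next
      case (gen x p)
      then show ?case using I.I_l_closed[of p "gen x"] free_gen[of x L] by simp
    qed
  qed
qed

lemma ideal_rel_ideal: "lie_subalgebra L \<Longrightarrow> ideal (rel_ideal L) (free_alg L)"
  using ring.genideal_ideal[OF ring_free_alg, of "env_rels L" L] env_rels_free[of L]
  by (auto simp flip: env_ideal_eq simp: env_ideal_def)

lemma ring_env: "lie_subalgebra L \<Longrightarrow> ring (env L)"
  unfolding env_def env_ideal_eq by (rule ideal.quotient_is_ring[OF ideal_rel_ideal])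

lemma env_class_hom: "lie_subalgebra L \<Longrightarrow> env_class L \<in> ring_hom (free_alg L) (env L)"
  using ideal.rcos_ring_hom[OF ideal_rel_ideal, of L]
  unfolding env_def env_class_def[abs_def] by (simp add: env_ideal_eq)

lemma carrier_env: "lie_subalgebra L \<Longrightarrow> carrier (env L) = env_class L ` free L"
  unfolding env_def env_class_def[abs_def] FactRing_def A_RCOSETS_def' by auto

lemma env_class_mult: "lie_subalgebra L \<Longrightarrow> p \<in> free L \<Longrightarrow> q \<in> free L \<Longrightarrow>
    env_class L p \<otimes>\<^bsub>env L\<^esub> env_class L q = env_class L (p * q)"
  using ring_hom_mult[OF env_class_hom, of L p q] by simp

lemma env_class_add: "lie_subalgebra L \<Longrightarrow> p \<in> free L \<Longrightarrow> q \<in> free L \<Longrightarrow>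
    env_class L p \<oplus>\<^bsub>env L\<^esub> env_class L q = env_class L (p + q)"
  using ring_hom_add[OF env_class_hom, of L p q] by simp

lemma env_class_one: "lie_subalgebra L \<Longrightarrow> \<one>\<^bsub>env L\<^esub> = env_class L 1"
  using ring_hom_one[OF env_class_hom, of L] by simp

lemma env_class_zero: "lie_subalgebra L \<Longrightarrow> \<zero>\<^bsub>env L\<^esub> = env_class L 0"
  using ring_hom_zero[OF env_class_hom ring_free_alg ring_env, of L] by simp

lemma env_class_in [intro]: "lie_subalgebra L \<Longrightarrow> p \<in> free L \<Longrightarrow> env_class L p \<in> carrier (env L)"
  by (simp add: carrier_env)

lemma env_class_a_inv:
  assumes "lie_subalgebra L" "p \<in> free L"
  shows "\<ominus>\<^bsub>env L\<^esub> env_class L p = env_class L (- p)"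
proof -
  interpret ring "env L" by (rule ring_env[OF assms(1)])
  show ?thesis
    using assms by (intro minus_equality) (auto simp: env_class_add env_class_zero free_minus)
qed

lemma env_class_diff: "lie_subalgebra L \<Longrightarrow> p \<in> free L \<Longrightarrow> q \<in> free L \<Longrightarrow>
    env_class L p \<ominus>\<^bsub>env L\<^esub> env_class L q = env_class L (p - q)"
  by (simp add: a_minus_def env_class_a_inv env_class_add free_minus)

lemma env_class_eq_iff:
  assumes "lie_subalgebra L" "p \<in> free L" "q \<in> free L"
  shows "env_class L p = env_class L q \<longleftrightarrow> p - q \<in> rel_ideal L"
proof -
  interpret ideal "rel_ideal L" "free_alg L" by (rule ideal_rel_ideal[OF assms(1)])
  have "p \<ominus>\<^bsub>free_alg L\<^esub> q = p - q"
    using assms by (simp add: a_minus_def free_alg_a_inv)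
  then show ?thesis
    using quotient_eq_iff_same_a_r_cos[OF ideal_rel_ideal[OF assms(1)] assms(2,3)] assms(1)
    by (simp add: env_class_def env_ideal_eq)
qed

lemma env_class_mem:
  assumes "lie_subalgebra L"
  shows "env_class L p = {r + p | r. r \<in> rel_ideal L}"
  by (auto simp: env_class_def env_ideal_eq assms a_r_coset_def')

lemma env_map_class:
  assumes "lie_subalgebra L" "lie_subalgebra M" "L \<subseteq> M" "p \<in> free L"
  shows "env_map M (env_class L p) = env_class M p"
proof -
  have "env_class M q = env_class M p" if q: "q \<in> env_class L p" for q
  proof -
    obtain r where r: "r \<in> rel_ideal L" "q = r + p"
      using q unfolding env_class_mem[OF assms(1)] by blast
    have "p \<in> free M" "r + p \<in> free M" "r \<in> rel_ideal M"
      using r assms by (auto intro: rel_ideal_mono free_add rel_ideal_free free_mono)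
    then show ?thesis
      using assms r by (simp add: env_class_eq_iff)
  qed
  moreover have "p \<in> env_class L p"
    using assms(1) rel_ideal.zero by (force simp: env_class_mem)
  ultimately show ?thesis
    unfolding env_map_def by blast
qed

section \<open>The left module of vacuum classes\<close>

lemma mconst_add: "mconst (a + b) = mconst a + mconst b"
  by transfer (simp add: mero_eq_def is_mero_const)

lemma mconst_scaleC: "mconst (c *\<^sub>C a) = c *\<^sub>C mconst a"
  by transfer (simp add: mero_eq_def is_mero_const)

lemma mconst_lie: "mconst (lie a b) = lie (mconst a) (mconst b)"
  by transfer (simp add: mero_eq_def is_mero_const)

lemma mconst_0: "mconst 0 = 0"
  by transfer (simp add: mero_eq_def is_mero_const)

lemma lie_subalgebra_const: "lie_subalgebra (range mconst)"
  unfolding lie_subalgebra_def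
  by (auto simp flip: mconst_add mconst_scaleC mconst_lie mconst_0)

text \<open>The preimage, in the free algebra, of the left ideal generated by the augmentation ideal of the
constants: a nonempty word in constants ends in a constant, hence the constants themselves are
enough as generators.\<close>

inductive_set vac_ideal :: "'g :: complex_lie_algebra mero set \<Rightarrow> 'g mero ncpoly set" for L where
  rel: "p \<in> rel_ideal L \<Longrightarrow> p \<in> vac_ideal L"
| const: "gen (mconst a) \<in> vac_ideal L"
| add: "p \<in> vac_ideal L \<Longrightarrow> q \<in> vac_ideal L \<Longrightarrow> p + q \<in> vac_ideal L"
| scal: "p \<in> vac_ideal L \<Longrightarrow> scal c * p \<in> vac_ideal L"
| gen: "x \<in> L \<Longrightarrow> p \<in> vac_ideal L \<Longrightarrow> gen x * p \<in> vac_ideal L"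

definition const_subalgebra :: "'g :: complex_lie_algebra mero set \<Rightarrow> bool" where
  "const_subalgebra L \<longleftrightarrow> lie_subalgebra L \<and> range mconst \<subseteq> L"

lemma const_subalgebra_D:
  "const_subalgebra L \<Longrightarrow> lie_subalgebra L"
  "const_subalgebra L \<Longrightarrow> mconst a \<in> L"
  by (auto simp: const_subalgebra_def)

lemma vac_ideal_free:
  assumes "p \<in> vac_ideal L" "const_subalgebra L"
  shows "p \<in> free L"
  using assms
  by (induction rule: vac_ideal.induct)
    (auto intro!: free_closed simp: rel_ideal_free const_subalgebra_D)

lemma vac_ideal_0: "0 \<in> vac_ideal L"
  by (intro vac_ideal.rel rel_ideal.zero)

lemma vac_ideal_minus: "p \<in> vac_ideal L \<Longrightarrow> - p \<in> vac_ideal L"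
  using vac_ideal.scal[of p L "- 1"] by (simp add: scal_minus)

lemma vac_ideal_diff: "p \<in> vac_ideal L \<Longrightarrow> q \<in> vac_ideal L \<Longrightarrow> p - q \<in> vac_ideal L"
  using vac_ideal.add[of p L "- q"] by (simp add: vac_ideal_minus)

lemma vac_ideal_left:
  assumes "p \<in> free L" "r \<in> vac_ideal L"
  shows "p * r \<in> vac_ideal L"
  using assms(1)
  by (induction rule: free_induct)
    (simp_all add: distrib_right mult.assoc assms(2) vac_ideal.intros vac_ideal_0)

lemma vac_ideal_mono:
  assumes "p \<in> vac_ideal L" "L \<subseteq> M"
  shows "p \<in> vac_ideal M"
  using assms by (induction rule: vac_ideal.induct) (auto intro: vac_ideal.intros rel_ideal_mono)

lemma lookup_gen_mult_Nil: "Poly_Mapping.lookup (gen x * p) [] = 0"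
proof (induction p rule: ncpoly_induct)
  case (monomial c w)
  have "gen x * (scal c * word w) = Poly_Mapping.single (x # w) c"
    by (simp add: gen_def scal_def word_def mult_single plus_list_def)
  then show ?case by (simp add: lookup_single)
qed (simp_all add: distrib_left lookup_add)

lemma lookup_scal_mult: "Poly_Mapping.lookup (scal c * p) w = c * Poly_Mapping.lookup p w"
proof (induction p rule: ncpoly_induct)
  case (monomial d v)
  have "scal c * (scal d * word v) = Poly_Mapping.single v (c * d)"
    by (simp add: scal_def word_def mult_single plus_list_def)
  then show ?case by (simp add: lookup_single single_conv_word[symmetric] when_def)
qed (simp_all add: distrib_left lookup_add)

text \<open>Each relation is a sum of words of positive length, and right multiplication keeps their first
letters.\<close>

lemma rel_ideal_constant_term:
  assumes "p \<in> rel_ideal L"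
  shows "Poly_Mapping.lookup p [] = 0"
  using assms
proof (induction rule: rel_ideal.induct)
  case (rel r q)
  then show ?case
    unfolding env_rels_def
    by (auto simp: left_diff_distrib distrib_right lookup_minus lookup_add lookup_gen_mult_Nil
        mult.assoc lookup_scal_mult)
qed (simp_all add: lookup_add lookup_scal_mult lookup_gen_mult_Nil)

lemma augmentation_class:
  assumes "lie_subalgebra L"
  shows "augmentation (env_class L p) = Poly_Mapping.lookup p []"
  unfolding augmentation_def env_class_mem[OF assms]
proof (rule the_equality)
  show "\<forall>q\<in>{r + p |r. r \<in> rel_ideal L}. Poly_Mapping.lookup q [] = Poly_Mapping.lookup p []"
    by (auto simp: lookup_add rel_ideal_constant_term)
next
  fix c assume "\<forall>q\<in>{r + p |r. r \<in> rel_ideal L}. Poly_Mapping.lookup q [] = c"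
  then show "c = Poly_Mapping.lookup p []"
    using rel_ideal.zero[of L] by force
qed

lemma aug_free_in_vac_ideal:
  assumes "const_subalgebra L" "q \<in> free (range mconst)" "Poly_Mapping.lookup q [] = 0"
  shows "q \<in> vac_ideal L"
proof -
  have word: "word w \<in> vac_ideal L" if w: "w \<in> lists (range mconst)" "w \<noteq> []" for w :: "'a mero list"
  proof -
    obtain v a where v: "w = v @ [mconst a]" "v \<in> lists (range mconst)"
      using w by (cases w rule: rev_cases) auto
    then have "v \<in> lists L"
      using assms(1) lists_mono unfolding const_subalgebra_def by blast
    then show ?thesis
      using v by (simp add: word_append word_singleton vac_ideal_left free_word vac_ideal.const)
  qed
  have "(\<Sum>w\<in>A. scal (Poly_Mapping.lookup q w) * word w) \<in> vac_ideal L"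
    if "A \<subseteq> Poly_Mapping.keys q" for A
    using that
  proof (induction A rule: infinite_finite_induct)
    case (insert w A)
    then have "w \<in> lists (range mconst)" "w \<noteq> []"
      using assms(2,3) by (auto simp: free_iff in_keys_iff)
    then show ?case
      using insert by (auto intro!: vac_ideal.add vac_ideal.scal word)
  qed (auto simp: vac_ideal_0)
  then show ?thesis
    by (subst ncpoly_expand) simp
qed

lemma const_ideal_gens:
  assumes L: "const_subalgebra L"
  shows "{X \<otimes>\<^bsub>env L\<^esub> s | X s. X \<in> carrier (env L) \<and> s \<in> env_map L ` aug_ideal (range mconst)} =
    {env_class L (p * q) | p q. p \<in> free L \<and> q \<in> free (range mconst) \<and> Poly_Mapping.lookup q [] = 0}"
    (is "?A = ?B")
proof -
  note LD = const_subalgebra_D[OF L]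
  have C: "range mconst \<subseteq> L" using L by (simp add: const_subalgebra_def)
  have aug: "aug_ideal (range mconst) =
      env_class (range mconst) ` {q \<in> free (range mconst). Poly_Mapping.lookup q [] = 0}"
    unfolding aug_ideal_def carrier_env[OF lie_subalgebra_const]
    by (auto simp: augmentation_class[OF lie_subalgebra_const])
  have eq: "env_class L p \<otimes>\<^bsub>env L\<^esub> env_map L (env_class (range mconst) q) = env_class L (p * q)"
    if "p \<in> free L" "q \<in> free (range mconst)" for p q
    using that LD(1) C free_mono[OF C]
    by (simp add: env_map_class[OF lie_subalgebra_const] env_class_mult)
  show ?thesis
  proof (intro equalityI subsetI)
    fix Y assume "Y \<in> ?A"
    then obtain p q where "Y = env_class L (p * q)"
        "p \<in> free L" "q \<in> free (range mconst)" "Poly_Mapping.lookup q [] = 0"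
      unfolding aug carrier_env[OF LD(1)] by (auto simp: eq)
    then show "Y \<in> ?B"
      by blast
  next
    fix Y assume "Y \<in> ?B"
    then obtain p q where "Y = env_class L p \<otimes>\<^bsub>env L\<^esub> env_map L (env_class (range mconst) q)"
        "p \<in> free L" "q \<in> free (range mconst)" "Poly_Mapping.lookup q [] = 0"
      by (auto simp: eq)
    then show "Y \<in> ?A"
      unfolding aug carrier_env[OF LD(1)] by blast
  qed
qed

text \<open>The left ideal is defined as an additive span; it has to be shown first that the span is stable
under left multiplication.\<close>

lemma const_ideal_eq:
  assumes L: "const_subalgebra L"
  shows "const_ideal L = env_class L ` vac_ideal L"
proof -
  note LD = const_subalgebra_D[OF L]
  have C: "range mconst \<subseteq> L" using L by (simp add: const_subalgebra_def)
  interpret ring "env L" by (rule ring_env[OF LD(1)])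
  define G where "G = {env_class L (p * q) | p q. p \<in> free L \<and> q \<in> free (range mconst) \<and>
    Poly_Mapping.lookup q [] = 0}"
  have eq: "const_ideal L = generate (add_monoid (env L)) G"
    unfolding const_ideal_def left_ideal_def const_ideal_gens[OF L] G_def ..
  have Gc: "G \<subseteq> carrier (env L)"
    unfolding G_def using LD C by (auto intro!: env_class_in free_mult intro: free_mono)
  have clos: "Y \<in> carrier (env L)" if "Y \<in> generate (add_monoid (env L)) G" for Y
    using add.generate_in_carrier[of G Y] Gc that by simp
  have left: "env_class L p \<otimes>\<^bsub>env L\<^esub> Y \<in> generate (add_monoid (env L)) G"
    if "p \<in> free L" "Y \<in> generate (add_monoid (env L)) G" for p Y
    using that(2)
  proof (induction Y rule: generate.induct)
    case one
    then show ?case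
      using that(1) LD generate.one[of "add_monoid (env L)" G] by (simp add: env_class_in)
  next
    case (incl h)
    then obtain p' q where h: "h = env_class L (p' * q)" "p' \<in> free L" "q \<in> free (range mconst)"
        "Poly_Mapping.lookup q [] = 0"
      unfolding G_def by blast
    then have "env_class L p \<otimes>\<^bsub>env L\<^esub> h = env_class L ((p * p') * q)"
      using that(1) LD C free_mono[OF C] by (simp add: env_class_mult free_mult mult.assoc)
    then show ?case
      using h that(1) by (intro generate.incl) (auto simp: G_def intro: free_mult)
  next
    case (inv h)
    then obtain p' q where h: "h = env_class L (p' * q)" "p' \<in> free L" "q \<in> free (range mconst)"
        "Poly_Mapping.lookup q [] = 0"
      unfolding G_def by blast
    then have "env_class L p \<otimes>\<^bsub>env L\<^esub> (\<ominus>\<^bsub>env L\<^esub> h) = env_class L ((- p * p') * q)"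
      using that(1) LD C free_mono[OF C]
      by (simp add: env_class_a_inv env_class_mult free_mult free_minus mult.assoc)
    then have "env_class L p \<otimes>\<^bsub>env L\<^esub> inv\<^bsub>add_monoid (env L)\<^esub> h = env_class L ((- p * p') * q)"
      unfolding a_inv_def .
    then show ?case
      using h free_mult[OF free_minus[OF that(1)] h(2)] unfolding G_def
      by (metis (mono_tags, lifting) generate.incl mem_Collect_eq)
  next
    case (eng h1 h2)
    then show ?case
      using generate.eng[OF eng.IH] that(1) LD clos by (simp add: r_distr env_class_in)
  qed
  show ?thesis
  proof
    show "const_ideal L \<subseteq> env_class L ` vac_ideal L"
    proof
      fix X assume "X \<in> const_ideal L"
      then have "X \<in> generate (add_monoid (env L)) G"
        by (simp add: eq)
      then show "X \<in> env_class L ` vac_ideal L"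
      proof (induction X rule: generate.induct)
        case one
        then show ?case
          using LD vac_ideal_0 by (auto simp: env_class_zero)
      next
        case (incl h)
        then show ?case
          using L by (auto simp: G_def intro!: imageI vac_ideal_left aug_free_in_vac_ideal)
      next
        case (inv h)
        then obtain p where p: "h = env_class L p" "p \<in> vac_ideal L"
          using L by (auto simp: G_def intro!: vac_ideal_left aug_free_in_vac_ideal)
        then have "\<ominus>\<^bsub>env L\<^esub> h = env_class L (- p)"
          using L LD by (simp add: env_class_a_inv vac_ideal_free)
        then have "inv\<^bsub>add_monoid (env L)\<^esub> h = env_class L (- p)"
          unfolding a_inv_def .
        then show ?case
          using p vac_ideal_minus by blast
      next
        case (eng h1 h2)
        then obtain p q where pq: "h1 = env_class L p" "p \<in> vac_ideal L" "h2 = env_class L q"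
            "q \<in> vac_ideal L"
          by blast
        then have "h1 \<otimes>\<^bsub>add_monoid (env L)\<^esub> h2 = env_class L (p + q)"
          using L LD by (simp add: env_class_add vac_ideal_free)
        then show ?case
          using pq vac_ideal.add by blast
      qed
    qed
    show "env_class L ` vac_ideal L \<subseteq> const_ideal L"
    proof (rule image_subsetI)
      fix p assume "p \<in> vac_ideal L"
      then show "env_class L p \<in> const_ideal L"
        unfolding eq
      proof (induction rule: vac_ideal.induct)
        case (rel p)
        then have "env_class L p = \<zero>\<^bsub>env L\<^esub>"
          using LD by (simp add: env_class_zero env_class_eq_iff rel_ideal_free)
        then show ?case
          using generate.one[of "add_monoid (env L)" G] by simp
      next
        case (const a)
        have "env_class L (gen (mconst a)) = env_class L (1 * gen (mconst a))"
          by simp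
        moreover have "Poly_Mapping.lookup (gen (mconst a)) [] = 0"
          using lookup_gen_mult_Nil[of "mconst a" 1] by simp
        ultimately show ?case
          unfolding G_def using free_gen[of "mconst a" "range mconst"] free_1[of L]
          by (intro generate.incl) blast
      next
        case (add p q)
        then show ?case
          using generate.eng[OF add.IH] L LD by (simp add: env_class_add vac_ideal_free)
      next
        case (scal p c)
        then show ?case
          using left[of "scal c" "env_class L p"] L LD by (simp add: env_class_mult vac_ideal_free)
      next
        case (gen x p)
        then show ?case
          using left[of "gen x" "env_class L p"] L LD by (simp add: env_class_mult vac_ideal_free free_gen)
      qed
    qed
  qed
qed

text \<open>An element of the quotient is a coset of cosets. From here on it is handled through a
representative in the free algebra.\<close>

definition vcl :: "'g :: complex_lie_algebra mero set \<Rightarrow> 'g mero ncpoly \<Rightarrow> 'g vac" where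
  "vcl L p = vac_class L (env_class L p)"

context
  fixes L :: "'g :: complex_lie_algebra mero set"
  assumes L: "const_subalgebra L"
begin

lemmas LD = const_subalgebra_D[OF L]

lemma vcl_eq_set:
  assumes "p \<in> free L"
  shows "vcl L p = {env_class L (r + p) | r. r \<in> vac_ideal L}"
  unfolding vcl_def vac_class_def const_ideal_eq[OF L] a_r_coset_def'
  using assms L LD by (auto simp: env_class_add vac_ideal_free)

lemma vcl_subset:
  assumes "p \<in> free L" "q \<in> free L" "p - q \<in> vac_ideal L"
  shows "vcl L p \<subseteq> vcl L q"
proof
  fix X assume "X \<in> vcl L p"
  then obtain r where "X = env_class L (r + p)" "r \<in> vac_ideal L"
    using assms by (auto simp: vcl_eq_set)
  then have "X = env_class L ((r + (p - q)) + q)" "r + (p - q) \<in> vac_ideal L"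
    using assms(3) vac_ideal.add by auto
  then show "X \<in> vcl L q"
    unfolding vcl_eq_set[OF assms(2)] by blast
qed

lemma vcl_eq_iff:
  assumes "p \<in> free L" "q \<in> free L"
  shows "vcl L p = vcl L q \<longleftrightarrow> p - q \<in> vac_ideal L"
proof
  assume "vcl L p = vcl L q"
  moreover have "env_class L p \<in> vcl L p"
    using assms vac_ideal_0 by (force simp: vcl_eq_set)
  ultimately obtain r where r: "env_class L p = env_class L (r + q)" "r \<in> vac_ideal L"
    using assms by (auto simp: vcl_eq_set)
  then have "p - (r + q) \<in> rel_ideal L"
    using assms L LD by (simp add: env_class_eq_iff vac_ideal_free free_add)
  then have "p - (r + q) + r \<in> vac_ideal L"
    using r(2) by (rule vac_ideal.add[OF vac_ideal.rel])
  then show "p - q \<in> vac_ideal L"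
    by simp
next
  assume d: "p - q \<in> vac_ideal L"
  then have "q - p \<in> vac_ideal L"
    using vac_ideal_minus[OF d] by simp
  with d show "vcl L p = vcl L q"
    using assms by (intro equalityI vcl_subset)
qed

lemma vac_eq: "vac L = vcl L ` free L"
  unfolding vac_def A_RCOSETS_def' vcl_def[abs_def] vac_class_def carrier_env[OF LD(1)] by auto

lemma vac_add_vcl:
  assumes "p \<in> free L" "q \<in> free L"
  shows "vac_add L (vcl L p) (vcl L q) = vcl L (p + q)"
proof (intro equalityI subsetI)
  fix X assume "X \<in> vac_add L (vcl L p) (vcl L q)"
  then obtain r s where rs: "X = env_class L (r + p) \<oplus>\<^bsub>env L\<^esub> env_class L (s + q)"
      "r \<in> vac_ideal L" "s \<in> vac_ideal L"
    unfolding vac_add_def set_add_def' vcl_eq_set[OF assms(1)] vcl_eq_set[OF assms(2)] by blast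
  then have "X = env_class L ((r + s) + (p + q))"
    using assms L LD by (simp add: env_class_add vac_ideal_free free_add algebra_simps)
  then show "X \<in> vcl L (p + q)"
    using vac_ideal.add[OF rs(2,3)] unfolding vcl_eq_set[OF free_add[OF assms]] by blast
next
  fix X assume "X \<in> vcl L (p + q)"
  then obtain r where r: "X = env_class L (r + (p + q))" "r \<in> vac_ideal L"
    unfolding vcl_eq_set[OF free_add[OF assms]] by blast
  then have "X = env_class L (r + p) \<oplus>\<^bsub>env L\<^esub> env_class L (0 + q)"
    using assms L LD by (simp add: env_class_add vac_ideal_free free_add add.assoc)
  then show "X \<in> vac_add L (vcl L p) (vcl L q)"
    unfolding vac_add_def set_add_def' vcl_eq_set[OF assms(1)] vcl_eq_set[OF assms(2)]
    using r(2) vac_ideal_0 by blast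
qed

lemma vac_diff_vcl:
  assumes "p \<in> free L" "q \<in> free L"
  shows "vac_diff L (vcl L p) (vcl L q) = vcl L (p - q)"
proof -
  have eq: "\<ominus>\<^bsub>env L\<^esub> env_class L (r + q) = env_class L (- r + - q)" if "r \<in> vac_ideal L" for r
    using that assms L LD by (simp add: env_class_a_inv vac_ideal_free free_add)
  have "a_set_inv\<^bsub>env L\<^esub> (vcl L q) = vcl L (- q)"
  proof (intro equalityI subsetI)
    fix X assume "X \<in> a_set_inv\<^bsub>env L\<^esub> (vcl L q)"
    then obtain r where "r \<in> vac_ideal L" "X = env_class L (- r + - q)"
      unfolding A_SET_INV_def' vcl_eq_set[OF assms(2)] using eq by blast
    then show "X \<in> vcl L (- q)"
      unfolding vcl_eq_set[OF free_minus[OF assms(2)]] using vac_ideal_minus by blast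
  next
    fix X assume "X \<in> vcl L (- q)"
    then obtain r where r: "r \<in> vac_ideal L" "X = env_class L (r + - q)"
      unfolding vcl_eq_set[OF free_minus[OF assms(2)]] by blast
    then have "X = \<ominus>\<^bsub>env L\<^esub> env_class L (- r + q)"
      using eq[of "- r"] vac_ideal_minus[of r L] by simp
    then show "X \<in> a_set_inv\<^bsub>env L\<^esub> (vcl L q)"
      unfolding A_SET_INV_def' vcl_eq_set[OF assms(2)] using r(1) vac_ideal_minus by blast
  qed
  then have "vac_diff L (vcl L p) (vcl L q) = vac_add L (vcl L p) (vcl L (- q))"
    by (simp add: vac_diff_def vac_add_def)
  then show ?thesis
    using vac_add_vcl[OF assms(1) free_minus[OF assms(2)]] by simp
qed

lemma vac_act_vcl:
  assumes "x \<in> free L" "p \<in> free L"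
  shows "vac_act L (env_class L x) (vcl L p) = vcl L (x * p)"
proof -
  have "vac_class L (env_class L x \<otimes>\<^bsub>env L\<^esub> env_class L (r + p)) = vcl L (x * p)"
    if r: "r \<in> vac_ideal L" for r
  proof -
    have "x * (r + p) - x * p \<in> vac_ideal L"
      using assms r by (simp add: distrib_left vac_ideal_left)
    then show ?thesis
      using assms L LD r vac_ideal_free[OF r L]
      by (simp add: env_class_mult free_add flip: vcl_def) (simp add: vcl_eq_iff free_mult free_add)
  qed
  then show ?thesis
    unfolding vac_act_def using vac_ideal_0
    by (intro UN_constant_eq[of "env_class L (0 + p)"]) (auto simp: vcl_eq_set[OF assms(2)] intro!: exI[of _ 0])
qed

end

lemma vac_map_vcl:
  assumes L: "const_subalgebra L" and M: "const_subalgebra M"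
    and "L \<subseteq> M" "p \<in> free L"
  shows "vac_map M (vcl L p) = vcl M p"
proof -
  have "vac_class M (env_map M (env_class L (r + p))) = vcl M p" if r: "r \<in> vac_ideal L" for r
  proof -
    have "r + p \<in> free L" "r + p \<in> free M" "p \<in> free M"
      using r assms by (auto intro: free_add vac_ideal_free free_mono)
    then show ?thesis
      using r assms vac_ideal_mono[OF r]
      by (simp add: env_map_class const_subalgebra_D flip: vcl_def) (simp add: vcl_eq_iff)
  qed
  then show ?thesis
    unfolding vac_map_def using vac_ideal_0
    by (intro UN_constant_eq[of "env_class L (0 + p)"]) (auto simp: vcl_eq_set[OF L assms(4)] intro!: exI[of _ 0])
qed

section \<open>Derivations of free algebras\<close>

lemma lie_anti: "lie x y = - lie y (x :: 'l :: complex_lie_algebra)"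
proof -
  have "lie (x + y) (x + y) = lie x y + lie y x"
    unfolding lie_add_left lie_add_right by (simp add: lie_self)
  then show ?thesis
    by (simp add: lie_self eq_neg_iff_add_eq_0)
qed

lemma lie_minus_right: "lie x (- y) = - lie x (y :: 'l :: complex_lie_algebra)"
  using lie_scaleC_right[of x "- 1" y] by (simp add: scaleC_minus_one)

lemma lie_derivation: "lie c (lie d x) = lie d (lie c x) + lie (lie c d) (x :: 'l :: complex_lie_algebra)"
proof -
  have "lie d (lie x c) = - lie d (lie c x)" "lie x (lie c d) = - lie (lie c d) x"
    using lie_anti[of x c] lie_anti[of x "lie c d"] by (simp_all add: lie_minus_right)
  then show ?thesis
    using jacobi[of c d x] by (simp add: algebra_simps)
qed

text \<open>The derivation of the free algebra that extends \<open>lie c\<close>. The element \<open>c\<close> normalises the Lie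
algebra under consideration but may lie outside it.\<close>

primrec ad_word :: "'l :: complex_lie_algebra \<Rightarrow> 'l list \<Rightarrow> 'l ncpoly" where
  "ad_word c [] = 0"
| "ad_word c (x # w) = gen (lie c x) * word w + gen x * ad_word c w"

definition ad :: "'l :: complex_lie_algebra \<Rightarrow> 'l ncpoly \<Rightarrow> 'l ncpoly" where
  "ad c = lin (ad_word c)"

lemma ad_linear [simp]:
  "ad c 0 = 0" "ad c 1 = 0" "ad c (p + q) = ad c p + ad c q" "ad c (scal k * p) = scal k * ad c p"
  "ad c (- p) = - ad c p" "ad c (p - q) = ad c p - ad c q"
  by (simp_all add: ad_def lin_add lin_scal lin_minus lin_diff)

lemma ad_gen_mult: "ad c (gen x * p) = gen (lie c x) * p + gen x * ad c p"
proof (rule ncpoly_linear_ext[where F = "\<lambda>p. ad c (gen x * p)"])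
  fix w
  show "ad c (gen x * word w) = gen (lie c x) * word w + gen x * ad c (word w)"
    by (simp add: ad_def flip: word_Cons)
qed (simp_all add: distrib_left scal_left_commute)

lemma ad_gen [simp]: "ad c (gen x) = gen (lie c x)"
  using ad_gen_mult[of c x 1] by simp

lemma ad_derivation: "ad c (p * q) = ad c p * q + p * ad c q"
proof (rule ncpoly_linear_ext[where F = "\<lambda>p. ad c (p * q)"])
  fix w
  show "ad c (word w * q) = ad c (word w) * q + word w * ad c q"
    by (induction w) (simp_all add: word_Cons mult.assoc ad_gen_mult algebra_simps)
qed (simp_all add: distrib_left distrib_right mult.assoc scal_left_commute)

context
  fixes L :: "'l :: complex_lie_algebra set" and c :: 'l
  assumes L: "lie_subalgebra L" and normal: "\<And>x. x \<in> L \<Longrightarrow> lie c x \<in> L"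
begin

lemma ad_free: "p \<in> free L \<Longrightarrow> ad c p \<in> free L"
  by (induction rule: free_induct) (auto simp: ad_gen_mult normal intro!: free_closed)

lemma ad_env_rels: "r \<in> env_rels L \<Longrightarrow> ad c r \<in> rel_ideal L"
proof -
  assume "r \<in> env_rels L"
  then consider
      x y where "x \<in> L" "y \<in> L" "r = gen (x + y) - (gen x + gen y)"
    | k x where "x \<in> L" "r = gen (k *\<^sub>C x) - scal k * gen x"
    | x y where "x \<in> L" "y \<in> L" "r = gen x * gen y - gen y * gen x - gen (lie x y)"
    unfolding env_rels_def by blast
  then show "ad c r \<in> rel_ideal L"
  proof cases
    case 1
    then show ?thesis
      using rel_ideal_gen_add[OF normal normal] by (simp add: lie_add_right)
  next
    case 2
    then show ?thesis
      using rel_ideal_gen_scal[OF normal] by (simp add: lie_scaleC_right)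
  next
    case (3 x y)
    have "lie c (lie x y) = lie (lie c x) y + lie x (lie c y)"
      using lie_derivation[of c x y] by (simp add: add.commute)
    then have "ad c r = (gen (lie c x) * gen y - gen y * gen (lie c x) - gen (lie (lie c x) y))
        + (gen x * gen (lie c y) - gen (lie c y) * gen x - gen (lie x (lie c y)))
        - (gen (lie (lie c x) y + lie x (lie c y)) - (gen (lie (lie c x) y) + gen (lie x (lie c y))))"
      unfolding 3(3) by (simp add: ad_derivation algebra_simps)
    moreover have "lie (lie c x) y \<in> L" "lie x (lie c y) \<in> L"
      using 3 normal L by (auto simp: lie_subalgebra_def)
    ultimately show ?thesis
      using 3 normal
      by (simp only: rel_ideal_diff rel_ideal.add rel_ideal_gen_lie rel_ideal_gen_add)
  qed
qed

lemma ad_rel_ideal: "p \<in> rel_ideal L \<Longrightarrow> ad c p \<in> rel_ideal L"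
proof (induction rule: rel_ideal.induct)
  case (rel r q)
  then show ?case
    using rel_ideal.add[OF rel_ideal_right[OF ad_env_rels rel(2)] rel_ideal.rel[OF rel(1) ad_free]]
    by (simp add: ad_derivation)
next
  case (gen x p)
  then show ?case
    by (auto simp: ad_gen_mult intro!: rel_ideal.add rel_ideal_left free_gen normal)
qed (auto intro: rel_ideal.intros)

text \<open>In a larger enveloping algebra that contains \<open>c\<close>, a derivation of this kind becomes inner.\<close>

lemma ad_inner:
  assumes "c \<in> M" "L \<subseteq> M" "p \<in> free L"
  shows "ad c p - (gen c * p - p * gen c) \<in> rel_ideal M"
  using assms(3)
proof (induction rule: linear_mod_induct[where F = "\<lambda>_ :: unit. \<lambda>p. ad c p - (gen c * p - p * gen c)"])
  case (gen a x p)
  have "ad c (gen x * p) - (gen c * (gen x * p) - (gen x * p) * gen c) =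
      gen x * (ad c p - (gen c * p - p * gen c)) - (gen c * gen x - gen x * gen c - gen (lie c x)) * p"
    by (simp add: algebra_simps ad_gen_mult)
  moreover have "gen x * (ad c p - (gen c * p - p * gen c)) \<in> rel_ideal M"
    using gen assms(2) by (auto intro: rel_ideal.gen)
  moreover have "(gen c * gen x - gen x * gen c - gen (lie c x)) * p \<in> rel_ideal M"
    using gen assms by (intro rel_ideal_right rel_ideal_gen_lie free_mono[OF assms(2)]) auto
  ultimately show ?case
    by (simp only: rel_ideal_diff)
qed (auto simp: algebra_simps scal_left_commute[of "gen _"] intro: rel_ideal.intros)

end

lemma ad_add:
  assumes "lie_subalgebra L" "\<And>x. x \<in> L \<Longrightarrow> lie c x \<in> L" "\<And>x. x \<in> L \<Longrightarrow> lie d x \<in> L"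
    and "p \<in> free L"
  shows "ad (c + d) p - (ad c p + ad d p) \<in> rel_ideal L"
  using assms(4)
proof (induction rule: linear_mod_induct[where F = "\<lambda>_ :: unit. \<lambda>p. ad (c + d) p - (ad c p + ad d p)"])
  case (gen a x p)
  have "ad (c + d) (gen x * p) - (ad c (gen x * p) + ad d (gen x * p)) =
      gen x * (ad (c + d) p - (ad c p + ad d p))
      + (gen (lie c x + lie d x) - (gen (lie c x) + gen (lie d x))) * p"
    by (simp add: algebra_simps ad_gen_mult lie_add_left)
  then show ?case
    using gen assms(2,3)
    by (simp only: rel_ideal.add rel_ideal_right rel_ideal_gen_add rel_ideal.gen)
qed (auto simp: algebra_simps  intro: rel_ideal.intros)

lemma ad_scaleC:
  assumes "lie_subalgebra L" "\<And>x. x \<in> L \<Longrightarrow> lie c x \<in> L" "p \<in> free L"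
  shows "ad (k *\<^sub>C c) p - scal k * ad c p \<in> rel_ideal L"
  using assms(3)
proof (induction rule: linear_mod_induct[where F = "\<lambda>_ :: unit. \<lambda>p. ad (k *\<^sub>C c) p - scal k * ad c p"])
  case (scal a l p)
  then show ?case
    by (simp add: right_diff_distrib scal_left_commute[of "scal k" l])
next
  case (gen a x p)
  have "ad (k *\<^sub>C c) (gen x * p) - scal k * ad c (gen x * p) =
      gen x * (ad (k *\<^sub>C c) p - scal k * ad c p)
      + (gen (k *\<^sub>C lie c x) - scal k * gen (lie c x)) * p"
    by (simp add: algebra_simps ad_gen_mult lie_scaleC_left scal_left_commute[of "gen _"])
  then show ?case
    using gen assms(2)
    by (simp only: rel_ideal.add rel_ideal_right rel_ideal_gen_scal rel_ideal.gen)
qed (auto simp: algebra_simps intro: rel_ideal.intros)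

lemma ad_lie:
  assumes L: "lie_subalgebra L" and c: "\<And>x. x \<in> L \<Longrightarrow> lie c x \<in> L"
    and d: "\<And>x. x \<in> L \<Longrightarrow> lie d x \<in> L" and p: "p \<in> free L"
  shows "ad c (ad d p) - ad d (ad c p) - ad (lie c d) p \<in> rel_ideal L"
  using p
proof (induction rule: linear_mod_induct[where F = "\<lambda>_ :: unit. \<lambda>p. ad c (ad d p) - ad d (ad c p) - ad (lie c d) p"])
  case (gen a x p)
  have cd: "lie c (lie d x) = lie d (lie c x) + lie (lie c d) x"
    by (simp add: lie_derivation[of c d x])
  have mem: "lie d (lie c x) \<in> L" "lie (lie c d) x \<in> L"
  proof -
    show "lie d (lie c x) \<in> L" using gen c d by simp
    have "lie (lie c d) x = lie c (lie d x) + (- 1) *\<^sub>C lie d (lie c x)"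
      by (simp add: cd scaleC_minus_one)
    then show "lie (lie c d) x \<in> L"
      using L gen c d unfolding lie_subalgebra_def by metis
  qed
  have "ad c (ad d (gen x * p)) - ad d (ad c (gen x * p)) - ad (lie c d) (gen x * p) =
      gen x * (ad c (ad d p) - ad d (ad c p) - ad (lie c d) p)
      + (gen (lie d (lie c x) + lie (lie c d) x) - (gen (lie d (lie c x)) + gen (lie (lie c d) x))) * p"
    by (simp add: algebra_simps ad_gen_mult flip: cd)
  then show ?case
    using gen mem
    by (simp only: rel_ideal.add rel_ideal_right rel_ideal_gen_add rel_ideal.gen)
qed (auto simp: algebra_simps  intro: rel_ideal.intros)

section \<open>Splitting off the constants\<close>

text \<open>A map \<open>x\<close> acts on the enveloping algebra of the kernel of the evaluation \<open>ev\<close>: the part of \<open>x\<close>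
in the kernel by left multiplication, the constant part by the derivation. \<open>red ev p\<close> is the
result of the action of \<open>p\<close> on \<open>1\<close>.\<close>

primrec red_word :: "('g mero \<Rightarrow> 'g) \<Rightarrow> 'g mero list \<Rightarrow> 'g :: complex_lie_algebra mero ncpoly" where
  "red_word ev [] = 1"
| "red_word ev (x # w) =
     gen (x - mconst (ev x)) * red_word ev w + ad (mconst (ev x)) (red_word ev w)"

definition red :: "('g mero \<Rightarrow> 'g) \<Rightarrow> 'g mero ncpoly \<Rightarrow> 'g :: complex_lie_algebra mero ncpoly" where
  "red ev = lin (red_word ev)"

lemma red_linear [simp]:
  "red ev 0 = 0" "red ev 1 = 1" "red ev (p + q) = red ev p + red ev q"
  "red ev (scal k * p) = scal k * red ev p"
  "red ev (- p) = - red ev p" "red ev (p - q) = red ev p - red ev q"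
  by (simp_all add: red_def lin_add lin_scal lin_minus lin_diff)

lemma red_gen_mult:
  "red ev (gen x * p) = gen (x - mconst (ev x)) * red ev p + ad (mconst (ev x)) (red ev p)"
proof (rule ncpoly_linear_ext[where F = "\<lambda>p. red ev (gen x * p)"])
  fix w
  show "red ev (gen x * word w) =
      gen (x - mconst (ev x)) * red ev (word w) + ad (mconst (ev x)) (red ev (word w))"
    by (simp add: red_def flip: word_Cons)
qed (simp_all add: distrib_left scal_left_commute algebra_simps)

text \<open>The semidirect product situation: \<open>ev\<close> is a Lie algebra homomorphism that splits the inclusion of
the constants, and its kernel \<open>K\<close> is an ideal.\<close>

locale evaluation =
  fixes L :: "'g :: complex_lie_algebra mero set" and ev :: "'g mero \<Rightarrow> 'g"
  assumes L: "const_subalgebra L"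
    and ev_add: "x \<in> L \<Longrightarrow> y \<in> L \<Longrightarrow> ev (x + y) = ev x + ev y"
    and ev_scaleC: "x \<in> L \<Longrightarrow> ev (k *\<^sub>C x) = k *\<^sub>C ev x"
    and ev_lie: "x \<in> L \<Longrightarrow> y \<in> L \<Longrightarrow> ev (lie x y) = lie (ev x) (ev y)"
    and ev_const: "ev (mconst a) = a"
begin

definition K :: "'g mero set" where
  "K = {x \<in> L. ev x = 0}"

lemma K_sub: "K \<subseteq> L"
  by (auto simp: K_def)

lemma L_closed: "x \<in> L \<Longrightarrow> y \<in> L \<Longrightarrow> x + y \<in> L" "x \<in> L \<Longrightarrow> k *\<^sub>C x \<in> L"
  "x \<in> L \<Longrightarrow> y \<in> L \<Longrightarrow> lie x y \<in> L" "0 \<in> L" "mconst a \<in> L" "x \<in> L \<Longrightarrow> y \<in> L \<Longrightarrow> x - y \<in> L"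
proof -
  show 1: "x \<in> L \<Longrightarrow> y \<in> L \<Longrightarrow> x + y \<in> L" "x \<in> L \<Longrightarrow> k *\<^sub>C x \<in> L"
    "x \<in> L \<Longrightarrow> y \<in> L \<Longrightarrow> lie x y \<in> L" "0 \<in> L" "mconst a \<in> L" for x y k a
    using L by (auto simp: const_subalgebra_def lie_subalgebra_def)
  show "x \<in> L \<Longrightarrow> y \<in> L \<Longrightarrow> x - y \<in> L"
    using 1(1)[of x "(- 1) *\<^sub>C y"] 1(2)[of y "- 1"] by (simp add: scaleC_minus_one)
qed

lemma ev_0: "ev 0 = 0"
  using ev_const[of 0] by (simp add: mconst_0)

lemma K_lie: "lie_subalgebra K"
  unfolding lie_subalgebra_def K_def
  by (auto simp: L_closed ev_add ev_scaleC ev_lie ev_0)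

lemma K_normal: "x \<in> L \<Longrightarrow> y \<in> K \<Longrightarrow> lie x y \<in> K"
  unfolding K_def by (auto simp: L_closed ev_lie)

lemma K_part:
  assumes "x \<in> L"
  shows "x - mconst (ev x) \<in> K"
proof -
  have "ev (x + (- 1) *\<^sub>C mconst (ev x)) = ev x + (- 1) *\<^sub>C ev x"
    using assms by (simp add: ev_add ev_scaleC L_closed ev_const)
  then show ?thesis
    using assms by (simp add: K_def L_closed scaleC_minus_one)
qed

lemma red_free: "p \<in> free L \<Longrightarrow> red ev p \<in> free K"
  by (induction rule: free_induct)
    (auto simp: red_gen_mult intro!: free_closed K_part ad_free K_lie K_normal L_closed)

lemma red_step_rel_ideal:
  assumes "x \<in> L" "p \<in> rel_ideal K"
  shows "gen (x - mconst (ev x)) * p + ad (mconst (ev x)) p \<in> rel_ideal K"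
  using assms by (auto intro!: rel_ideal.add rel_ideal.gen K_part ad_rel_ideal K_lie K_normal L_closed)

text \<open>For the bracket relation, write \<open>x = m + a\<close> and \<open>y = n + b\<close> with \<open>m, n\<close> in the kernel and
\<open>a, b\<close> constant; then \<open>[m, n] + [a, n] - [b, m]\<close> is the kernel part of \<open>[x, y]\<close>. The mixed terms
of the commutator of the two actions are accounted for by the derivation property.\<close>

lemma red_env_rels:
  assumes r: "r \<in> env_rels L" and q: "q \<in> free L"
  shows "red ev (r * q) \<in> rel_ideal K"
proof -
  define Q where "Q = red ev q"
  have Q: "Q \<in> free K"
    using q by (simp add: Q_def red_free)
  note normal = K_normal[OF L_closed(5)]
  from r consider
      x y where "x \<in> L" "y \<in> L" "r = gen (x + y) - (gen x + gen y)"
    | k x where "x \<in> L" "r = gen (k *\<^sub>C x) - scal k * gen x"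
    | x y where "x \<in> L" "y \<in> L" "r = gen x * gen y - gen y * gen x - gen (lie x y)"
    unfolding env_rels_def by blast
  then show ?thesis
  proof cases
    case (1 x y)
    define a b m n where "a = mconst (ev x)" and "b = mconst (ev y)" and "m = x - a" and "n = y - b"
    have mn: "m \<in> K" "n \<in> K"
      using 1 K_part by (auto simp: m_def n_def a_def b_def)
    have "red ev (r * q) = (gen (m + n) - (gen m + gen n)) * Q + (ad (a + b) Q - (ad a Q + ad b Q))"
      unfolding 1(3) Q_def m_def n_def a_def b_def
      using 1(1,2) by (simp add: left_diff_distrib distrib_right red_gen_mult ev_add mconst_add algebra_simps)
    also have "\<dots> \<in> rel_ideal K"
      using mn Q unfolding a_def b_def
      by (intro rel_ideal.add rel_ideal_right rel_ideal_gen_add ad_add K_lie normal)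
    finally show ?thesis .
  next
    case (2 k x)
    define a m where "a = mconst (ev x)" and "m = x - a"
    have m: "m \<in> K"
      using 2 K_part by (auto simp: m_def a_def)
    have km: "k *\<^sub>C m = k *\<^sub>C x - k *\<^sub>C a"
      using scaleC_add_right[of k m a] by (simp add: m_def)
    have "red ev (r * q) = (gen (k *\<^sub>C m) - scal k * gen m) * Q + (ad (k *\<^sub>C a) Q - scal k * ad a Q)"
      unfolding 2(2) Q_def km
      using 2(1) by (simp add: left_diff_distrib distrib_left red_gen_mult ev_scaleC mconst_scaleC
          a_def m_def mult.assoc)
    also have "\<dots> \<in> rel_ideal K"
      using m Q unfolding a_def
      by (intro rel_ideal.add rel_ideal_right rel_ideal_gen_scal ad_scaleC K_lie normal)
    finally show ?thesis .
  next
    case (3 x y)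
    define a b m n where "a = mconst (ev x)" and "b = mconst (ev y)" and "m = x - a" and "n = y - b"
    have mn: "m \<in> K" "n \<in> K"
      using 3 K_part by (auto simp: m_def n_def a_def b_def)
    have xy: "x = m + a" "y = n + b"
      by (simp_all add: m_def n_def)
    have eq: "lie x y - lie a b = (lie m n + lie a n) + (- 1) *\<^sub>C lie b m"
      unfolding xy by (simp add: lie_add_left lie_add_right lie_anti[of m b] scaleC_minus_one)
    have K: "lie m n \<in> K" "lie a n \<in> K" "lie b m \<in> K" "lie m n + lie a n \<in> K"
        "(- 1) *\<^sub>C lie b m \<in> K"
      using mn K_lie normal unfolding a_def b_def lie_subalgebra_def by auto
    have "red ev (r * q) = (gen m * gen n - gen n * gen m - gen (lie m n)) * Q
       + (ad a (ad b Q) - ad b (ad a Q) - ad (lie a b) Q)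
       - (gen ((lie m n + lie a n) + (- 1) *\<^sub>C lie b m) - (gen (lie m n + lie a n) + gen ((- 1) *\<^sub>C lie b m))) * Q
       - (gen (lie m n + lie a n) - (gen (lie m n) + gen (lie a n))) * Q
       - (gen ((- 1) *\<^sub>C lie b m) - scal (- 1) * gen (lie b m)) * Q"
      unfolding 3(3) Q_def eq[symmetric]
      using 3(1,2)
      by (simp add: left_diff_distrib distrib_left red_gen_mult ev_lie mconst_lie ad_gen_mult
          mult.assoc a_def[symmetric] b_def[symmetric] m_def[symmetric] n_def[symmetric] scal_minus)
        (simp add: algebra_simps)
    also have "\<dots> \<in> rel_ideal K"
      by (rule rel_ideal_diff[OF rel_ideal_diff[OF rel_ideal_diff[OF rel_ideal.add]]])
        (use mn Q K in \<open>simp_all add: rel_ideal_right rel_ideal_gen_lie rel_ideal_gen_scal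
          rel_ideal_gen_add ad_lie K_lie normal a_def b_def\<close>)
    finally show ?thesis .
  qed
qed

lemma red_rel_ideal: "p \<in> rel_ideal L \<Longrightarrow> red ev p \<in> rel_ideal K"
  by (induction rule: rel_ideal.induct)
    (auto simp: red_env_rels red_gen_mult[of ev] intro!: red_step_rel_ideal intro: rel_ideal.intros)

text \<open>Constants annihilate \<open>1\<close>, because a derivation does.\<close>

lemma red_vac_ideal: "p \<in> vac_ideal L \<Longrightarrow> red ev p \<in> rel_ideal K"
proof (induction rule: vac_ideal.induct)
  case (const a)
  show ?case
    using red_gen_mult[of ev "mconst a" 1] by (simp add: ev_const rel_ideal_gen_0 K_lie)
qed (auto simp: red_rel_ideal red_gen_mult[of ev] intro!: red_step_rel_ideal intro: rel_ideal.intros)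

lemma ad_0:
  assumes "p \<in> free K"
  shows "ad 0 p \<in> rel_ideal K"
  using ad_scaleC[of K 0 p 0] assms K_lie by (simp add: lie_subalgebra_def)

lemma red_K: "p \<in> free K \<Longrightarrow> red ev p - p \<in> rel_ideal K"
proof (induction rule: linear_mod_induct[where F = "\<lambda>_ :: unit. \<lambda>p. red ev p - p"])
  case (gen a x p)
  then have "ev x = 0" "red ev p \<in> free K"
    using free_mono[OF K_sub] red_free by (auto simp: K_def)
  moreover have "gen x * (red ev p - p) \<in> rel_ideal K"
    using gen by (intro rel_ideal.gen)
  ultimately show ?case
    using rel_ideal.add[OF _ ad_0, of "gen x * (red ev p - p)" "red ev p"]
    by (simp add: red_gen_mult mconst_0 algebra_simps)
qed (auto simp: algebra_simps intro: rel_ideal.intros)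

text \<open>Inductively \<open>p\<close> may be replaced by \<open>Q = red ev p\<close>. A constant \<open>a\<close> satisfies
\<open>a Q = [a, Q] + Q a\<close>, and the last term is in the left ideal.\<close>

lemma red_vac: "p \<in> free L \<Longrightarrow> p - red ev p \<in> vac_ideal L"
proof (induction rule: linear_mod_induct[where F = "\<lambda>_ :: unit. \<lambda>p. p - red ev p"])
  case (gen u x p)
  define a m Q where "a = mconst (ev x)" and "m = x - a" and "Q = red ev p"
  have m: "m \<in> L"
    using gen K_part K_sub by (auto simp: m_def a_def)
  have Q: "Q \<in> free K"
    using gen red_free by (simp add: Q_def)
  then have QL: "Q \<in> free L"
    using free_mono[OF K_sub] by simp
  have "gen x * p - red ev (gen x * p) =
      gen x * (p - Q) + (gen (m + a) - (gen m + gen a)) * Q - (ad a Q - (gen a * Q - Q * gen a)) + Q * gen a"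
    by (simp add: red_gen_mult m_def Q_def a_def[symmetric] algebra_simps)
  also have "\<dots> \<in> vac_ideal L"
  proof (rule vac_ideal.add[OF vac_ideal_diff[OF vac_ideal.add]])
    show "gen x * (p - Q) \<in> vac_ideal L"
      using gen by (auto simp: Q_def intro: vac_ideal.gen)
    show "(gen (m + a) - (gen m + gen a)) * Q \<in> vac_ideal L"
      using m QL by (intro vac_ideal.rel rel_ideal_right rel_ideal_gen_add) (auto simp: a_def L_closed)
    show "ad a Q - (gen a * Q - Q * gen a) \<in> vac_ideal L"
      using Q by (intro vac_ideal.rel ad_inner[of K] K_lie)
        (auto simp: a_def L_closed K_sub intro: K_normal)
    show "Q * gen a \<in> vac_ideal L"
      using QL by (auto simp: a_def intro: vac_ideal_left vac_ideal.const)
  qed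
  finally show ?case .
qed (auto simp: algebra_simps intro: vac_ideal.intros vac_ideal_0)

text \<open>The injectivity of the identification: \<open>red\<close> sends the left ideal to relations, and fixes the
enveloping algebra of the kernel modulo relations.\<close>

lemma vac_ideal_free_K:
  assumes "p \<in> free K" "p \<in> vac_ideal L"
  shows "p \<in> rel_ideal K"
  using rel_ideal_diff[OF red_vac_ideal[OF assms(2)] red_K[OF assms(1)]] by simp

end

section \<open>The identification with the enveloping algebra of the vanishing maps\<close>

context evaluation
begin

lemma K_class_of_vcl:
  assumes "q \<in> free K"
  shows "inv_into (carrier (env K)) (\<lambda>X. vac_class L (env_map L X)) (vcl L q) = env_class K q"
proof -
  note LD = const_subalgebra_D[OF L]
  let ?f = "\<lambda>X. vac_class L (env_map L X)"
  have f: "?f (env_class K p) = vcl L p" if "p \<in> free K" for p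
    using env_map_class[OF K_lie LD(1) K_sub that] by (simp add: vcl_def)
  have "inj_on ?f (carrier (env K))"
  proof (rule inj_onI)
    fix X Y assume "X \<in> carrier (env K)" "Y \<in> carrier (env K)" and eq: "?f X = ?f Y"
    then obtain p q where pq: "X = env_class K p" "p \<in> free K" "Y = env_class K q" "q \<in> free K"
      by (auto simp: carrier_env[OF K_lie])
    then have "p - q \<in> vac_ideal L"
      using eq f free_mono[OF K_sub] by (simp add: vcl_eq_iff[OF L])
    then have "p - q \<in> rel_ideal K"
      using pq by (intro vac_ideal_free_K free_diff)
    then show "X = Y"
      using pq K_lie by (simp add: env_class_eq_iff)
  qed
  from inv_into_f_f[OF this env_class_in[OF K_lie assms]] show ?thesis
    using f[OF assms] by simp
qed

lemma vcl_red: "p \<in> free L \<Longrightarrow> vcl L p = vcl L (red ev p)"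
  using red_vac[of p] red_free[of p] free_mono[OF K_sub] by (simp add: vcl_eq_iff[OF L])

end

section \<open>Operators on free algebras with prescribed commutation relations\<close>

lemma rel_ideal_gen_diff:
  assumes "lie_subalgebra L" "x \<in> L" "y \<in> L"
  shows "gen (x - y) - (gen x - gen y) \<in> rel_ideal L"
proof -
  have y: "(- 1) *\<^sub>C y \<in> L"
    using assms by (simp add: lie_subalgebra_def)
  have "gen (x - y) - (gen x - gen y) =
      (gen (x + (- 1) *\<^sub>C y) - (gen x + gen ((- 1) *\<^sub>C y))) + (gen ((- 1) *\<^sub>C y) - scal (- 1) * gen y)"
    by (simp add: scaleC_minus_one scal_minus)
  then show ?thesis
    using assms y by (simp only: rel_ideal.add rel_ideal_gen_add rel_ideal_gen_scal)
qed

text \<open>The operators with \<open>J a 1 = 0\<close> and \<open>[J a, x] = D a x - c a x + J (\<tau> a x)\<close>, where \<open>x\<close> and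
\<open>D a x\<close> stand for left multiplications. The recursion moves \<open>J a\<close> through a word from the left;
\<open>a\<close> changes on the way, so that all the operators are defined together.\<close>

primrec comm_word :: "('g \<Rightarrow> 'l \<Rightarrow> 'l) \<Rightarrow> ('g \<Rightarrow> 'l \<Rightarrow> complex) \<Rightarrow> ('g \<Rightarrow> 'l \<Rightarrow> 'g) \<Rightarrow>
    'l list \<Rightarrow> 'g \<Rightarrow> 'l ncpoly" where
  "comm_word D c \<tau> [] = (\<lambda>a. 0)"
| "comm_word D c \<tau> (x # w) = (\<lambda>a. gen x * comm_word D c \<tau> w a
     + (gen (D a x) - scal (c a x)) * word w + comm_word D c \<tau> w (\<tau> a x))"

definition comm_op :: "('g \<Rightarrow> 'l \<Rightarrow> 'l) \<Rightarrow> ('g \<Rightarrow> 'l \<Rightarrow> complex) \<Rightarrow> ('g \<Rightarrow> 'l \<Rightarrow> 'g) \<Rightarrow>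
    'g \<Rightarrow> 'l ncpoly \<Rightarrow> 'l ncpoly" where
  "comm_op D c \<tau> a = lin (\<lambda>w. comm_word D c \<tau> w a)"

lemma comm_op_linear [simp]:
  "comm_op D c \<tau> a 0 = 0" "comm_op D c \<tau> a 1 = 0"
  "comm_op D c \<tau> a (p + q) = comm_op D c \<tau> a p + comm_op D c \<tau> a q"
  "comm_op D c \<tau> a (scal k * p) = scal k * comm_op D c \<tau> a p"
  "comm_op D c \<tau> a (- p) = - comm_op D c \<tau> a p"
  "comm_op D c \<tau> a (p - q) = comm_op D c \<tau> a p - comm_op D c \<tau> a q"
  by (simp_all add: comm_op_def lin_add lin_scal lin_minus lin_diff)

lemma comm_op_gen_mult:
  "comm_op D c \<tau> a (gen x * p) =
     gen x * comm_op D c \<tau> a p + (gen (D a x) - scal (c a x)) * p + comm_op D c \<tau> (\<tau> a x) p"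
proof (rule ncpoly_linear_ext[where F = "\<lambda>p. comm_op D c \<tau> a (gen x * p)"])
  fix k p
  show "comm_op D c \<tau> a (gen x * (scal k * p)) = scal k * comm_op D c \<tau> a (gen x * p)"
    by (simp add: scal_left_commute[of "gen x"])
  show "gen x * comm_op D c \<tau> a (scal k * p) + (gen (D a x) - scal (c a x)) * (scal k * p) +
      comm_op D c \<tau> (\<tau> a x) (scal k * p) =
    scal k * (gen x * comm_op D c \<tau> a p + (gen (D a x) - scal (c a x)) * p + comm_op D c \<tau> (\<tau> a x) p)"
    unfolding comm_op_linear scal_left_commute[of "gen x"] scal_left_commute[of "_ - _"]
    by (simp add: distrib_left)
next
  fix w
  show "comm_op D c \<tau> a (gen x * word w) = gen x * comm_op D c \<tau> a (word w)
      + (gen (D a x) - scal (c a x)) * word w + comm_op D c \<tau> (\<tau> a x) (word w)"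
    by (simp add: comm_op_def flip: word_Cons)
qed (simp_all add: algebra_simps)

text \<open>Linearity of the prescribed commutators in \<open>a\<close> and in \<open>x\<close>, together with the cocycle
condition that \<open>[[J a, x], y] - [[J a, y], x] = [J a, [x, y]]\<close> imposes on them: it is the
consistency condition for the operators to descend to the enveloping algebra.\<close>

locale comm_data =
  fixes L :: "'l :: complex_lie_algebra set"
    and D :: "'g :: complex_vector \<Rightarrow> 'l \<Rightarrow> 'l" and c :: "'g \<Rightarrow> 'l \<Rightarrow> complex"
    and \<tau> :: "'g \<Rightarrow> 'l \<Rightarrow> 'g"
  assumes L: "lie_subalgebra L"
    and D_in: "x \<in> L \<Longrightarrow> D a x \<in> L"
    and left_add: "x \<in> L \<Longrightarrow> D (a + b) x = D a x + D b x"
      "x \<in> L \<Longrightarrow> c (a + b) x = c a x + c b x" "x \<in> L \<Longrightarrow> \<tau> (a + b) x = \<tau> a x + \<tau> b x"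
    and left_scaleC: "x \<in> L \<Longrightarrow> D (k *\<^sub>C a) x = k *\<^sub>C D a x"
      "x \<in> L \<Longrightarrow> c (k *\<^sub>C a) x = k * c a x" "x \<in> L \<Longrightarrow> \<tau> (k *\<^sub>C a) x = k *\<^sub>C \<tau> a x"
    and right_add: "x \<in> L \<Longrightarrow> y \<in> L \<Longrightarrow> D a (x + y) = D a x + D a y"
      "x \<in> L \<Longrightarrow> y \<in> L \<Longrightarrow> c a (x + y) = c a x + c a y"
      "x \<in> L \<Longrightarrow> y \<in> L \<Longrightarrow> \<tau> a (x + y) = \<tau> a x + \<tau> a y"
    and right_scaleC: "x \<in> L \<Longrightarrow> D a (k *\<^sub>C x) = k *\<^sub>C D a x"
      "x \<in> L \<Longrightarrow> c a (k *\<^sub>C x) = k * c a x" "x \<in> L \<Longrightarrow> \<tau> a (k *\<^sub>C x) = k *\<^sub>C \<tau> a x"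
    and right_lie: "x \<in> L \<Longrightarrow> y \<in> L \<Longrightarrow>
        D a (lie x y) = (lie x (D a y) - lie y (D a x)) + (D (\<tau> a x) y - D (\<tau> a y) x)"
      "x \<in> L \<Longrightarrow> y \<in> L \<Longrightarrow> c a (lie x y) = c (\<tau> a x) y - c (\<tau> a y) x"
      "x \<in> L \<Longrightarrow> y \<in> L \<Longrightarrow> \<tau> a (lie x y) = \<tau> (\<tau> a x) y - \<tau> (\<tau> a y) x"
begin

abbreviation J :: "'g \<Rightarrow> 'l ncpoly \<Rightarrow> 'l ncpoly" where
  "J \<equiv> comm_op D c \<tau>"

lemma L_closed: "x \<in> L \<Longrightarrow> y \<in> L \<Longrightarrow> x + y \<in> L" "x \<in> L \<Longrightarrow> k *\<^sub>C x \<in> L"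
  "x \<in> L \<Longrightarrow> y \<in> L \<Longrightarrow> lie x y \<in> L" "x \<in> L \<Longrightarrow> y \<in> L \<Longrightarrow> x - y \<in> L"
proof -
  show 1: "x \<in> L \<Longrightarrow> y \<in> L \<Longrightarrow> x + y \<in> L" "x \<in> L \<Longrightarrow> k *\<^sub>C x \<in> L"
    "x \<in> L \<Longrightarrow> y \<in> L \<Longrightarrow> lie x y \<in> L" for x y k
    using L by (auto simp: lie_subalgebra_def)
  show "x \<in> L \<Longrightarrow> y \<in> L \<Longrightarrow> x - y \<in> L"
    using 1(1)[of x "(- 1) *\<^sub>C y"] 1(2)[of y "- 1"] by (simp add: scaleC_minus_one)
qed

lemma J_free: "p \<in> free L \<Longrightarrow> J a p \<in> free L"
  by (induction arbitrary: a rule: free_induct)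
    (auto simp: comm_op_gen_mult D_in intro!: free_closed)

lemma J_add:
  assumes "p \<in> free L"
  shows "J (a + b) p - (J a p + J b p) \<in> rel_ideal L"
proof -
  have "J (fst ab + snd ab) p - (J (fst ab) p + J (snd ab) p) \<in> rel_ideal L" for ab
    using assms
  proof (induction rule: linear_mod_induct[where F = "\<lambda>ab p. J (fst ab + snd ab) p - (J (fst ab) p + J (snd ab) p)"])
    case (gen ab x p)
    obtain a b where ab: "ab = (a, b)" by fastforce
    have "J (a + b) (gen x * p) - (J a (gen x * p) + J b (gen x * p)) =
        gen x * (J (a + b) p - (J a p + J b p))
        + (gen (D a x + D b x) - (gen (D a x) + gen (D b x))) * p
        + (J (\<tau> a x + \<tau> b x) p - (J (\<tau> a x) p + J (\<tau> b x) p))"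
      using gen by (simp add: comm_op_gen_mult left_add scal_add algebra_simps)
    then show ?case
      using gen(1,2) gen.IH[of "(a, b)"] gen.IH[of "(\<tau> a x, \<tau> b x)"]
      by (simp only: ab fst_conv snd_conv rel_ideal.add rel_ideal.gen rel_ideal_right rel_ideal_gen_add D_in)
  qed (auto simp: algebra_simps intro: rel_ideal.intros)
  from this[of "(a, b)"] show ?thesis
    by simp
qed

lemma J_scaleC:
  assumes "p \<in> free L"
  shows "J (k *\<^sub>C a) p - scal k * J a p \<in> rel_ideal L"
  using assms
proof (induction rule: linear_mod_induct[where F = "\<lambda>a p. J (k *\<^sub>C a) p - scal k * J a p"])
  case (scal a l p)
  then show ?case
    by (simp add: right_diff_distrib scal_left_commute[of "scal k" l])
next
  case (gen a x p)
  have "J (k *\<^sub>C a) (gen x * p) - scal k * J a (gen x * p) =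
      gen x * (J (k *\<^sub>C a) p - scal k * J a p)
      + (gen (k *\<^sub>C D a x) - scal k * gen (D a x)) * p
      + (J (k *\<^sub>C \<tau> a x) p - scal k * J (\<tau> a x) p)"
    using gen by (simp add: comm_op_gen_mult left_scaleC scal_mult algebra_simps
        scal_left_commute[of "gen _"])
  then show ?case
    using gen by (simp only: rel_ideal.add rel_ideal.gen rel_ideal_right rel_ideal_gen_scal D_in)
qed (auto simp: algebra_simps intro: rel_ideal.intros)

lemma J_diff:
  assumes "p \<in> free L"
  shows "J (a - b) p - (J a p - J b p) \<in> rel_ideal L"
proof -
  have "J (a - b) p - (J a p - J b p) = (J (a + (- 1) *\<^sub>C b) p - (J a p + J ((- 1) *\<^sub>C b) p))
      + (J ((- 1) *\<^sub>C b) p - scal (- 1) * J b p)"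
    by (simp add: scaleC_minus_one scal_minus)
  then show ?thesis
    using assms by (simp only: rel_ideal.add J_add J_scaleC)
qed

text \<open>For the bracket relation, the terms of \<open>J a (r * q)\<close> are collected into elements of the ideal that
each express one of the cocycle conditions.\<close>

lemma J_env_rels:
  assumes r: "r \<in> env_rels L" and q: "q \<in> free L"
  shows "J a (r * q) \<in> rel_ideal L"
proof -
  from r consider
      x y where "x \<in> L" "y \<in> L" "r = gen (x + y) - (gen x + gen y)"
    | k x where "x \<in> L" "r = gen (k *\<^sub>C x) - scal k * gen x"
    | x y where "x \<in> L" "y \<in> L" "r = gen x * gen y - gen y * gen x - gen (lie x y)"
    unfolding env_rels_def by blast
  then show ?thesis
  proof cases
    case (1 x y)
    have "J a (r * q) = r * J a q + (gen (D a x + D a y) - (gen (D a x) + gen (D a y))) * q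
        + (J (\<tau> a x + \<tau> a y) q - (J (\<tau> a x) q + J (\<tau> a y) q))"
      using 1 by (simp add: left_diff_distrib distrib_right comm_op_gen_mult right_add scal_add)
    then show ?thesis
      using 1(1,2) q r by (simp only: rel_ideal.add rel_ideal.rel rel_ideal_right rel_ideal_gen_add
          J_add J_free D_in)
  next
    case (2 k x)
    have "J a (r * q) = r * J a q + (gen (k *\<^sub>C D a x) - scal k * gen (D a x)) * q
        + (J (k *\<^sub>C \<tau> a x) q - scal k * J (\<tau> a x) q)"
      using 2 by (simp add: left_diff_distrib distrib_left comm_op_gen_mult right_scaleC scal_mult
          mult.assoc right_diff_distrib)
    then show ?thesis
      using 2(1) q r by (simp only: rel_ideal.add rel_ideal.rel rel_ideal_right rel_ideal_gen_scal
          J_scaleC J_free D_in)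
  next
    case (3 x y)
    note xy = 3(1,2)
    define A B C E where "A = D a x" and "B = D a y" and "C = D (\<tau> a x) y" and "E = D (\<tau> a y) x"
    have in_L: "A \<in> L" "B \<in> L" "C \<in> L" "E \<in> L" "lie x B \<in> L" "lie y A \<in> L" "lie x B - lie y A \<in> L"
        "C - E \<in> L"
      using xy by (auto simp: A_def B_def C_def E_def D_in L_closed)
    have swap: "gen v * (scal k * p) = scal k * (gen v * p)" for v :: 'l and k p
      by (rule scal_left_commute)
    have "J a (r * q) = r * J a q
        + (gen x * gen B - gen B * gen x - gen (lie x B)) * q
        - (gen y * gen A - gen A * gen y - gen (lie y A)) * q
        - (gen ((lie x B - lie y A) + (C - E)) - (gen (lie x B - lie y A) + gen (C - E))) * q
        - (gen (lie x B - lie y A) - (gen (lie x B) - gen (lie y A))) * q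
        - (gen (C - E) - (gen C - gen E)) * q
        - (J (\<tau> (\<tau> a x) y - \<tau> (\<tau> a y) x) q - (J (\<tau> (\<tau> a x) y) q - J (\<tau> (\<tau> a y) x) q))"
      unfolding 3(3) using right_lie[OF xy, of a]
      by (simp add: left_diff_distrib right_diff_distrib distrib_left distrib_right comm_op_gen_mult
          mult.assoc swap A_def B_def C_def E_def scal_add scal_minus)
        (simp add: algebra_simps swap scal_diff)
    then show ?thesis
      using xy in_L q r L
      by (simp only: rel_ideal_diff rel_ideal.add rel_ideal.rel rel_ideal_right rel_ideal_gen_lie
          rel_ideal_gen_add rel_ideal_gen_diff J_diff J_free)
  qed
qed

lemma J_rel_ideal: "p \<in> rel_ideal L \<Longrightarrow> J a p \<in> rel_ideal L"
proof (induction arbitrary: a rule: rel_ideal.induct)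
  case (gen x p)
  then show ?case
    by (simp add: comm_op_gen_mult rel_ideal.add rel_ideal.gen rel_ideal_left free_diff free_gen D_in)
qed (simp_all add: J_env_rels rel_ideal.intros)

end

text \<open>If the commutators with constants reduce to \<open>J (\<tau> a x)\<close>, then \<open>J a\<close> kills the generators of the
left ideal modulo relations, and commuting it past further letters does not leave the ideal.\<close>

lemma comm_op_vac_ideal:
  fixes L :: "'g :: complex_lie_algebra mero set" and D :: "'h :: complex_vector \<Rightarrow> 'g mero \<Rightarrow> 'g mero"
  assumes "comm_data L D c \<tau>"
    and "\<And>a b. D a (mconst b) = 0" "\<And>a b. c a (mconst b) = 0"
    and "p \<in> vac_ideal L"
  shows "comm_op D c \<tau> a p \<in> vac_ideal L"
proof -
  interpret comm_data L D c \<tau> by fact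
  from assms(4) show ?thesis
  proof (induction arbitrary: a rule: vac_ideal.induct)
    case (rel p)
    then show ?case
      by (intro vac_ideal.rel J_rel_ideal)
  next
    case (const b)
    show ?case
      using comm_op_gen_mult[of D c \<tau> a "mconst b" 1] assms(2,3)
      by (simp add: vac_ideal.rel rel_ideal_gen_0 L)
  next
    case (gen x p)
    then show ?case
      by (simp add: comm_op_gen_mult vac_ideal.add vac_ideal.gen vac_ideal_left free_diff free_gen D_in)
  qed (simp_all add: vac_ideal.intros)
qed

section \<open>Values of meromorphic maps\<close>

lemma loc_0 [simp]: "loc z 0 = z"
  by (cases z) auto

lemma eventually_loc_notin:
  assumes "finite A"
  shows "eventually (\<lambda>w. loc z w \<notin> A) (at 0)"
proof -
  have "finite (loc z -` A)"
    using assms inj_loc by (rule finite_vimageI)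
  then have "eventually (\<lambda>w. w \<notin> loc z -` A) (at 0)"
    by (metis islimpt_finite islimpt_iff_eventually)
  then show ?thesis
    by simp
qed

lemma abs_mero_eq_iff:
  assumes "is_mero \<alpha>" "is_mero \<beta>"
  shows "abs_mero \<alpha> = abs_mero \<beta> \<longleftrightarrow> finite {x. \<alpha> x \<noteq> \<beta> x}"
  using Quotient3_rel[OF Quotient3_mero, of \<alpha> \<beta>] assms by (auto simp: mero_eq_def)

lemma mero_eq_refl: "is_mero \<alpha> \<Longrightarrow> mero_eq \<alpha> \<alpha>"
  by (simp add: mero_eq_def)

text \<open>The representatives in the definition of regularity and values: their pointwise value at \<open>z\<close> is the
value of the class.\<close>

definition expansion :: "sphere \<Rightarrow> (sphere \<Rightarrow> 'a :: complex_vector) \<Rightarrow> bool" where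
  "expansion z \<phi> \<longleftrightarrow> (\<exists>(n :: nat) f b. (\<forall>i<n. mero_fun (f i) \<and> (\<lambda>w. f i (loc z w)) analytic_on {0}) \<and>
     \<phi> = (\<lambda>x. \<Sum>i<n. f i x *\<^sub>C b i))"

lemma has_value_iff_expansion:
  "has_value \<alpha> z v \<longleftrightarrow> (\<exists>\<phi>. expansion z \<phi> \<and> \<alpha> = abs_mero \<phi> \<and> v = \<phi> z)"
  unfolding has_value_def expansion_def by blast

lemma expansion_is_mero: "expansion z \<phi> \<Longrightarrow> is_mero \<phi>"
  unfolding expansion_def by (auto intro!: is_mero_sum is_mero_term)

lemma expansion_0: "expansion z (\<lambda>_. 0)"
  unfolding expansion_def by (rule exI[of _ 0]) auto

lemma expansion_add_term:
  assumes "expansion z \<phi>" "mero_fun g" "(\<lambda>w. g (loc z w)) analytic_on {0}"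
  shows "expansion z (\<lambda>x. \<phi> x + g x *\<^sub>C c)"
proof -
  obtain n :: nat and f b where *: "\<forall>i<n. mero_fun (f i) \<and> (\<lambda>w. f i (loc z w)) analytic_on {0}"
      "\<phi> = (\<lambda>x. \<Sum>i<n. f i x *\<^sub>C b i)"
    using assms(1) unfolding expansion_def by blast
  have "(\<lambda>x. \<phi> x + g x *\<^sub>C c) = (\<lambda>x. \<Sum>i<Suc n. (f(n := g)) i x *\<^sub>C (b(n := c)) i)"
    unfolding *(2) by (auto intro!: sum.cong)
  moreover have "\<forall>i<Suc n. mero_fun ((f(n := g)) i) \<and> (\<lambda>w. (f(n := g)) i (loc z w)) analytic_on {0}"
    using *(1) assms(2,3) by (auto simp: less_Suc_eq)
  ultimately show ?thesis
    unfolding expansion_def by blast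
qed

lemma expansion_term:
  "mero_fun g \<Longrightarrow> (\<lambda>w. g (loc z w)) analytic_on {0} \<Longrightarrow> expansion z (\<lambda>x. g x *\<^sub>C c)"
  using expansion_add_term[OF expansion_0, of g z c] by simp

lemma expansion_induct [consumes 1, case_names zero add_term]:
  assumes "expansion z \<phi>"
    and "Q (\<lambda>_. 0)"
    and "\<And>\<phi> g c. expansion z \<phi> \<Longrightarrow> Q \<phi> \<Longrightarrow> mero_fun g \<Longrightarrow> (\<lambda>w. g (loc z w)) analytic_on {0} \<Longrightarrow>
      Q (\<lambda>x. \<phi> x + g x *\<^sub>C c)"
  shows "Q \<phi>"
proof -
  obtain n :: nat and f b where *: "\<forall>i<n. mero_fun (f i) \<and> (\<lambda>w. f i (loc z w)) analytic_on {0}"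
      "\<phi> = (\<lambda>x. \<Sum>i<n. f i x *\<^sub>C b i)"
    using assms(1) unfolding expansion_def by blast
  have "expansion z (\<lambda>x. \<Sum>i<m. f i x *\<^sub>C b i) \<and> Q (\<lambda>x. \<Sum>i<m. f i x *\<^sub>C b i)" if "m \<le> n" for m
    using that
  proof (induction m)
    case 0
    then show ?case by (simp add: expansion_0 assms(2))
  next
    case (Suc m)
    then show ?case
      using *(1) by (auto intro!: expansion_add_term assms(3))
  qed
  then show ?thesis
    using *(2) by blast
qed

lemma expansion_add:
  assumes "expansion z \<phi>" "expansion z \<psi>"
  shows "expansion z (\<lambda>x. \<phi> x + \<psi> x)"
  using assms(2)
proof (induction rule: expansion_induct)
  case zero
  then show ?case using assms(1) by simp
next
  case (add_term \<psi> g c)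
  then show ?case
    using expansion_add_term[of z "\<lambda>x. \<phi> x + \<psi> x" g c] by (simp add: add.assoc)
qed

lemma expansion_linear_image:
  assumes "expansion z \<phi>" and "\<And>x y. T (x + y) = T x + T y" "\<And>c x. T (c *\<^sub>C x) = c *\<^sub>C T x"
  shows "expansion z (\<lambda>x. T (\<phi> x))"
  using assms(1)
proof (induction rule: expansion_induct)
  case zero
  have "T 0 = 0" using assms(2)[of 0 0] by simp
  then show ?case by (simp add: expansion_0)
next
  case (add_term \<phi> g c)
  then show ?case by (auto simp: assms(2,3) intro!: expansion_add_term)
qed

lemma expansion_smult:
  assumes "mero_fun f" "(\<lambda>w. f (loc z w)) analytic_on {0}" "expansion z \<phi>"
  shows "expansion z (\<lambda>x. f x *\<^sub>C \<phi> x)"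
  using assms(3)
proof (induction rule: expansion_induct)
  case zero
  then show ?case by (simp add: expansion_0)
next
  case (add_term \<phi> g c)
  then show ?case
    using assms(1,2) expansion_add_term[of z "\<lambda>x. f x *\<^sub>C \<phi> x" "\<lambda>x. f x * g x" c]
    by (simp add: scaleC_add_right scaleC_scaleC mero_fun_mult analytic_on_mult)
qed

lemma expansion_complex:
  "expansion z \<phi> \<longleftrightarrow> mero_fun \<phi> \<and> (\<lambda>w. \<phi> (loc z w)) analytic_on {0}" (is "?A \<longleftrightarrow> ?B")
proof
  show ?B if ?A
    using that
  proof (induction rule: expansion_induct)
    case zero
    then show ?case by (auto intro: mero_fun_const)
  next
    case (add_term \<phi> g c)
    then show ?case
      by (auto simp: scaleC_complex_def intro!: mero_fun_add mero_fun_mult mero_fun_const analytic_intros)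
  qed
  show ?A if ?B
    using that expansion_term[of \<phi> z "1 :: complex"] by (simp add: scaleC_complex_def)
qed

lemma expansion_lie:
  fixes \<phi> \<psi> :: "sphere \<Rightarrow> 'a :: complex_lie_algebra"
  assumes "expansion z \<phi>" "expansion z \<psi>"
  shows "expansion z (\<lambda>x. lie (\<phi> x) (\<psi> x))"
  using assms(1)
proof (induction rule: expansion_induct)
  case zero
  then show ?case by (simp add: expansion_0)
next
  case (add_term \<phi> g c)
  have "expansion z (\<lambda>x. lie c (\<psi> x))"
    using assms(2) by (rule expansion_linear_image) (simp_all add: lie_add_right lie_scaleC_right)
  then have "expansion z (\<lambda>x. g x *\<^sub>C lie c (\<psi> x))"
    using add_term by (intro expansion_smult)
  then show ?case
    using expansion_add[OF add_term.IH] by (simp add: lie_add_left lie_scaleC_left)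
qed

lemma expansion_form:
  fixes \<phi> :: "sphere \<Rightarrow> 'a :: metrized_lie_algebra"
  assumes "expansion z \<phi>"
  shows "expansion z (\<lambda>x. form a (\<phi> x))"
  using expansion_linear_image[OF assms, of "form a"]
  by (simp add: form_add_right form_scaleC_right scaleC_complex_def)

lemma expansion_const: "expansion z (\<lambda>_. b)"
  using expansion_term[of "\<lambda>_. 1" z b] by (simp add: mero_fun_const scaleC_one)

text \<open>The space \<open>\<g>\<close> carries no topology; a family of linear functionals that separates its points
  reduces the uniqueness of values to the identity of continuous scalar functions.\<close>

lemma expansion_determines_value:
  fixes \<phi> \<psi> :: "sphere \<Rightarrow> 'a :: complex_vector" and \<Phi> :: "'b \<Rightarrow> 'a \<Rightarrow> complex"
  assumes "expansion z \<phi>" "expansion z \<psi>" "finite {x. \<phi> x \<noteq> \<psi> x}"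
    and add: "\<And>y u v. \<Phi> y (u + v) = \<Phi> y u + \<Phi> y v"
    and scale: "\<And>y c v. \<Phi> y (c *\<^sub>C v) = c * \<Phi> y v"
    and sep: "\<And>v. (\<And>y. \<Phi> y v = 0) \<Longrightarrow> v = 0"
  shows "\<phi> z = \<psi> z"
proof -
  have diff: "\<Phi> y (u - v) = \<Phi> y u - \<Phi> y v" for y u v
    using add[of y "u - v" v] by simp
  have "\<Phi> y (\<phi> z - \<psi> z) = 0" for y
  proof -
    have an: "expansion z (\<lambda>x. \<Phi> y (\<phi> x))" "expansion z (\<lambda>x. \<Phi> y (\<psi> x))"
      using expansion_linear_image[OF assms(1), of "\<Phi> y"] expansion_linear_image[OF assms(2), of "\<Phi> y"]
      by (simp_all add: add scale scaleC_complex_def)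
    define F where "F = (\<lambda>w. \<Phi> y (\<phi> (loc z w)) - \<Phi> y (\<psi> (loc z w)))"
    have "F analytic_on {0}"
      using an unfolding F_def expansion_complex by (intro analytic_intros) auto
    then have "F \<midarrow>0\<rightarrow> F 0"
      by (intro isContD analytic_at_imp_isCont)
    moreover have "eventually (\<lambda>w. F w = 0) (at 0)"
      using eventually_loc_notin[OF assms(3), of z] by eventually_elim (simp add: F_def)
    then have "F \<midarrow>0\<rightarrow> 0"
      by (rule tendsto_eventually)
    ultimately have "F 0 = 0"
      by (rule LIM_unique)
    then show ?thesis
      by (simp add: F_def diff)
  qed
  then show ?thesis
    using sep[of "\<phi> z - \<psi> z"] by simp
qed

lemma has_value_unique:
  fixes \<alpha> :: "'g :: metrized_lie_algebra mero"
  assumes "has_value \<alpha> z v" "has_value \<alpha> z w"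
  shows "v = w"
proof -
  obtain \<phi> \<psi> where "expansion z \<phi>" "\<alpha> = abs_mero \<phi>" "v = \<phi> z" "expansion z \<psi>" "\<alpha> = abs_mero \<psi>" "w = \<psi> z"
    using assms unfolding has_value_iff_expansion by blast
  then show ?thesis
    using expansion_determines_value[of z \<phi> \<psi> form] abs_mero_eq_iff[of \<phi> \<psi>]
    by (simp add: expansion_is_mero form_add_right form_scaleC_right)
      (metis form_nondegenerate form_sym)
qed

lemma has_value_unique_complex:
  fixes f :: "complex mero"
  assumes "has_value f z v" "has_value f z w"
  shows "v = w"
proof -
  obtain \<phi> \<psi> where "expansion z \<phi>" "f = abs_mero \<phi>" "v = \<phi> z" "expansion z \<psi>" "f = abs_mero \<psi>" "w = \<psi> z"
    using assms unfolding has_value_iff_expansion by blast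
  then show ?thesis
    using expansion_determines_value[of z \<phi> \<psi> "\<lambda>_ x. x"] abs_mero_eq_iff[of \<phi> \<psi>]
    by (simp add: expansion_is_mero scaleC_complex_def)
qed

lemma mval_eq: "has_value (\<alpha> :: 'g :: metrized_lie_algebra mero) z v \<Longrightarrow> mval \<alpha> z = v"
  unfolding mval_def using has_value_unique by blast

lemma mval_eq_complex: "has_value (f :: complex mero) z v \<Longrightarrow> mval f z = v"
  unfolding mval_def using has_value_unique_complex by blast

lemma has_value_mval: "regular (\<alpha> :: 'g :: metrized_lie_algebra mero) z \<Longrightarrow> has_value \<alpha> z (mval \<alpha> z)"
  unfolding regular_def using mval_eq by blast

lemma has_value_mval_complex: "regular (f :: complex mero) z \<Longrightarrow> has_value f z (mval f z)"
  unfolding regular_def using mval_eq_complex by blast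

lemma has_value_add: "has_value \<alpha> z v \<Longrightarrow> has_value \<beta> z w \<Longrightarrow> has_value (\<alpha> + \<beta>) z (v + w)"
  unfolding has_value_iff_expansion
  by (metis (no_types) expansion_add expansion_is_mero mero_eq_refl plus_mero.abs_eq)

lemma has_value_msmult: "has_value f z c \<Longrightarrow> has_value \<alpha> z v \<Longrightarrow> has_value (f \<odot> \<alpha>) z (c *\<^sub>C v)"
  unfolding has_value_iff_expansion
  by (metis (no_types) expansion_smult expansion_complex expansion_is_mero mero_eq_refl msmult.abs_eq)

lemma has_value_lie: "has_value \<alpha> z v \<Longrightarrow> has_value \<beta> z w \<Longrightarrow> has_value (lie \<alpha> \<beta>) z (lie v w)"
  unfolding has_value_iff_expansion
  by (metis (no_types) expansion_lie expansion_is_mero mero_eq_refl lie_mero.abs_eq)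

lemma has_value_mform: "has_value \<alpha> z v \<Longrightarrow> has_value (mform a \<alpha>) z (form a v)"
  unfolding has_value_iff_expansion
  by (metis (no_types) expansion_form expansion_is_mero mero_eq_refl mform.abs_eq)

lemma has_value_mconst: "has_value (mconst b) z b"
  unfolding has_value_iff_expansion mconst_def
  using expansion_const[of z b] by (metis mconst.abs_eq mconst_def)

text \<open>By Riemann's theorem on removable singularities, the values of scalar functions are limits, and can
be computed from any representative.\<close>

lemma has_value_complex_iff_limit:
  assumes "mero_fun \<phi>"
  shows "has_value (abs_mero \<phi>) z v \<longleftrightarrow> ((\<lambda>w. \<phi> (loc z w)) \<longlongrightarrow> v) (at 0)"
proof
  assume "has_value (abs_mero \<phi>) z v"
  then obtain \<psi> where \<psi>: "expansion z \<psi>" "abs_mero \<phi> = abs_mero \<psi>" "v = \<psi> z"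
    unfolding has_value_iff_expansion by blast
  then have fin: "finite {x. \<psi> x \<noteq> \<phi> x}"
    using assms abs_mero_eq_iff[of \<psi> \<phi>] expansion_is_mero[of z \<psi>] by (simp add: is_mero_complex)
  have "(\<lambda>w. \<psi> (loc z w)) analytic_on {0}"
    using \<psi>(1) by (simp add: expansion_complex)
  then have "(\<lambda>w. \<psi> (loc z w)) \<midarrow>0\<rightarrow> v"
    using analytic_at_imp_isCont[of "\<lambda>w. \<psi> (loc z w)" 0] \<psi>(3) by (simp add: isCont_def)
  moreover have "eventually (\<lambda>w. \<psi> (loc z w) = \<phi> (loc z w)) (at 0)"
    using eventually_loc_notin[OF fin, of z] by eventually_elim simp
  ultimately show "(\<lambda>w. \<phi> (loc z w)) \<midarrow>0\<rightarrow> v"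
    using tendsto_cong by fast
next
  assume lim: "(\<lambda>w. \<phi> (loc z w)) \<midarrow>0\<rightarrow> v"
  let ?F = "\<lambda>w. \<phi> (loc z w)" and ?\<psi> = "\<phi>(z := v)"
  have "?F meromorphic_on {0}"
    using assms by (simp add: mero_fun_def)
  then have iso: "isolated_singularity_at ?F 0"
    by (rule meromorphic_on_isolated_singularity)
  have an: "remove_sings ?F analytic_on {0}"
    using remove_sings_analytic_at[OF iso lim] .
  have "eventually (\<lambda>w. loc z w \<noteq> z) (at 0)"
    using eventually_loc_notin[of "{z}" z] by simp
  with eventually_remove_sings_eq_at[OF iso]
  have "eventually (\<lambda>w. remove_sings ?F w = ?\<psi> (loc z w)) (at 0)"
    by eventually_elim simp
  moreover have "remove_sings ?F 0 = ?\<psi> (loc z 0)"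
    using remove_sings_eqI[OF lim] by simp
  ultimately have "eventually (\<lambda>w. remove_sings ?F w = ?\<psi> (loc z w)) (nhds 0)"
    by (simp add: eventually_nhds_conv_at)
  then have "(\<lambda>w. ?\<psi> (loc z w)) analytic_on {0}"
    using an analytic_at_cong by metis
  moreover have fin: "finite {x. ?\<psi> x \<noteq> \<phi> x}"
    by (rule finite_subset[of _ "{z}"]) auto
  moreover have "mero_fun ?\<psi>"
    using mero_fun_cong[OF assms fin] .
  moreover have "abs_mero \<phi> = abs_mero ?\<psi>"
    using abs_mero_eq_iff[of \<phi> ?\<psi>] assms \<open>mero_fun ?\<psi>\<close> fin by (simp add: is_mero_complex eq_commute)
  ultimately show "has_value (abs_mero \<phi>) z v"
    unfolding has_value_iff_expansion expansion_complex by (metis fun_upd_same)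
qed

section \<open>Multiplication by scalar functions\<close>

lemma is_mero_times: "is_mero f \<Longrightarrow> is_mero g \<Longrightarrow> is_mero (\<lambda>x. f x * g x :: complex)"
  by (simp add: is_mero_complex mero_fun_mult)

lemma msmult_add_right: "f \<odot> (\<alpha> + \<beta>) = f \<odot> \<alpha> + f \<odot> \<beta>"
  by transfer (auto simp: mero_eq_def scaleC_add_right intro!: is_mero_add is_mero_smult)

lemma msmult_add_left: "(f + g) \<odot> \<alpha> = f \<odot> \<alpha> + g \<odot> \<alpha>"
  by transfer (auto simp: mero_eq_def scaleC_add_left intro!: is_mero_add is_mero_smult)

lemma msmult_scaleC_right: "f \<odot> (k *\<^sub>C \<alpha>) = k *\<^sub>C (f \<odot> \<alpha>)"
  by transfer (auto simp: mero_eq_def scaleC_scaleC mult.commute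
      intro!: is_mero_scaleC is_mero_smult is_mero_times is_mero_const)

lemma msmult_scaleC_left: "(k *\<^sub>C f) \<odot> \<alpha> = k *\<^sub>C (f \<odot> \<alpha>)"
  by transfer (simp add: mero_eq_def scaleC_scaleC scaleC_complex_def
      is_mero_scaleC is_mero_smult is_mero_times is_mero_const)

lemma msmult_assoc: "(f \<odot> g) \<odot> \<alpha> = f \<odot> (g \<odot> \<alpha>)"
  by transfer (auto simp: mero_eq_def scaleC_scaleC scaleC_complex_def
      intro!: is_mero_smult is_mero_times)

lemma msmult_const: "mconst k \<odot> \<alpha> = k *\<^sub>C \<alpha>"
  by transfer (auto simp: mero_eq_def intro!: is_mero_scaleC)

lemma lie_msmult_left: "lie (f \<odot> \<alpha>) \<beta> = f \<odot> lie \<alpha> \<beta>"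
  by transfer (auto simp: mero_eq_def lie_scaleC_left intro!: is_mero_lie is_mero_smult)

lemma lie_msmult_right: "lie \<alpha> (f \<odot> \<beta>) = f \<odot> lie \<alpha> \<beta>"
  by transfer (auto simp: mero_eq_def lie_scaleC_right intro!: is_mero_lie is_mero_smult)

lemma mform_add_right: "mform a (\<alpha> + \<beta>) = mform a \<alpha> + mform a \<beta>"
  by transfer (auto simp: mero_eq_def form_add_right intro!: is_mero_add is_mero_form)

lemma mform_add_left: "mform (a + b) \<alpha> = mform a \<alpha> + mform b \<alpha>"
  by transfer (auto simp: mero_eq_def form_add_left intro!: is_mero_add is_mero_form)

lemma mform_msmult: "mform a (f \<odot> \<alpha>) = f \<odot> mform a \<alpha>"
  by transfer (auto simp: mero_eq_def form_scaleC_right scaleC_complex_def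
    intro!: is_mero_form is_mero_smult is_mero_times)

lemma mform_scaleC_left: "mform (k *\<^sub>C a) \<alpha> = k *\<^sub>C mform a \<alpha>"
  by transfer (auto simp: mero_eq_def form_scaleC_left scaleC_complex_def
      intro!: is_mero_form is_mero_times is_mero_const)

lemma mform_const: "mform a (mconst b) = mconst (form a b)"
  by transfer (auto simp: mero_eq_def is_mero_const is_mero_form)

lemma mform_lie: "mform a (lie (mconst b) \<alpha>) = mform (lie a b) \<alpha>"
  by transfer (auto simp: mero_eq_def form_invariant intro!: is_mero_form is_mero_lie is_mero_const)

text \<open>A regular map is a finite sum of regular scalar functions times constant maps, even if the Lie
algebra has infinite dimension.\<close>

lemma regular_induct [consumes 1, case_names zero add_term]:
  assumes "regular \<alpha> z"
    and "Q 0"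
    and "\<And>\<alpha> f b. regular \<alpha> z \<Longrightarrow> Q \<alpha> \<Longrightarrow> regular f z \<Longrightarrow> Q (\<alpha> + f \<odot> mconst b)"
  shows "Q \<alpha>"
proof -
  obtain \<phi> where \<phi>: "expansion z \<phi>" "\<alpha> = abs_mero \<phi>"
    using assms(1) unfolding regular_def has_value_iff_expansion by blast
  from \<phi>(1) have "Q (abs_mero \<phi>)"
  proof (induction rule: expansion_induct)
    case zero
    then show ?case
      using assms(2) by (simp add: zero_mero.abs_eq zero_mero_def)
  next
    case (add_term \<phi> g c)
    have g: "expansion z g"
      using add_term by (simp add: expansion_complex)
    have im: "is_mero \<phi>" "is_mero g" "is_mero (\<lambda>x. g x *\<^sub>C c)"
      using add_term expansion_is_mero[OF g] expansion_is_mero[of z \<phi>] is_mero_term by auto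
    have "abs_mero (\<lambda>x. \<phi> x + g x *\<^sub>C c) = abs_mero \<phi> + abs_mero g \<odot> mconst c"
      using im by (simp add: mconst_def[symmetric] plus_mero.abs_eq msmult.abs_eq mconst.abs_eq
          mero_eq_refl is_mero_const)
    moreover have "regular (abs_mero \<phi>) z" "regular (abs_mero g) z"
      using add_term(1) g unfolding regular_def has_value_iff_expansion by blast+
    ultimately show ?case
      using assms(3) add_term.IH by metis
  qed
  then show ?thesis
    using \<phi>(2) by simp
qed

lemma has_value_scaleC: "has_value \<alpha> z v \<Longrightarrow> has_value (k *\<^sub>C \<alpha>) z (k *\<^sub>C v)"
  using has_value_msmult[OF has_value_mconst, of \<alpha> z v k] by (simp add: msmult_const)

lemma has_value_uminus: "has_value \<alpha> z v \<Longrightarrow> has_value (- \<alpha>) z (- v)"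
  using has_value_scaleC[of \<alpha> z v "- 1"] by (simp add: scaleC_minus_one)

lemma has_value_diff: "has_value \<alpha> z v \<Longrightarrow> has_value \<beta> z w \<Longrightarrow> has_value (\<alpha> - \<beta>) z (v - w)"
  using has_value_add[OF _ has_value_uminus, of \<alpha> z v \<beta> w] by simp

lemma regular_closed:
  "regular \<alpha> z \<Longrightarrow> regular \<beta> z \<Longrightarrow> regular (\<alpha> + \<beta>) z"
  "regular \<alpha> z \<Longrightarrow> regular \<beta> z \<Longrightarrow> regular (\<alpha> - \<beta>) z"
  "regular \<alpha> z \<Longrightarrow> regular (k *\<^sub>C \<alpha>) z" "regular \<alpha> z \<Longrightarrow> regular (- \<alpha>) z"
  "regular f z \<Longrightarrow> regular \<alpha> z \<Longrightarrow> regular (f \<odot> \<alpha>) z" "regular (mconst b) z"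
  unfolding regular_def
  by (blast intro: has_value_add has_value_diff has_value_scaleC has_value_uminus has_value_msmult
      has_value_mconst)+

lemma regular_lie: "regular \<alpha> z \<Longrightarrow> regular \<beta> z \<Longrightarrow> regular (lie \<alpha> \<beta>) z"
  unfolding regular_def by (blast intro: has_value_lie)

lemma regular_mform: "regular \<alpha> z \<Longrightarrow> regular (mform a \<alpha>) z"
  unfolding regular_def by (blast intro: has_value_mform)

lemma mval_simps:
  fixes \<alpha> \<beta> :: "'g :: metrized_lie_algebra mero"
  shows "regular \<alpha> z \<Longrightarrow> regular \<beta> z \<Longrightarrow> mval (\<alpha> + \<beta>) z = mval \<alpha> z + mval \<beta> z"
    "regular \<alpha> z \<Longrightarrow> mval (k *\<^sub>C \<alpha>) z = k *\<^sub>C mval \<alpha> z"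
    "regular \<alpha> z \<Longrightarrow> regular \<beta> z \<Longrightarrow> mval (lie \<alpha> \<beta>) z = lie (mval \<alpha> z) (mval \<beta> z)"
    "regular f z \<Longrightarrow> regular \<alpha> z \<Longrightarrow> mval (f \<odot> \<alpha>) z = mval f z *\<^sub>C mval \<alpha> z"
    "mval (mconst b :: 'g mero) z = b"
  by (simp_all add: mval_eq has_value_add has_value_scaleC has_value_lie has_value_msmult
      has_value_mconst has_value_mval has_value_mval_complex)

section \<open>Coordinates\<close>

text \<open>After removal of its singularities, the function is entire and has a limit at infinity, so it is
constant by Liouville's theorem. The exceptional points do not accumulate in the plane, and are
absent near infinity, because singularities of a meromorphic function are isolated there too.\<close>

lemma liouville_sphere:
  assumes "mero_fun \<psi>" and lim: "\<And>z. \<exists>l. ((\<lambda>w. \<psi> (loc z w)) \<longlongrightarrow> l) (at 0)"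
  shows "\<exists>d. finite {x. \<psi> x \<noteq> d}"
proof -
  define F where "F = (\<lambda>\<zeta>. \<psi> (Pt \<zeta>))"
  define F' where "F' = remove_sings F"
  have shift: "(\<lambda>w. F (\<zeta> + w)) meromorphic_on {0}" for \<zeta>
    using assms(1) unfolding mero_fun_def F_def by (metis (no_types, lifting) ext loc.simps(1))
  have iso: "isolated_singularity_at F \<zeta>" for \<zeta>
    using meromorphic_on_isolated_singularity[OF shift[of \<zeta>]] isolated_singularity_at_shift_0[of \<zeta> F]
    by (simp add: add.commute)
  have an: "F' analytic_on {\<zeta>}" for \<zeta>
  proof -
    obtain l where "((\<lambda>w. F (\<zeta> + w)) \<longlongrightarrow> l) (at 0)"
      using lim[of "Pt \<zeta>"] by (auto simp: F_def)
    then have "F \<midarrow>\<zeta>\<rightarrow> l"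
      by (subst LIM_offset_zero_iff) auto
    then show ?thesis
      unfolding F'_def by (rule remove_sings_analytic_at[OF iso])
  qed
  then have hol: "F' holomorphic_on UNIV"
    using analytic_on_analytic_at analytic_imp_holomorphic by blast
  define G where "G = (\<lambda>w. \<psi> (loc Infty w))"
  have GF: "G w = F (inverse w)" if "w \<noteq> 0" for w
    using that by (simp add: G_def F_def inverse_eq_divide)
  obtain d where d: "(G \<longlongrightarrow> d) (at 0)"
    using lim[of Infty] by (auto simp: G_def)
  have "G meromorphic_on {0}"
    using assms(1) unfolding mero_fun_def G_def by blast
  then have "isolated_singularity_at G 0"
    by (rule meromorphic_on_isolated_singularity)
  then obtain r where r: "r > 0" "G analytic_on ball 0 r - {0}"
    unfolding isolated_singularity_at_def by auto
  have F'F: "F' (inverse w) = F (inverse w)" if w: "w \<in> ball 0 r - {0}" for w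
  proof -
    have "inverse analytic_on {inverse w}"
      using w by (intro analytic_intros) auto
    moreover have "G analytic_on inverse ` {inverse w}"
      using w r(2) by (auto intro: analytic_on_subset)
    ultimately have "(G \<circ> inverse) analytic_on {inverse w}"
      by (rule analytic_on_compose)
    moreover have "eventually (\<lambda>\<zeta>. \<zeta> \<in> - {0}) (nhds (inverse w))"
      using w by (intro eventually_nhds_in_open) auto
    then have "eventually (\<lambda>\<zeta>. (G \<circ> inverse) \<zeta> = F \<zeta>) (nhds (inverse w))"
      by eventually_elim (simp add: GF)
    ultimately have "F analytic_on {inverse w}"
      using analytic_at_cong by blast
    then show ?thesis
      unfolding F'_def by (rule remove_sings_at_analytic)
  qed
  have ev: "eventually (\<lambda>w. w \<in> ball 0 r - {0}) (at (0::complex))"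
    using r(1) by (intro eventually_at_in_open) auto
  have "((F' \<circ> inverse) \<longlongrightarrow> d) (at 0)"
  proof (rule Lim_transform_eventually[OF d])
    show "eventually (\<lambda>w. G w = (F' \<circ> inverse) w) (at 0)"
      using ev by eventually_elim (simp add: GF F'F)
  qed
  then have "((\<lambda>\<zeta>. F' \<zeta> - d) \<longlongrightarrow> 0) at_infinity"
    unfolding lim_at_infinity_0 o_def by (rule LIM_zero)
  then have F'd: "F' \<zeta> = d" for \<zeta>
    using Liouville_weak_0[of "\<lambda>\<zeta>. F' \<zeta> - d" \<zeta>] hol by (simp add: holomorphic_intros)
  have not_lim: "\<not> \<zeta> islimpt {\<zeta>. F \<zeta> \<noteq> d}" for \<zeta>
    using eventually_remove_sings_eq_at[OF iso, of \<zeta>] F'd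
    unfolding islimpt_iff_eventually F'_def by (auto elim: eventually_mono)
  have "finite (cball 0 (2 / r) \<inter> {\<zeta>. F \<zeta> \<noteq> d})"
    using not_lim by (intro finite_not_islimpt_in_compact) auto
  moreover have "{x. \<psi> x \<noteq> d} \<subseteq> insert Infty (Pt ` (cball 0 (2 / r) \<inter> {\<zeta>. F \<zeta> \<noteq> d}))"
  proof
    fix x assume x: "x \<in> {x. \<psi> x \<noteq> d}"
    show "x \<in> insert Infty (Pt ` (cball 0 (2 / r) \<inter> {\<zeta>. F \<zeta> \<noteq> d}))"
    proof (cases x)
      case (Pt \<zeta>)
      have "\<zeta> \<in> cball 0 (2 / r)"
      proof (rule ccontr)
        assume "\<zeta> \<notin> cball 0 (2 / r)"
        then have n: "2 / r < norm \<zeta>" by simp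
        then have "\<zeta> \<noteq> 0" using r(1) by (auto simp: field_simps)
        have "1 < r * norm \<zeta>"
          using n r(1) by (simp add: field_simps)
        then have "norm (inverse \<zeta>) < r"
          using \<open>\<zeta> \<noteq> 0\<close> by (simp add: norm_divide inverse_eq_divide divide_less_eq)
        then have "inverse \<zeta> \<in> ball 0 r - {0}"
          using \<open>\<zeta> \<noteq> 0\<close> by simp
        then have "F \<zeta> = d"
          using F'F[of "inverse \<zeta>"] F'd by simp
        then show False
          using x Pt by (simp add: F_def)
      qed
      then show ?thesis
        using x Pt by (auto simp: F_def)
    qed simp
  qed
  ultimately show ?thesis
    by (meson finite.insertI finite_imageI finite_subset)
qed

text \<open>The standard coordinate with its pole at the first argument. At the pole itself, the value \<open>0\<close> is a
default.\<close>

fun pole_fun :: "sphere \<Rightarrow> sphere \<Rightarrow> complex" where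
  "pole_fun Infty (Pt \<zeta>) = \<zeta>"
| "pole_fun (Pt p) (Pt \<zeta>) = inverse (\<zeta> - p)"
| "pole_fun _ Infty = 0"

lemma pole_fun_loc_self: "pole_fun P (loc P w) = inverse w"
  by (cases P) (auto simp: inverse_eq_divide)

lemma pole_fun_loc_Infty: "pole_fun (Pt p) (loc Infty w) = w / (1 - p * w)"
  by (auto simp: field_simps)

lemma mero_fun_pole_fun: "mero_fun (pole_fun P)"
  unfolding mero_fun_def
proof
  fix z
  show "(\<lambda>w. pole_fun P (loc z w)) meromorphic_on {0}"
  proof (cases "z = P")
    case True
    then show ?thesis
      by (auto simp: pole_fun_loc_self intro!: meromorphic_intros)
  next
    case False
    then show ?thesis
      by (cases P; cases z; simp only: pole_fun_loc_Infty loc.simps(1) pole_fun.simps)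
        (auto intro!: meromorphic_intros)
  qed
qed

lemma pole_fun_inj: "x \<noteq> P \<Longrightarrow> y \<noteq> P \<Longrightarrow> pole_fun P x = pole_fun P y \<Longrightarrow> x = y"
  by (cases P; cases x; cases y) auto

lemma pole_fun_deriv:
  assumes "z \<noteq> P"
  shows "\<exists>k. k \<noteq> 0 \<and> ((\<lambda>w. pole_fun P (loc z w)) has_field_derivative k) (at 0)"
proof (cases P; cases z)
  fix \<zeta> assume "P = Infty" "z = Pt \<zeta>"
  moreover have "((\<lambda>w. \<zeta> + w) has_field_derivative 1) (at 0)"
    by (auto intro!: derivative_eq_intros)
  ultimately show ?thesis by (intro exI[of _ 1]) simp
next
  fix p assume *: "P = Pt p" "z = Infty"
  have "((\<lambda>w. w / (1 - p * w)) has_field_derivative 1) (at 0)"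
    by (auto intro!: derivative_eq_intros)
  then show ?thesis
    using * by (intro exI[of _ 1]) (simp only: pole_fun_loc_Infty, simp)
next
  fix p \<zeta> assume *: "P = Pt p" "z = Pt \<zeta>"
  then have "\<zeta> - p \<noteq> 0" using assms by simp
  then have "((\<lambda>w. inverse (\<zeta> + w - p)) has_field_derivative - (inverse ((\<zeta> - p)\<^sup>2))) (at 0)"
    by (auto intro!: derivative_eq_intros simp: power2_eq_square)
  then show ?thesis
    using * \<open>\<zeta> - p \<noteq> 0\<close> by (intro exI[of _ "- (inverse ((\<zeta> - p)\<^sup>2))"]) simp
qed (use assms in auto)

lemma pole_fun_lim:
  assumes "z \<noteq> P"
  shows "((\<lambda>w. pole_fun P (loc z w)) \<longlongrightarrow> pole_fun P z) (at 0)"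
proof -
  obtain k where "((\<lambda>w. pole_fun P (loc z w)) has_field_derivative k) (at 0)"
    using pole_fun_deriv[OF assms] by blast
  from DERIV_isCont[OF this] show ?thesis
    by (simp add: isCont_def)
qed

lemma simple_pole_split:
  assumes "g meromorphic_on {0}" "is_pole g 0" "zorder g 0 = - 1"
  shows "\<exists>c l. c \<noteq> 0 \<and> ((\<lambda>w. g w - c * inverse w) \<longlongrightarrow> l) (at 0)"
proof -
  obtain r where r: "r > 0" "g analytic_on ball 0 r - {0}"
    using meromorphic_on_isolated_singularity[OF assms(1)] unfolding isolated_singularity_at_def by auto
  define h where "h = zor_poly g 0"
  obtain e where e: "h 0 \<noteq> 0" "e > 0" "h holomorphic_on cball 0 e"
      "\<forall>w\<in>cball 0 e - {0}. g w = h w / w ^ nat 1"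
    using zorder_exist_pole[of g "ball 0 r" 0] r assms(2,3) analytic_imp_holomorphic[OF r(2)]
    by (auto simp: h_def)
  have "h field_differentiable (at 0)"
    using e by (meson ball_subset_cball centre_in_ball holomorphic_on_imp_differentiable_at
        holomorphic_on_subset open_ball)
  then obtain k where "(h has_field_derivative k) (at 0)"
    by (auto simp: field_differentiable_def)
  then have lim: "((\<lambda>w. (h w - h 0) / w) \<longlongrightarrow> k) (at 0)"
    by (simp add: DERIV_def)
  have ev: "eventually (\<lambda>w. w \<in> ball 0 e - {0}) (at (0::complex))"
    using e(2) by (intro eventually_at_in_open) auto
  have "eventually (\<lambda>w. (h w - h 0) / w = g w - h 0 * inverse w) (at 0)"
    using ev by eventually_elim (use e(4) in \<open>auto simp: field_simps\<close>)
  then have "((\<lambda>w. g w - h 0 * inverse w) \<longlongrightarrow> k) (at 0)"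
    by (rule Lim_transform_eventually[OF lim])
  then show ?thesis
    using e(1) by blast
qed

text \<open>Subtract the polar part of \<open>u\<close> at \<open>P\<close>; the difference has finite limits everywhere.\<close>

lemma coordinate_normal_form:
  assumes "is_coordinate u" "has_pole u P"
  shows "\<exists>c d. c \<noteq> 0 \<and> u = abs_mero (\<lambda>x. c * pole_fun P x + d)"
proof -
  define \<phi> where "\<phi> = rep_mero u"
  have u: "u = abs_mero \<phi>"
    unfolding \<phi>_def using Quotient3_abs_rep[OF Quotient3_mero] by metis
  have "mero_eq \<phi> \<phi>"
    unfolding \<phi>_def using Quotient3_rep_reflp[OF Quotient3_mero] by metis
  then have m: "mero_fun \<phi>"
    by (simp add: mero_eq_def is_mero_complex)
  obtain p where p: "{z. has_pole u z} = {p}" "zorder (\<lambda>w. \<phi> (loc p w)) 0 = - 1"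
    using assms(1) unfolding is_coordinate_def \<phi>_def by blast
  have "P \<in> {z. has_pole u z}"
    using assms(2) by simp
  then have "p = P"
    unfolding p(1) by simp
  with p have P: "{z. has_pole u z} = {P}" "zorder (\<lambda>w. \<phi> (loc P w)) 0 = - 1"
    by simp_all
  obtain c l where c: "c \<noteq> 0" "((\<lambda>w. \<phi> (loc P w) - c * inverse w) \<longlongrightarrow> l) (at 0)"
    using simple_pole_split[of "\<lambda>w. \<phi> (loc P w)"] P m assms(2)
    unfolding has_pole_def mero_fun_def \<phi>_def by blast
  define \<psi> where "\<psi> = (\<lambda>x. \<phi> x + (- c) * pole_fun P x)"
  have "mero_fun \<psi>"
    unfolding \<psi>_def by (intro mero_fun_add mero_fun_mult mero_fun_const mero_fun_pole_fun m)
  moreover have "\<exists>l. ((\<lambda>w. \<psi> (loc z w)) \<longlongrightarrow> l) (at 0)" for z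
  proof (cases "z = P")
    case True
    then show ?thesis
      using c(2) by (auto simp: \<psi>_def pole_fun_loc_self)
  next
    case False
    then have "\<not> is_pole (\<lambda>w. \<phi> (loc z w)) 0"
      using P(1) unfolding has_pole_def \<phi>_def by auto
    moreover have "not_essential (\<lambda>w. \<phi> (loc z w)) 0"
      using m meromorphic_at_iff unfolding mero_fun_def by blast
    ultimately obtain l where "((\<lambda>w. \<phi> (loc z w)) \<longlongrightarrow> l) (at 0)"
      unfolding not_essential_def by blast
    then have "((\<lambda>w. \<psi> (loc z w)) \<longlongrightarrow> l + (- c) * pole_fun P z) (at 0)"
      unfolding \<psi>_def by (intro tendsto_intros pole_fun_lim False)
    then show ?thesis by blast
  qed
  ultimately obtain d where "finite {x. \<psi> x \<noteq> d}"
    using liouville_sphere[of \<psi>] by blast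
  moreover have "{x. \<psi> x \<noteq> d} = {x. \<phi> x \<noteq> c * pole_fun P x + d}"
    by (auto simp: \<psi>_def algebra_simps)
  moreover have "mero_fun (\<lambda>x. c * pole_fun P x + d)"
    by (intro mero_fun_add mero_fun_mult mero_fun_const mero_fun_pole_fun)
  ultimately have "u = abs_mero (\<lambda>x. c * pole_fun P x + d)"
    using m by (simp add: u abs_mero_eq_iff is_mero_complex)
  then show ?thesis
    using c(1) by blast
qed

section \<open>Cauchy kernels\<close>

lemma mero_fun_diff_const: "mero_fun f \<Longrightarrow> mero_fun (\<lambda>x. f x - k)"
  using mero_fun_add[OF _ mero_fun_const[of "- k"], of f] by simp

lemma mconst_uminus: "mconst (- a) = - mconst a"
  by transfer (simp add: mero_eq_def is_mero_const)

text \<open>The properties of \<open>h = 1 / (u - u(z))\<close>, and of its multiples, that are used later. The last one says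
that the pole of \<open>h\<close> at \<open>z\<close> is at most simple.\<close>

locale cauchy_kernel =
  fixes P z :: sphere and h :: "complex mero"
  assumes z_P: "z \<noteq> P" and h_P: "has_value h P 0" and h_regular: "\<And>x. x \<noteq> z \<Longrightarrow> regular h x"
    and h_cancel: "\<And>f :: complex mero. regular f z \<Longrightarrow> regular (h \<odot> (f - mconst (mval f z))) z"

lemma cauchy_kernel_scaleC:
  assumes "cauchy_kernel P z h"
  shows "cauchy_kernel P z (k *\<^sub>C h)"
proof -
  interpret cauchy_kernel P z h by fact
  show ?thesis
  proof
    show "has_value (k *\<^sub>C h) P 0"
      using has_value_scaleC[OF h_P, of k] by simp
    show "regular (k *\<^sub>C h) x" if "x \<noteq> z" for x
      using h_regular[OF that] by (rule regular_closed)
    show "regular ((k *\<^sub>C h) \<odot> (f - mconst (mval f z))) z" if "regular f z" for f :: "complex mero"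
      unfolding msmult_scaleC_left using h_cancel[OF that] by (rule regular_closed)
  qed (rule z_P)
qed

locale coordinate_at =
  fixes P z :: sphere and c d :: complex and u :: "complex mero"
  assumes c: "c \<noteq> 0" and u_eq: "u = abs_mero (\<lambda>x. c * pole_fun P x + d)" and z_P: "z \<noteq> P"
begin

definition U :: "sphere \<Rightarrow> complex" where
  "U = (\<lambda>x. c * pole_fun P x + d)"

abbreviation kernel :: "complex mero" where
  "kernel \<equiv> minverse (u - mconst (mval u z))"

lemma u: "u = abs_mero U"
  by (simp add: u_eq U_def)

lemma mero_fun_U: "mero_fun U"
  unfolding U_def by (intro mero_fun_add mero_fun_mult mero_fun_const mero_fun_pole_fun)

lemma U_lim: "x \<noteq> P \<Longrightarrow> ((\<lambda>w. U (loc x w)) \<longlongrightarrow> U x) (at 0)"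
  unfolding U_def by (intro tendsto_intros pole_fun_lim)

lemma has_value_u: "x \<noteq> P \<Longrightarrow> has_value u x (U x)"
  unfolding u has_value_complex_iff_limit[OF mero_fun_U] by (rule U_lim)

lemma mval_u: "x \<noteq> P \<Longrightarrow> mval u x = U x"
  by (rule mval_eq_complex[OF has_value_u])

lemma U_inj: "x \<noteq> P \<Longrightarrow> y \<noteq> P \<Longrightarrow> U x = U y \<Longrightarrow> x = y"
  using c pole_fun_inj[of x P y] by (simp add: U_def)

lemma U_finite: "finite {x. U x = y}"
proof (cases "\<exists>x. x \<noteq> P \<and> U x = y")
  case True
  then obtain x where x: "x \<noteq> P" "U x = y" by blast
  have "x' = x" if "U x' = y" "x' \<noteq> P" for x'
    using that x by (intro U_inj) simp_all
  then have "{x. U x = y} \<subseteq> {P, x}"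
    by blast
  then show ?thesis
    by (rule finite_subset) simp
next
  case False
  then have "{x. U x = y} \<subseteq> {P}"
    by blast
  then show ?thesis
    by (rule finite_subset) simp
qed

lemma kernel_abs: "kernel = abs_mero (\<lambda>x. inverse (U x - U z))"
proof -
  have m: "is_mero U" "is_mero (\<lambda>_. U z)" "is_mero (\<lambda>x. U x - U z)"
    using mero_fun_U is_mero_minus[of U "\<lambda>_. U z"] by (simp_all add: is_mero_complex is_mero_const mero_fun_const)
  have "u - mconst (mval u z) = abs_mero (\<lambda>x. U x - U z)"
    unfolding u mval_u[OF z_P, unfolded u] mconst.abs_eq using m by (simp add: minus_mero.abs_eq mero_eq_refl)
  then show ?thesis
    using m by (simp add: minverse.abs_eq mero_eq_refl)
qed

lemma mero_fun_kernel: "mero_fun (\<lambda>x. inverse (U x - U z))"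
  by (intro mero_fun_inverse mero_fun_diff_const mero_fun_U)

lemma kernel_regular_off:
  assumes "x \<noteq> P" "x \<noteq> z"
  shows "has_value kernel x (inverse (U x - U z))"
  unfolding kernel_abs has_value_complex_iff_limit[OF mero_fun_kernel]
  using assms U_inj[of x z] z_P by (intro tendsto_intros U_lim) auto

lemma kernel_at_pole: "has_value kernel P 0"
  unfolding kernel_abs has_value_complex_iff_limit[OF mero_fun_kernel]
proof (rule Lim_transform_eventually)
  let ?e = "d - U z"
  have U_loc: "U (loc P w) = c * inverse w + d" for w
    by (simp add: U_def pole_fun_loc_self)
  have "((\<lambda>w. w / (c + ?e * w)) \<longlongrightarrow> 0 / (c + ?e * 0)) (at 0)"
    using c by (intro tendsto_intros) auto
  then show "((\<lambda>w. w / (c + ?e * w)) \<longlongrightarrow> 0) (at 0)"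
    by simp
  have "eventually (\<lambda>w. w \<noteq> 0) (at (0::complex))"
    by (simp add: eventually_at_filter)
  then show "eventually (\<lambda>w. w / (c + ?e * w) = inverse (U (loc P w) - U z)) (at 0)"
  proof eventually_elim
    case (elim w)
    have "U (loc P w) - U z = (c + ?e * w) / w"
      using elim U_loc by (simp add: divide_inverse distrib_right)
    then show ?case by simp
  qed
qed

text \<open>Both \<open>f - f(z)\<close> and \<open>u - u(z)\<close> are divided by the local parameter; the limit of the quotient is
then a quotient of derivatives, as \<open>u\<close> has nonzero derivative at \<open>z\<close>.\<close>

lemma kernel_cancel:
  fixes f :: "complex mero"
  assumes "regular f z"
  shows "regular (kernel \<odot> (f - mconst (mval f z))) z"
proof -
  obtain \<phi> where \<phi>: "expansion z \<phi>" "f = abs_mero \<phi>" "mval f z = \<phi> z"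
    using has_value_mval_complex[OF assms] unfolding has_value_iff_expansion by blast
  have m: "mero_fun \<phi>" and an: "(\<lambda>w. \<phi> (loc z w)) analytic_on {0}"
    using \<phi>(1) by (auto simp: expansion_complex)
  have m': "mero_fun (\<lambda>x. \<phi> x - \<phi> z)"
    using m by (rule mero_fun_diff_const)
  have "f - mconst (mval f z) = abs_mero (\<lambda>x. \<phi> x - \<phi> z)"
    unfolding \<phi>(3) unfolding \<phi>(2) mconst.abs_eq
    using m by (simp add: minus_mero.abs_eq mero_eq_refl is_mero_complex mero_fun_const)
  then have eq: "kernel \<odot> (f - mconst (mval f z)) =
      abs_mero (\<lambda>x. inverse (U x - U z) * (\<phi> x - \<phi> z))"
    unfolding kernel_abs using mero_fun_kernel m'
    by (simp add: msmult.abs_eq mero_eq_refl is_mero_complex scaleC_complex_def)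
  obtain k where k: "k \<noteq> 0" "((\<lambda>w. pole_fun P (loc z w)) has_field_derivative k) (at 0)"
    using pole_fun_deriv[OF z_P] by blast
  have "((\<lambda>w. U (loc z w)) has_field_derivative c * k) (at 0)"
    unfolding U_def using k(2) by (auto intro!: derivative_eq_intros)
  then have lim1: "((\<lambda>w. (U (loc z w) - U z) / w) \<longlongrightarrow> c * k) (at 0)"
    by (simp add: DERIV_def)
  obtain l where "((\<lambda>w. \<phi> (loc z w)) has_field_derivative l) (at 0)"
    using analytic_on_imp_differentiable_at[OF an] by (auto simp: field_differentiable_def)
  then have lim2: "((\<lambda>w. (\<phi> (loc z w) - \<phi> z) / w) \<longlongrightarrow> l) (at 0)"
    by (simp add: DERIV_def)
  have "((\<lambda>w. ((\<phi> (loc z w) - \<phi> z) / w) / ((U (loc z w) - U z) / w)) \<longlongrightarrow> l / (c * k)) (at 0)"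
    using c k(1) by (intro tendsto_divide lim1 lim2) simp
  moreover have "eventually (\<lambda>w. w \<noteq> 0) (at (0::complex))"
    by (simp add: eventually_at_filter)
  then have "eventually (\<lambda>w. ((\<phi> (loc z w) - \<phi> z) / w) / ((U (loc z w) - U z) / w) =
      inverse (U (loc z w) - U z) * (\<phi> (loc z w) - \<phi> z)) (at 0)"
    by eventually_elim (simp add: divide_inverse mult.commute)
  ultimately have "((\<lambda>w. inverse (U (loc z w) - U z) * (\<phi> (loc z w) - \<phi> z)) \<longlongrightarrow> l / (c * k)) (at 0)"
    by (rule Lim_transform_eventually)
  then have "has_value (abs_mero (\<lambda>x. inverse (U x - U z) * (\<phi> x - \<phi> z))) z (l / (c * k))"
    using has_value_complex_iff_limit[OF mero_fun_mult[OF mero_fun_kernel m']] by simp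
  then show ?thesis
    unfolding eq regular_def by blast
qed

lemma cauchy_kernel_coordinate: "cauchy_kernel P z kernel"
proof
  show "regular kernel x" if "x \<noteq> z" for x
  proof (cases "x = P")
    case True
    then show ?thesis
      using kernel_at_pole unfolding regular_def by blast
  next
    case False
    then show ?thesis
      using kernel_regular_off[OF False that] unfolding regular_def by blast
  qed
qed (rule z_P kernel_at_pole kernel_cancel, assumption?)+

end

locale coordinate_with_zero = coordinate_at +
  fixes P' :: sphere
  assumes P'_P: "P' \<noteq> P" and z_P': "z \<noteq> P'" and U_P': "U P' = 0"
begin

lemma U_z: "U z \<noteq> 0"
  using U_inj[OF z_P P'_P] z_P' U_P' by metis

lemma minverse_u_abs: "minverse u = abs_mero (\<lambda>x. inverse (U x))"
  unfolding u using mero_fun_U by (simp add: minverse.abs_eq mero_eq_refl is_mero_complex)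

lemma u_times_minverse: "u \<odot> minverse u = mconst 1"
proof -
  have m: "is_mero U" "is_mero (\<lambda>x. inverse (U x))" "is_mero (\<lambda>x. U x * inverse (U x))"
    using mero_fun_U by (simp_all add: is_mero_complex mero_fun_inverse mero_fun_mult)
  have "{x. U x * inverse (U x) \<noteq> 1} = {x. U x = 0}"
    by (auto simp: field_simps)
  then have "abs_mero (\<lambda>x. U x * inverse (U x)) = abs_mero (\<lambda>_. 1)"
    using m U_finite[of 0] by (simp add: abs_mero_eq_iff is_mero_const)
  moreover have "u \<odot> minverse u = abs_mero (\<lambda>x. U x * inverse (U x))"
    unfolding minverse_u_abs unfolding u using m by (simp add: msmult.abs_eq mero_eq_refl scaleC_complex_def)
  ultimately show ?thesis
    by (simp add: mconst.abs_eq)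
qed

lemma has_value_minverse_u: "has_value (minverse u) z (inverse (U z))"
  unfolding minverse_u_abs has_value_complex_iff_limit[OF mero_fun_inverse[OF mero_fun_U]]
  using U_z z_P by (intro tendsto_intros U_lim)

text \<open>The identity \<open>1 / (1/x - 1/y) = - y\<^sup>2 / (x - y) - y\<close> at the points where \<open>x = u\<close> is different from
\<open>0\<close> and from \<open>y = u(z)\<close>. All the properties of the second kernel follow from it.\<close>

lemma kernel_inverse_coordinate:
  "minverse (minverse u - mconst (mval (minverse u) z)) =
     (- ((U z)\<^sup>2)) *\<^sub>C kernel - mconst (U z)"
proof -
  have mv: "mval (minverse u) z = inverse (U z)"
    using has_value_minverse_u by (rule mval_eq_complex)
  have m: "mero_fun (\<lambda>x. inverse (U x))" "mero_fun (\<lambda>x. inverse (U x) - inverse (U z))"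
    "mero_fun (\<lambda>x. inverse (inverse (U x) - inverse (U z)))"
    "mero_fun (\<lambda>x. - ((U z)\<^sup>2) * inverse (U x - U z))"
    "mero_fun (\<lambda>x. - ((U z)\<^sup>2) * inverse (U x - U z) - U z)"
    by (intro mero_fun_inverse mero_fun_diff_const mero_fun_mult mero_fun_const mero_fun_U)+
  have "minverse (minverse u - mconst (mval (minverse u) z)) =
      abs_mero (\<lambda>x. inverse (inverse (U x) - inverse (U z)))"
    unfolding mv unfolding minverse_u_abs mconst.abs_eq
    using m by (simp add: minus_mero.abs_eq minverse.abs_eq mero_eq_refl is_mero_complex mero_fun_const)
  moreover have "(- ((U z)\<^sup>2)) *\<^sub>C kernel - mconst (U z) =
      abs_mero (\<lambda>x. - ((U z)\<^sup>2) * inverse (U x - U z) - U z)"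
    unfolding kernel_abs unfolding mconst.abs_eq using m mero_fun_kernel
    by (simp add: minus_mero.abs_eq scaleC_mero.abs_eq mero_eq_refl is_mero_complex mero_fun_const
        scaleC_complex_def)
  moreover have "finite {x. inverse (inverse (U x) - inverse (U z)) \<noteq> - ((U z)\<^sup>2) * inverse (U x - U z) - U z}"
  proof (rule finite_subset)
    show "{x. inverse (inverse (U x) - inverse (U z)) \<noteq> - ((U z)\<^sup>2) * inverse (U x - U z) - U z}
        \<subseteq> {x. U x = 0} \<union> {x. U x = U z}"
    proof (rule ccontr)
      assume "\<not> ?thesis"
      then obtain x where x: "U x \<noteq> 0" "U x \<noteq> U z"
          "inverse (inverse (U x) - inverse (U z)) \<noteq> - ((U z)\<^sup>2) * inverse (U x - U z) - U z"
        by blast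
      have "U z - U x \<noteq> 0" "U x - U z \<noteq> 0"
        using x by auto
      have "inverse (inverse (U x) - inverse (U z)) = U x * U z * inverse (U z - U x)"
        using x U_z by (simp add: field_simps)
      also have "\<dots> = - ((U z)\<^sup>2) * inverse (U x - U z) - U z"
        using \<open>U z - U x \<noteq> 0\<close> \<open>U x - U z \<noteq> 0\<close>
        by (simp add: divide_simps power2_eq_square) (simp add: algebra_simps)
      finally show False
        using x(3) by contradiction
    qed
    show "finite ({x. U x = 0} \<union> {x. U x = U z})"
      by (simp add: U_finite)
  qed
  ultimately show ?thesis
    using m by (simp add: abs_mero_eq_iff is_mero_complex)
qed

text \<open>At \<open>P'\<close> the two terms cancel, because \<open>u\<close> vanishes there.\<close>

lemma cauchy_kernel_inverse_coordinate:
  "cauchy_kernel P' z (minverse (minverse u - mconst (mval (minverse u) z)))"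
proof -
  interpret cauchy_kernel P z kernel
    by (rule cauchy_kernel_coordinate)
  show ?thesis
    unfolding kernel_inverse_coordinate
  proof
    have "has_value ((- ((U z)\<^sup>2)) *\<^sub>C kernel - mconst (U z)) P' ((- ((U z)\<^sup>2)) *\<^sub>C inverse (U P' - U z) - U z)"
      using P'_P z_P' by (intro has_value_diff has_value_scaleC has_value_mconst kernel_regular_off) auto
    moreover have "(- ((U z)\<^sup>2)) *\<^sub>C inverse (U P' - U z) - U z = 0"
      using U_P' U_z by (simp add: scaleC_complex_def power2_eq_square)
    ultimately show "has_value ((- ((U z)\<^sup>2)) *\<^sub>C kernel - mconst (U z)) P' 0"
      by (simp only:)
    show "regular ((- ((U z)\<^sup>2)) *\<^sub>C kernel - mconst (U z)) x" if "x \<noteq> z" for x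
      by (intro regular_closed h_regular that)
    fix f :: "complex mero"
    assume f: "regular f z"
    have "(- ((U z)\<^sup>2)) *\<^sub>C kernel - mconst (U z) = (- ((U z)\<^sup>2)) *\<^sub>C kernel + mconst (- U z)"
      by (simp add: mconst_uminus)
    then have "((- ((U z)\<^sup>2)) *\<^sub>C kernel - mconst (U z)) \<odot> (f - mconst (mval f z)) =
        (- ((U z)\<^sup>2)) *\<^sub>C (kernel \<odot> (f - mconst (mval f z))) + (- U z) *\<^sub>C (f - mconst (mval f z))"
      by (simp only: msmult_add_left msmult_scaleC_left msmult_const)
    also have "regular \<dots> z"
      by (intro regular_closed h_cancel f)
    finally show "regular (((- ((U z)\<^sup>2)) *\<^sub>C kernel - mconst (U z)) \<odot> (f - mconst (mval f z))) z" .
  qed (rule z_P')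
qed

end

lemma tangent_rules:
  assumes "\<delta> \<in> tangent z"
  shows "regular f z \<Longrightarrow> regular g z \<Longrightarrow> \<delta> (f + g) = \<delta> f + \<delta> g"
    and "regular f z \<Longrightarrow> regular g z \<Longrightarrow> \<delta> (f \<odot> g) = mval f z * \<delta> g + mval g z * \<delta> f"
    and "regular f z \<Longrightarrow> \<delta> (k *\<^sub>C f) = k * \<delta> f"
  using assms by (simp_all add: tangent_def)

lemma tangent_const:
  assumes "\<delta> \<in> tangent z"
  shows "\<delta> (mconst k) = 0"
proof -
  have r: "regular (mconst k) z" for k :: complex
    by (rule regular_closed)
  have "\<delta> (mconst 1 \<odot> mconst 1) = mval (mconst 1) z * \<delta> (mconst 1) + mval (mconst 1) z * \<delta> (mconst 1)"
    by (rule tangent_rules(2)[OF assms r r])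
  then have "\<delta> (mconst 1) = 0"
    by (simp add: msmult_const scaleC_one mval_eq_complex[OF has_value_mconst])
  moreover have "\<delta> (k *\<^sub>C mconst 1) = k * \<delta> (mconst 1)"
    by (rule tangent_rules(3)[OF assms r])
  moreover have "k *\<^sub>C mconst 1 = mconst k"
    by transfer (simp add: mero_eq_def is_mero_const is_mero_scaleC scaleC_complex_def)
  ultimately show ?thesis by simp
qed

section \<open>Lie algebras of maps with prescribed regularity\<close>

lemma lie_diff_right: "lie x (y - z) = lie x y - lie x (z :: 'l :: complex_lie_algebra)"
  using lie_add_right[of x "y - z" z] by simp

lemma scaleC_diff_right: "k *\<^sub>C (x - y) = k *\<^sub>C x - k *\<^sub>C (y :: 'a :: complex_vector)"
  using scaleC_add_right[of k "x - y" y] by simp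

lemma has_value_0: "has_value (0 :: 'a :: complex_vector mero) z 0"
  using has_value_mconst[of "0 :: 'a" z] by (simp add: mconst_0)

lemma lie_subalgebra_reg_maps: "const_subalgebra (reg_maps S :: 'g :: complex_lie_algebra mero set)"
  unfolding const_subalgebra_def lie_subalgebra_def reg_maps_def
  using has_value_0 by (auto intro: regular_closed regular_lie simp: regular_def[of "0 :: 'g mero"])

lemma evaluation_reg_maps:
  assumes "P \<in> S"
  shows "evaluation (reg_maps S :: 'g :: metrized_lie_algebra mero set) (\<lambda>\<alpha>. mval \<alpha> P)"
  using assms lie_subalgebra_reg_maps
  by unfold_locales (auto simp: reg_maps_def mval_simps)

lemma van_maps_kernel:
  "van_maps P S = evaluation.K (reg_maps (insert P S) :: 'g :: metrized_lie_algebra mero set) (\<lambda>\<alpha>. mval \<alpha> P)"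
  unfolding van_maps_def evaluation.K_def[OF evaluation_reg_maps[OF insertI1]] ..

lemma lie_subalgebra_van_maps: "lie_subalgebra (van_maps P S :: 'g :: metrized_lie_algebra mero set)"
  unfolding van_maps_kernel by (rule evaluation.K_lie[OF evaluation_reg_maps]) simp

lemma reg_maps_mono: "S \<subseteq> T \<Longrightarrow> reg_maps T \<subseteq> reg_maps S"
  by (auto simp: reg_maps_def)

lemma van_maps_subset: "van_maps P S \<subseteq> reg_maps (insert P S)"
  by (auto simp: van_maps_def)

text \<open>Moves a representative into the free algebra on the maps that vanish at \<open>P\<close>, within its class in
the quotient.\<close>

definition drop_const :: "sphere \<Rightarrow> 'g :: metrized_lie_algebra mero ncpoly \<Rightarrow> 'g mero ncpoly" where
  "drop_const P = red (\<lambda>\<alpha>. mval \<alpha> P)"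

lemma drop_const:
  fixes p :: "'g :: metrized_lie_algebra mero ncpoly"
  assumes "p \<in> free (reg_maps (insert P S))"
  shows "drop_const P p \<in> free (van_maps P S)"
    and "p - drop_const P p \<in> vac_ideal (reg_maps (insert P S))"
    and "vcl (reg_maps (insert P S)) p = vcl (reg_maps (insert P S)) (drop_const P p)"
  using assms evaluation.red_free[OF evaluation_reg_maps, of P "insert P S" p]
    evaluation.red_vac[OF evaluation_reg_maps, of P "insert P S" p]
    evaluation.vcl_red[OF evaluation_reg_maps, of P "insert P S" p]
  by (simp_all add: drop_const_def van_maps_kernel)

lemma ident_class:
  fixes q :: "'g :: metrized_lie_algebra mero ncpoly"
  assumes "q \<in> free (van_maps P S)"
  shows "ident P S (env_class (van_maps P S) q) = vcl (reg_maps (insert P S)) q"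
  unfolding ident_def vcl_def
  using env_map_class[OF lie_subalgebra_van_maps const_subalgebra_D(1)[OF lie_subalgebra_reg_maps]
      van_maps_subset assms]
  by simp

lemma unident_vcl:
  fixes q :: "'g :: metrized_lie_algebra mero ncpoly"
  assumes "q \<in> free (van_maps P S)"
  shows "unident P S (vcl (reg_maps (insert P S)) q) = env_class (van_maps P S) q"
  using evaluation.K_class_of_vcl[OF evaluation_reg_maps[OF insertI1], of q P S] assms
  unfolding unident_def ident_def[abs_def] van_maps_kernel by blast

section \<open>Operators attached to a Cauchy kernel\<close>

text \<open>Here \<open>h\<close> plays the role of \<open>\<delta> u / (u - u(z))\<close>, and \<open>e a\<close> that of the map by which \<open>\<epsilon>\<^sup>a(z)\<close>
multiplies. The argument \<open>type_g\<close> serves to fix the Lie algebra.\<close>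

locale point_operators = cauchy_kernel P z h for P z :: sphere and h :: "complex mero" +
  fixes \<delta> :: "complex mero \<Rightarrow> complex" and type_g :: "'g :: metrized_lie_algebra itself"
  assumes \<delta>: "\<delta> \<in> tangent z"
begin

definition e :: "'g \<Rightarrow> 'g mero" where
  "e a = h \<odot> mconst a"

definition D :: "'g \<Rightarrow> 'g mero \<Rightarrow> 'g mero" where
  "D a \<alpha> = - lie (e a) \<alpha> + e (lie a (mval \<alpha> z))"

definition c :: "'g \<Rightarrow> 'g mero \<Rightarrow> complex" where
  "c a \<alpha> = \<delta> (mform a \<alpha>)"

definition \<tau> :: "'g \<Rightarrow> 'g mero \<Rightarrow> 'g" where
  "\<tau> a \<alpha> = lie a (mval \<alpha> z)"

text \<open>The operator \<open>\<iota>\<^sup>a(z)\<close> on representatives, for maps with arbitrary value at \<open>P\<close>.\<close>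

definition J :: "'g \<Rightarrow> 'g mero ncpoly \<Rightarrow> 'g mero ncpoly" where
  "J = comm_op D c \<tau>"

lemma e_add: "e (a + b) = e a + e b"
  by (simp add: e_def mconst_add msmult_add_right)

lemma e_scaleC: "e (k *\<^sub>C a) = k *\<^sub>C e a"
  by (simp add: e_def mconst_scaleC msmult_scaleC_right)

lemma e_diff: "e (a - b) = e a - e b"
  using e_add[of "a - b" b] by simp

lemma has_value_e_P: "has_value (e a) P 0"
  using has_value_msmult[OF h_P has_value_mconst[of a P]] scaleC_add_left[of 0 0 a]
  by (simp add: e_def)

lemma e_regular: "x \<noteq> z \<Longrightarrow> regular (e a) x"
  unfolding e_def by (intro regular_closed h_regular)

lemma e_in_reg_maps: "z \<notin> S \<Longrightarrow> e a \<in> reg_maps S"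
  unfolding reg_maps_def by (auto intro!: e_regular)

lemma e_in_van_maps: "z \<notin> S \<Longrightarrow> e a \<in> van_maps P S"
  unfolding van_maps_def using e_in_reg_maps[of "insert P S"] z_P mval_eq[OF has_value_e_P] by simp

lemma kernel_cancel_map:
  fixes \<alpha> :: "'g mero"
  assumes "regular \<alpha> z"
  shows "regular (h \<odot> (\<alpha> - mconst (mval \<alpha> z))) z"
  using assms
proof (induction rule: regular_induct)
  case zero
  have "mval (0 :: 'g mero) z = 0"
    by (rule mval_eq[OF has_value_0])
  moreover have "h \<odot> (0 :: 'g mero) = 0"
    using msmult_add_right[of h 0 "0 :: 'g mero"] by simp
  ultimately show ?case
    using has_value_0 by (auto simp: mconst_0 regular_def)
next
  case (add_term \<alpha> f b)
  have "mval (\<alpha> + f \<odot> mconst b) z = mval \<alpha> z + mval f z *\<^sub>C b"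
    using add_term by (simp add: mval_simps regular_closed)
  moreover have "mconst (mval f z *\<^sub>C b) = mconst (mval f z) \<odot> mconst b"
    by (simp add: msmult_const mconst_scaleC)
  ultimately have "(\<alpha> + f \<odot> mconst b) - mconst (mval (\<alpha> + f \<odot> mconst b) z) =
      (\<alpha> - mconst (mval \<alpha> z)) + (f - mconst (mval f z)) \<odot> mconst b"
    using msmult_add_left[of "f - mconst (mval f z)" "mconst (mval f z)" "mconst b"]
    by (simp add: mconst_add)
  then have "h \<odot> ((\<alpha> + f \<odot> mconst b) - mconst (mval (\<alpha> + f \<odot> mconst b) z)) =
      h \<odot> (\<alpha> - mconst (mval \<alpha> z)) + (h \<odot> (f - mconst (mval f z))) \<odot> mconst b"
    by (simp only: msmult_add_right msmult_assoc)
  then show ?case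
    using regular_closed(1)[OF add_term.IH regular_closed(5)[OF h_cancel[OF add_term(2)] regular_closed(6)]]
    by simp
qed

text \<open>At \<open>z\<close> one has \<open>D a \<alpha> = - [a, h (\<alpha> - \<alpha>(z))]\<close>, and the pole of \<open>h\<close> cancels.\<close>

lemma D_regular:
  assumes "regular \<alpha> x" "regular \<alpha> z"
  shows "regular (D a \<alpha>) x"
proof (cases "x = z")
  case True
  have "lie (e a) \<alpha> - e (lie a (mval \<alpha> z)) = lie (mconst a) (h \<odot> (\<alpha> - mconst (mval \<alpha> z)))"
  proof -
    have "lie (mconst a) \<alpha> = lie (mconst a) (\<alpha> - mconst (mval \<alpha> z)) + mconst (lie a (mval \<alpha> z))"
      using lie_add_right[of "mconst a" "\<alpha> - mconst (mval \<alpha> z)" "mconst (mval \<alpha> z)"]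
      by (simp add: mconst_lie)
    then show ?thesis
      by (simp add: e_def lie_msmult_left lie_msmult_right msmult_add_right)
  qed
  then have "D a \<alpha> = - lie (mconst a) (h \<odot> (\<alpha> - mconst (mval \<alpha> z)))"
    by (simp add: D_def algebra_simps)
  then show ?thesis
    using True kernel_cancel_map[OF assms(2)] by (simp add: regular_closed regular_lie)
next
  case False
  then show ?thesis
    unfolding D_def using assms(1) by (intro regular_closed regular_lie e_regular)
qed

lemma D_in_reg_maps: "z \<in> S \<Longrightarrow> \<alpha> \<in> reg_maps S \<Longrightarrow> D a \<alpha> \<in> reg_maps S"
  unfolding reg_maps_def using D_regular by blast

lemma D_in_van_maps:
  assumes "\<alpha> \<in> van_maps P {z}"
  shows "D a \<alpha> \<in> van_maps P {z}"
proof -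
  have r: "\<alpha> \<in> reg_maps {P, z}"
    using assms by (simp add: van_maps_def)
  then have "has_value (D a \<alpha>) P (- lie 0 (mval \<alpha> P) + 0)"
    unfolding D_def
    by (intro has_value_add has_value_uminus has_value_lie has_value_e_P has_value_mval)
      (simp add: reg_maps_def)
  then show ?thesis
    using D_in_reg_maps[OF _ r] mval_eq by (force simp: van_maps_def)
qed

text \<open>The terms with \<open>e\<close> of a bracket cancel in pairs, up to the Jacobi identity for values at \<open>z\<close>; the
others are the Jacobi identity for \<open>e a\<close>, \<open>x\<close> and \<open>y\<close>.\<close>

lemma D_lie:
  assumes "regular x z" "regular y z"
  shows "D a (lie x y) = (lie x (D a y) - lie y (D a x)) + (D (\<tau> a x) y - D (\<tau> a y) x)"
proof -
  have jac: "lie (e a) (lie x y) = lie x (lie (e a) y) - lie y (lie (e a) x)"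
    using lie_derivation[of "e a" x y] lie_anti[of "lie (e a) x" y] by simp
  have jac_z: "lie a (lie (mval x z) (mval y z)) =
      lie (lie a (mval x z)) (mval y z) - lie (lie a (mval y z)) (mval x z)"
    using lie_derivation[of a "mval x z" "mval y z"] lie_anti[of "mval x z" "lie a (mval y z)"]
    by (simp add: algebra_simps)
  have anti: "lie (e b) v = - lie v (e b)" for b v
    by (rule lie_anti)
  show ?thesis
    unfolding D_def \<tau>_def using assms
    by (simp add: mval_simps jac jac_z e_diff lie_add_right lie_diff_right
        anti[of "lie a (mval x z)"] anti[of "lie a (mval y z)"] algebra_simps)
qed

text \<open>The Leibniz rule for \<open>\<delta>\<close>, combined with the invariance of the form. By additivity in \<open>x\<close> it is
enough to treat \<open>x = f b\<close> with a scalar function \<open>f\<close>.\<close>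

lemma c_lie:
  assumes "regular x z" "regular y z"
  shows "c a (lie x y) = c (\<tau> a x) y - c (\<tau> a y) x"
  using assms(1)
proof (induction rule: regular_induct)
  case zero
  have "mform b (0 :: 'g mero) = mconst 0" for b
    using mform_add_right[of b 0 "0 :: 'g mero"] by (simp add: mconst_0)
  moreover have "mform (0 :: 'g) y = mconst 0"
    using mform_add_left[of 0 "0 :: 'g" y] by (simp add: mconst_0)
  ultimately show ?case
    by (simp add: c_def \<tau>_def mval_eq[OF has_value_0] tangent_const[OF \<delta>])
next
  case (add_term x f b)
  note \<delta>_rules = tangent_rules[OF \<delta>]
  have reg: "regular (mform d y) z" "regular (mform d x) z" "regular (mform d (f \<odot> mconst b)) z"
    "regular (mform d (lie x y)) z" "regular (mform d (lie (f \<odot> mconst b) y)) z" for d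
    using add_term assms(2) by (auto intro!: regular_mform regular_lie regular_closed)
  have y0: "mval (mform d y) z = form d (mval y z)" for d
    using mval_eq_complex[OF has_value_mform[OF has_value_mval[OF assms(2)]]] .
  have "c a (lie (x + f \<odot> mconst b) y) = c a (lie x y) + \<delta> (mform a (lie (f \<odot> mconst b) y))"
    using reg by (simp add: c_def lie_add_left mform_add_right \<delta>_rules)
  also have "mform a (lie (f \<odot> mconst b) y) = f \<odot> mform (lie a b) y"
    by (simp add: lie_msmult_left mform_msmult mform_lie)
  also have "\<delta> (f \<odot> mform (lie a b) y) = mval f z * \<delta> (mform (lie a b) y) + form (lie a b) (mval y z) * \<delta> f"
    using reg add_term by (simp add: \<delta>_rules y0)
  finally have lhs: "c a (lie (x + f \<odot> mconst b) y) =
      c a (lie x y) + (mval f z * \<delta> (mform (lie a b) y) + form (lie a b) (mval y z) * \<delta> f)" .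
  have "mval (x + f \<odot> mconst b) z = mval x z + mval f z *\<^sub>C b"
    using add_term by (simp add: mval_simps regular_closed)
  then have "c (\<tau> a (x + f \<odot> mconst b)) y = c (\<tau> a x) y + mval f z * \<delta> (mform (lie a b) y)"
    using reg by (simp add: c_def \<tau>_def lie_add_right lie_scaleC_right mform_add_left mform_scaleC_left
        \<delta>_rules regular_closed)
  moreover have "c (\<tau> a y) (x + f \<odot> mconst b) =
      c (\<tau> a y) x + form (lie a (mval y z)) b * \<delta> f"
  proof -
    have "\<delta> (mform (lie a (mval y z)) (f \<odot> mconst b)) = form (lie a (mval y z)) b * \<delta> f"
      using add_term \<delta>_rules(2)[of f "mconst (form (lie a (mval y z)) b)"]
      by (simp add: mform_msmult mform_const tangent_const[OF \<delta>] regular_closed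
          mval_eq_complex[OF has_value_mconst])
    then show ?thesis
      using reg by (simp add: c_def \<tau>_def mform_add_right \<delta>_rules)
  qed
  moreover have "form (lie a (mval y z)) b = - form (lie a b) (mval y z)"
  proof -
    have "form a (- v) = - form a v" for v
      using form_scaleC_right[of a "- 1" v] by (simp add: scaleC_minus_one)
    then show ?thesis
      using lie_anti[of "mval y z" b] by (simp add: form_invariant)
  qed
  ultimately show ?case
    using add_term.IH lhs by simp
qed

lemma comm_data_operators:
  fixes L :: "'g mero set"
  assumes L: "lie_subalgebra L" and reg: "\<And>x. x \<in> L \<Longrightarrow> regular x z"
    and D_in: "\<And>a x. x \<in> L \<Longrightarrow> D a x \<in> L"
  shows "comm_data L D c \<tau>"
proof
  note \<delta>_rules = tangent_rules[OF \<delta>]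
  fix a b :: 'g and x y :: "'g mero" and k :: complex
  assume x: "x \<in> L"
  note rx = reg[OF x]
  have lin_left: "lie (k *\<^sub>C e a) x = k *\<^sub>C lie (e a) x"
    by (rule lie_scaleC_left)
  have neg: "k *\<^sub>C (- v) = - (k *\<^sub>C v)" for v :: "'g mero"
    using scaleC_scaleC[of k "- 1" v] scaleC_scaleC[of "- 1" k v] by (simp add: scaleC_minus_one)
  show "D a x \<in> L"
    using x by (rule D_in)
  show "D (a + b) x = D a x + D b x"
    by (simp add: D_def e_add lie_add_left)
  show "D (k *\<^sub>C a) x = k *\<^sub>C D a x"
    by (simp add: D_def e_scaleC lie_scaleC_left scaleC_add_right scaleC_diff_right neg)
  show "c (a + b) x = c a x + c b x"
    using rx by (simp add: c_def mform_add_left \<delta>_rules regular_mform)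
  show "c (k *\<^sub>C a) x = k * c a x"
    using rx by (simp add: c_def mform_scaleC_left \<delta>_rules regular_mform)
  show "\<tau> (a + b) x = \<tau> a x + \<tau> b x" "\<tau> (k *\<^sub>C a) x = k *\<^sub>C \<tau> a x"
    by (simp_all add: \<tau>_def lie_add_left lie_scaleC_left)
  show "D a (k *\<^sub>C x) = k *\<^sub>C D a x"
    using rx by (simp add: D_def e_scaleC mval_simps lie_scaleC_right scaleC_add_right scaleC_diff_right neg)
  have "mform a (k *\<^sub>C x) = k *\<^sub>C mform a x"
    using mform_msmult[of a "mconst k" x] by (simp add: msmult_const)
  then show "c a (k *\<^sub>C x) = k * c a x"
    using rx by (simp add: c_def \<delta>_rules regular_mform)
  show "\<tau> a (k *\<^sub>C x) = k *\<^sub>C \<tau> a x"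
    using rx by (simp add: \<tau>_def mval_simps lie_scaleC_right)
  assume y: "y \<in> L"
  note ry = reg[OF y]
  show "D a (x + y) = D a x + D a y"
    using rx ry by (simp add: D_def e_add mval_simps lie_add_right)
  show "c a (x + y) = c a x + c a y"
    using rx ry by (simp add: c_def mform_add_right \<delta>_rules regular_mform)
  show "\<tau> a (x + y) = \<tau> a x + \<tau> a y"
    using rx ry by (simp add: \<tau>_def mval_simps lie_add_right)
  show "D a (lie x y) = (lie x (D a y) - lie y (D a x)) + (D (\<tau> a x) y - D (\<tau> a y) x)"
    using rx ry by (rule D_lie)
  show "c a (lie x y) = c (\<tau> a x) y - c (\<tau> a y) x"
    using rx ry by (rule c_lie)
  show "\<tau> a (lie x y) = \<tau> (\<tau> a x) y - \<tau> (\<tau> a y) x"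
    using rx ry lie_derivation[of a "mval x z" "mval y z"] lie_anti[of "mval x z" "lie a (mval y z)"]
    by (simp add: \<tau>_def mval_simps)
qed (rule L)

lemma comm_data_van_maps: "comm_data (van_maps P {z}) D c \<tau>"
  by (rule comm_data_operators[OF lie_subalgebra_van_maps])
    (simp_all add: D_in_van_maps, simp add: van_maps_def reg_maps_def)

lemma comm_data_reg_maps:
  assumes "z \<in> S"
  shows "comm_data (reg_maps S) D c \<tau>"
  using assms const_subalgebra_D(1)[OF lie_subalgebra_reg_maps]
  by (intro comm_data_operators D_in_reg_maps) (auto simp: reg_maps_def)

text \<open>Constants commute with the kernel, which is a scalar function.\<close>

lemma D_const: "D a (mconst b) = 0"
  by (simp add: D_def e_def lie_msmult_left mval_simps mconst_lie)

lemma c_const: "c a (mconst b) = 0"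
  by (simp add: c_def mform_const tangent_const[OF \<delta>])

lemma J_vac_ideal: "z \<in> S \<Longrightarrow> p \<in> vac_ideal (reg_maps S) \<Longrightarrow> J a p \<in> vac_ideal (reg_maps S)"
  unfolding J_def by (rule comm_op_vac_ideal[OF comm_data_reg_maps D_const c_const])

lemma J_free: "z \<in> S \<Longrightarrow> p \<in> free (reg_maps S) \<Longrightarrow> J a p \<in> free (reg_maps S)"
  unfolding J_def by (rule comm_data.J_free[OF comm_data_reg_maps])

lemma J_free_van: "p \<in> free (van_maps P {z}) \<Longrightarrow> J a p \<in> free (van_maps P {z})"
  unfolding J_def by (rule comm_data.J_free[OF comm_data_van_maps])

lemma J_linear:
  "J a (p + q) = J a p + J a q" "J a (p - q) = J a p - J a q" "J a (scal k * p) = scal k * J a p"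
  "J a 0 = 0" "J a 1 = 0"
  by (simp_all add: J_def)

lemma J_gen_mult: "J a (gen x * p) = gen x * J a p + (gen (D a x) - scal (c a x)) * p + J (\<tau> a x) p"
  unfolding J_def by (rule comm_op_gen_mult)

end

text \<open>The kernel may vanish identically, namely for \<open>\<delta> u = 0\<close>, whereas the relations of \<open>\<iota>\<close> contain
\<open>1 / (u - u(z))\<close> and \<open>\<delta> u\<close> as separate factors. So \<open>1 / (u - u(z))\<close> is required to be a kernel as
well.\<close>

locale coordinate_operators = point_operators P z h \<delta> type_g
  for P z :: sphere and h :: "complex mero" and \<delta> :: "complex mero \<Rightarrow> complex"
    and type_g :: "'g :: metrized_lie_algebra itself" +
  fixes u :: "complex mero"
  assumes kernel_u: "cauchy_kernel P z (minverse (u - mconst (mval u z)))"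
    and h_u: "h = \<delta> u *\<^sub>C minverse (u - mconst (mval u z))"
begin

abbreviation K :: "'g mero set" where
  "K \<equiv> van_maps P {z}"

lemma e_eps_map: "e a = \<delta> u *\<^sub>C eps_map u z a"
proof -
  have "h \<odot> mconst a = \<delta> u *\<^sub>C eps_map u z a"
    by (subst h_u) (simp only: eps_map_def msmult_scaleC_left)
  then show ?thesis
    by (simp only: e_def)
qed

definition D_unscaled :: "'g \<Rightarrow> 'g mero \<Rightarrow> 'g mero" where
  "D_unscaled a x = - lie (eps_map u z a) x + eps_map u z (lie a (mval x z))"

lemma D_eq: "D a x = \<delta> u *\<^sub>C D_unscaled a x"
  by (simp add: D_def D_unscaled_def e_eps_map lie_scaleC_left scaleC_diff_right)

lemma unscaled: "point_operators P z (minverse (u - mconst (mval u z))) \<delta>"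
  using kernel_u \<delta> by (simp add: point_operators_def point_operators_axioms_def)

lemma D_unscaled_in: "x \<in> K \<Longrightarrow> D_unscaled a x \<in> K"
  using point_operators.D_in_van_maps[OF unscaled, of x a]
  unfolding D_unscaled_def eps_map_def point_operators.D_def[OF unscaled] point_operators.e_def[OF unscaled] .

lemma eps_map_in: "z \<notin> S \<Longrightarrow> (eps_map u z a :: 'g mero) \<in> van_maps P S"
  using point_operators.e_in_van_maps[OF unscaled, of S a]
  unfolding eps_map_def point_operators.e_def[OF unscaled] .

lemma K_sub: "lie_subalgebra K"
  by (rule lie_subalgebra_van_maps)

lemmas env_K = env_class_mult[OF K_sub] env_class_add[OF K_sub] env_class_diff[OF K_sub]

text \<open>Modulo relations, the factor \<open>\<delta> u\<close> can be absorbed into the map \<open>D a x\<close>; thus the defining relation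
of \<open>\<iota>\<close> becomes the recursion of \<open>J\<close>.\<close>

lemma relation_rhs:
  assumes x: "x \<in> K" and p: "p \<in> free K" and q: "q \<in> free K"
  shows "env_scal K (\<delta> u) \<otimes>\<^bsub>env K\<^esub> (env_gen K (D_unscaled a x) \<otimes>\<^bsub>env K\<^esub> env_class K p)
      \<ominus>\<^bsub>env K\<^esub> env_scal K (\<delta> (mform a x)) \<otimes>\<^bsub>env K\<^esub> env_class K p \<oplus>\<^bsub>env K\<^esub> env_class K q =
    env_class K ((gen (D a x) - scal (c a x)) * p + q)"
proof -
  let ?y = "D_unscaled a x"
  note y = D_unscaled_in[OF x, of a]
  note free = free_gen[OF y] free_gen[OF D_in_van_maps[OF x, of a]] p q
  have "(gen (D a x) - scal (\<delta> u) * gen ?y) * p \<in> rel_ideal K"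
    unfolding D_eq using y p by (intro rel_ideal_right rel_ideal_gen_scal)
  then have "- ((gen (D a x) - scal (\<delta> u) * gen ?y) * p) \<in> rel_ideal K"
    by (rule rel_ideal_minus)
  moreover have "- ((gen (D a x) - scal (\<delta> u) * gen ?y) * p) =
      scal (\<delta> u) * (gen ?y * p) - scal (\<delta> (mform a x)) * p + q - ((gen (D a x) - scal (c a x)) * p + q)"
    by (simp add: c_def left_diff_distrib mult.assoc)
  ultimately have "env_class K (scal (\<delta> u) * (gen ?y * p) - scal (\<delta> (mform a x)) * p + q) =
      env_class K ((gen (D a x) - scal (c a x)) * p + q)"
    using free by (simp add: env_class_eq_iff[OF K_sub] free_mult free_diff free_add)
  then show ?thesis
    using free by (simp add: env_scal_def env_gen_def env_K free_mult free_diff)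
qed

text \<open>The defining relations of \<open>\<iota>\<close> express its value on a word by its values on shorter words.\<close>

lemma iota_on_class_unique:
  assumes I: "is_iota P u z \<delta> I" and p: "p \<in> free K"
  shows "I a (env_class K p) = env_class K (J a p)"
proof -
  interpret ring "env K" by (rule ring_env[OF K_sub])
  have I_in: "I a X \<in> carrier (env K)" if "X \<in> carrier (env K)" for a X
  proof -
    have "I a \<in> carrier (env K) \<rightarrow>\<^sub>E carrier (env K)"
      using I unfolding is_iota_def Let_def by (elim conjE) (erule spec)
    then show ?thesis
      using that by (rule PiE_mem)
  qed
  have I_add: "I a (X \<oplus>\<^bsub>env K\<^esub> Y) = I a X \<oplus>\<^bsub>env K\<^esub> I a Y"
    if "X \<in> carrier (env K)" "Y \<in> carrier (env K)" for a X Y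
    using I that unfolding is_iota_def Let_def by blast
  have I_scal: "I a (env_scal K k \<otimes>\<^bsub>env K\<^esub> X) = env_scal K k \<otimes>\<^bsub>env K\<^esub> I a X"
    if "X \<in> carrier (env K)" for a k X
    using I that unfolding is_iota_def Let_def by blast
  have I_one: "I a \<one>\<^bsub>env K\<^esub> = \<zero>\<^bsub>env K\<^esub>" for a
    using I unfolding is_iota_def Let_def by blast
  have I_gen: "I a (env_gen K x \<otimes>\<^bsub>env K\<^esub> X) \<ominus>\<^bsub>env K\<^esub> env_gen K x \<otimes>\<^bsub>env K\<^esub> I a X =
      env_scal K (\<delta> u) \<otimes>\<^bsub>env K\<^esub> (env_gen K (D_unscaled a x) \<otimes>\<^bsub>env K\<^esub> X)
      \<ominus>\<^bsub>env K\<^esub> env_scal K (\<delta> (mform a x)) \<otimes>\<^bsub>env K\<^esub> X \<oplus>\<^bsub>env K\<^esub> I (\<tau> a x) X"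
    if "x \<in> K" "X \<in> carrier (env K)" for a x X
    using I that unfolding is_iota_def Let_def D_unscaled_def \<tau>_def by blast
  from p show ?thesis
  proof (induction arbitrary: a rule: free_induct)
    case zero
    have "I a (env_class K (scal 0 * 1)) = env_class K (scal 0 * 0)"
      using I_scal[of "\<one>\<^bsub>env K\<^esub>" a 0] I_one[of a]
      by (simp add: env_scal_def env_class_one[OF K_sub] env_class_zero[OF K_sub] env_K env_class_in[OF K_sub])
    then show ?case
      by (simp add: J_linear)
  next
    case one
    then show ?case
      using I_one[of a] by (simp add: J_linear env_class_one[OF K_sub] env_class_zero[OF K_sub])
  next
    case (add p q)
    then show ?case
      using I_add[of "env_class K p" "env_class K q" a]
      by (simp add: J_linear env_K J_free_van env_class_in[OF K_sub])
  next
    case (scal k p)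
    then show ?case
      using I_scal[of "env_class K p" a k]
      by (simp add: J_linear env_scal_def env_K J_free_van env_class_in[OF K_sub])
  next
    case (gen x p)
    let ?r = "(gen (D a x) - scal (c a x)) * p + J (\<tau> a x) p"
    have free: "gen x \<in> free K" "J a p \<in> free K" "?r \<in> free K" "gen x * p \<in> free K"
        "gen x * J a p \<in> free K"
      using gen J_free_van D_in_van_maps by (auto intro!: free_closed)
    have "I a (env_class K (gen x * p)) \<ominus>\<^bsub>env K\<^esub> env_class K (gen x * J a p) = env_class K ?r"
      using I_gen[of x "env_class K p" a] gen free J_free_van[OF gen(2)]
      by (simp add: relation_rhs env_class_in[OF K_sub]) (simp add: env_gen_def env_K)
    moreover have "X = (X \<ominus>\<^bsub>env K\<^esub> Y) \<oplus>\<^bsub>env K\<^esub> Y"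
      if "X \<in> carrier (env K)" "Y \<in> carrier (env K)" for X Y
      using that by (simp add: a_minus_def a_assoc l_neg)
    ultimately have "I a (env_class K (gen x * p)) =
        env_class K ?r \<oplus>\<^bsub>env K\<^esub> env_class K (gen x * J a p)"
      using I_in[OF env_class_in[OF K_sub free(4)], of a] env_class_in[OF K_sub free(5)]
      by metis
    then show ?case
      using free by (simp add: env_K J_gen_mult algebra_simps)
  qed
qed

text \<open>\<open>J\<close> respects the relations, hence its class does not depend on the choice of a representative.\<close>

lemma is_iota_exists: "\<exists>I :: 'g \<Rightarrow> _. is_iota P u z \<delta> I"
proof -
  define I where "I = (\<lambda>a. restrict (\<lambda>X. env_class K (J a (SOME p. p \<in> free K \<and> X = env_class K p))) (carrier (env K)))"
  have I: "I a (env_class K p) = env_class K (J a p)" if p: "p \<in> free K" for a p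
  proof -
    define q where "q = (SOME q. q \<in> free K \<and> env_class K p = env_class K q)"
    have q: "q \<in> free K" "env_class K p = env_class K q"
      unfolding q_def using someI[of "\<lambda>q. q \<in> free K \<and> env_class K p = env_class K q" p] p by auto
    then have "q - p \<in> rel_ideal K"
      using p env_class_eq_iff[OF K_sub, of q p] by simp
    then have "J a (q - p) \<in> rel_ideal K"
      unfolding J_def by (rule comm_data.J_rel_ideal[OF comm_data_van_maps])
    then have "env_class K (J a q) = env_class K (J a p)"
      using p q J_free_van by (simp add: env_class_eq_iff[OF K_sub] J_linear)
    then show ?thesis
      using p by (simp add: I_def env_class_in[OF K_sub] flip: q_def)
  qed
  have ball: "(\<forall>X\<in>carrier (env K). Q X) \<longleftrightarrow> (\<forall>p\<in>free K. Q (env_class K p))" for Q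
    unfolding carrier_env[OF K_sub] by blast
  have "is_iota P u z \<delta> I"
    unfolding is_iota_def Let_def ball
  proof (intro conjI allI ballI)
    fix a :: 'g
    show "I a \<in> carrier (env K) \<rightarrow>\<^sub>E carrier (env K)"
    proof (rule PiE_I)
      fix X assume "X \<in> carrier (env K)"
      then show "I a X \<in> carrier (env K)"
        by (auto simp: carrier_env[OF K_sub] I J_free_van)
    qed (simp add: I_def)
    show "I a \<one>\<^bsub>env K\<^esub> = \<zero>\<^bsub>env K\<^esub>"
      by (simp add: env_class_one[OF K_sub] env_class_zero[OF K_sub] I J_linear)
    fix p assume p: "p \<in> free K"
    show "I a (env_scal K k \<otimes>\<^bsub>env K\<^esub> env_class K p) = env_scal K k \<otimes>\<^bsub>env K\<^esub> I a (env_class K p)" for k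
      using p by (simp add: env_scal_def env_K I J_linear J_free_van free_mult)
    show "I a (env_class K p \<oplus>\<^bsub>env K\<^esub> env_class K q) = I a (env_class K p) \<oplus>\<^bsub>env K\<^esub> I a (env_class K q)"
      if "q \<in> free K" for q
      using p that by (simp add: env_K I J_linear J_free_van free_add)
    fix x assume x: "x \<in> K"
    have "I a (env_gen K x \<otimes>\<^bsub>env K\<^esub> env_class K p) \<ominus>\<^bsub>env K\<^esub> env_gen K x \<otimes>\<^bsub>env K\<^esub> I a (env_class K p) =
        env_class K ((gen (D a x) - scal (c a x)) * p + J (\<tau> a x) p)"
      using p free_gen[OF x] J_free_van free_gen[OF D_in_van_maps[OF x, of a]]
      by (simp add: env_gen_def env_K I free_mult free_add free_diff J_gen_mult add.assoc)
    then show "I a (env_gen K x \<otimes>\<^bsub>env K\<^esub> env_class K p) \<ominus>\<^bsub>env K\<^esub> env_gen K x \<otimes>\<^bsub>env K\<^esub> I a (env_class K p) =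
        env_scal K (\<delta> u) \<otimes>\<^bsub>env K\<^esub>
          (env_gen K (- lie (eps_map u z a) x + eps_map u z (lie a (mval x z))) \<otimes>\<^bsub>env K\<^esub> env_class K p)
        \<ominus>\<^bsub>env K\<^esub> env_scal K (\<delta> (mform a x)) \<otimes>\<^bsub>env K\<^esub> env_class K p
        \<oplus>\<^bsub>env K\<^esub> I (lie a (mval x z)) (env_class K p)"
      using relation_rhs[OF x p J_free_van[OF p], of a "\<tau> a x"] I[OF p]
      by (simp add: D_unscaled_def \<tau>_def)
  qed
  then show ?thesis
    by (rule exI[of _ I])
qed

lemma iota_on_class:
  assumes "p \<in> free K"
  shows "iota P u z \<delta> a (env_class K p) = env_class K (J a p)"
proof -
  obtain I :: "'g \<Rightarrow> _" where I: "is_iota P u z \<delta> I"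
    using is_iota_exists by blast
  have "I' = I" if I': "is_iota P u z \<delta> I'" for I' :: "'g \<Rightarrow> _"
  proof (rule ext, rule ext)
    fix a X
    show "I' a X = I a X"
    proof (cases "X \<in> carrier (env K)")
      case True
      then show ?thesis
        by (auto simp: carrier_env[OF K_sub] iota_on_class_unique[OF I] iota_on_class_unique[OF I'])
    next
      case False
      have "I a \<in> carrier (env K) \<rightarrow>\<^sub>E carrier (env K)"
        using I unfolding is_iota_def Let_def by (elim conjE) (erule spec)
      moreover have "I' a \<in> carrier (env K) \<rightarrow>\<^sub>E carrier (env K)"
        using I' unfolding is_iota_def Let_def by (elim conjE) (erule spec)
      ultimately show ?thesis
        using PiE_arb[OF _ False] by metis
    qed
  qed
  with I have "iota P u z \<delta> = I"
    unfolding iota_def by (intro the_equality)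
  then show ?thesis
    using iota_on_class_unique[OF I assms] by simp
qed

lemma eps_on_class:
  assumes "p \<in> free (van_maps P {} :: 'g mero set)"
  shows "eps P u z \<delta> a (env_class (van_maps P {}) p) =
    env_class (van_maps P {}) (scal (\<delta> u) * (gen (eps_map u z a) * p))"
  using assms free_gen[OF eps_map_in[of "{}" a]]
  by (simp add: eps_def Let_def env_scal_def env_gen_def env_class_mult[OF lie_subalgebra_van_maps] free_mult)

lemma gen_e:
  assumes "z \<notin> S"
  shows "gen (e a) - scal (\<delta> u) * gen (eps_map u z a) \<in> rel_ideal (reg_maps (insert P S))"
  unfolding e_eps_map using eps_map_in[OF assms, of a] van_maps_subset[of P S] by (intro rel_ideal_gen_scal) blast

lemma reg_P: "const_subalgebra (reg_maps S :: 'g mero set)"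
  by (rule lie_subalgebra_reg_maps)

text \<open>Transport replaces \<open>p\<close> by \<open>drop_const P p\<close>. The difference lies in the left ideal, which the
operator respects, so that the operator may be applied to \<open>p\<close> itself.\<close>

lemma eps_vac_vcl:
  assumes p: "p \<in> free (reg_maps {P})"
  shows "eps_vac P u z \<delta> a (vcl (reg_maps {P}) p) = vcl (reg_maps {P}) (gen (e a) * p)"
proof -
  let ?L = "reg_maps {P} :: 'g mero set"
  let ?q = "drop_const P p" and ?x = "gen (eps_map u z a :: 'g mero)"
  note q = drop_const[OF p]
  have x: "?x \<in> free (van_maps P {})" "?x \<in> free ?L" "gen (e a) \<in> free ?L"
    using eps_map_in[of "{}" a] van_maps_subset[of P "{}"] e_in_reg_maps[of "{P}" a] z_P
    by (auto intro!: free_gen)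
  have qL: "?q \<in> free ?L"
    using free_mono[OF van_maps_subset q(1)] .
  have "eps_vac P u z \<delta> a (vcl ?L p) = vcl ?L (scal (\<delta> u) * (?x * ?q))"
    unfolding eps_vac_def q(3) unident_vcl[OF q(1)] eps_on_class[OF q(1)]
    by (rule ident_class) (intro free_mult free_scal x(1) q(1))
  also have "\<dots> = vcl ?L (gen (e a) * p)"
  proof -
    have "(gen (e a) - scal (\<delta> u) * ?x) * ?q \<in> vac_ideal ?L"
      by (intro vac_ideal.rel rel_ideal_right gen_e qL) simp
    with vac_ideal_left[OF x(3) q(2)]
    have "gen (e a) * (p - ?q) + (gen (e a) - scal (\<delta> u) * ?x) * ?q \<in> vac_ideal ?L"
      by (rule vac_ideal.add)
    then have "- (gen (e a) * (p - ?q) + (gen (e a) - scal (\<delta> u) * ?x) * ?q) \<in> vac_ideal ?L"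
      by (rule vac_ideal_minus)
    moreover have "- (gen (e a) * (p - ?q) + (gen (e a) - scal (\<delta> u) * ?x) * ?q) =
        scal (\<delta> u) * (?x * ?q) - gen (e a) * p"
      by (simp add: algebra_simps)
    ultimately show ?thesis
      using x qL p by (simp add: vcl_eq_iff[OF reg_P] free_mult)
  qed
  finally show ?thesis .
qed

lemma iota_vac_vcl:
  assumes p: "p \<in> free (reg_maps {P, z})"
  shows "iota_vac P u z \<delta> a (vcl (reg_maps {P, z}) p) = vcl (reg_maps {P, z}) (J a p)"
proof -
  let ?L = "reg_maps {P, z} :: 'g mero set"
  let ?q = "drop_const P p"
  note q = drop_const[OF p]
  have qL: "?q \<in> free ?L"
    using free_mono[OF van_maps_subset q(1)] .
  have "iota_vac P u z \<delta> a (vcl ?L p) = vcl ?L (J a ?q)"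
    unfolding iota_vac_def q(3) unident_vcl[OF q(1)] iota_on_class[OF q(1)]
    by (rule ident_class[OF J_free_van[OF q(1)]])
  also have "\<dots> = vcl ?L (J a p)"
  proof -
    have "J a (p - ?q) \<in> vac_ideal ?L"
      by (rule J_vac_ideal[OF _ q(2)]) simp
    from vac_ideal_minus[OF this] show ?thesis
      using qL p by (simp add: vcl_eq_iff[OF reg_P] J_free J_linear)
  qed
  finally show ?thesis .
qed

lemma jay_vac_vcl:
  assumes p: "p \<in> free (reg_maps {P, z})"
  shows "jay_vac P u z \<delta> a (vcl (reg_maps {P, z}) p) = vcl (reg_maps {P}) (gen (e a) * p + J a p)"
proof -
  let ?L1 = "reg_maps {P, z} :: 'g mero set" and ?L = "reg_maps {P} :: 'g mero set"
  let ?K = "van_maps P {} :: 'g mero set"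
  let ?q = "drop_const P p" and ?x = "gen (eps_map u z a :: 'g mero)"
  note q = drop_const[OF p]
  have sub: "?L1 \<subseteq> ?L" "K \<subseteq> ?K"
    by (auto simp: reg_maps_def van_maps_def)
  have x: "?x \<in> free ?K" "?x \<in> free ?L" "gen (e a) \<in> free ?L"
    using eps_map_in[of "{}" a] van_maps_subset[of P "{}"] e_in_reg_maps[of "{P}" a] z_P
    by (auto intro!: free_gen)
  have qs: "?q \<in> free ?K" "J a ?q \<in> free ?K" "?q \<in> free ?L" "J a ?q \<in> free ?L"
    using q(1) J_free_van[OF q(1), of a] free_mono[OF sub(2)] free_mono[OF van_maps_subset, of _ P "{}"] by auto
  have ps: "p \<in> free ?L" "J a p \<in> free ?L"
    using p J_free[OF _ p, of a] free_mono[OF sub(1)] by auto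
  have jay: "jay P u z \<delta> a (env_class K ?q) = env_class ?K (scal (\<delta> u) * (?x * ?q) + J a ?q)"
    using q(1) J_free_van[OF q(1), of a] qs x
    by (simp add: jay_def Let_def iota_on_class env_map_class[OF K_sub lie_subalgebra_van_maps sub(2)]
        eps_on_class env_class_add[OF lie_subalgebra_van_maps] free_mult)
  have "jay_vac P u z \<delta> a (vcl ?L1 p) = vcl ?L (scal (\<delta> u) * (?x * ?q) + J a ?q)"
    unfolding jay_vac_def q(3) unident_vcl[OF q(1)] jay
    by (rule ident_class) (intro free_add free_mult free_scal x(1) qs(1,2))
  also have "\<dots> = vcl ?L (gen (e a) * p + J a p)"
  proof -
    have "J a (p - ?q) \<in> vac_ideal ?L"
      using J_vac_ideal[OF _ q(2), of a] vac_ideal_mono[OF _ sub(1)] by auto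
    moreover have "gen (e a) * (p - ?q) \<in> vac_ideal ?L"
      using vac_ideal_left[OF x(3)] vac_ideal_mono[OF q(2) sub(1)] by auto
    moreover have "(gen (e a) - scal (\<delta> u) * ?x) * ?q \<in> vac_ideal ?L"
      by (intro vac_ideal.rel rel_ideal_right gen_e qs(3)) simp
    ultimately have "gen (e a) * (p - ?q) + (gen (e a) - scal (\<delta> u) * ?x) * ?q + J a (p - ?q) \<in> vac_ideal ?L"
      by (simp only: vac_ideal.add)
    then have "- (gen (e a) * (p - ?q) + (gen (e a) - scal (\<delta> u) * ?x) * ?q + J a (p - ?q)) \<in> vac_ideal ?L"
      by (rule vac_ideal_minus)
    moreover have "- (gen (e a) * (p - ?q) + (gen (e a) - scal (\<delta> u) * ?x) * ?q + J a (p - ?q)) =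
        scal (\<delta> u) * (?x * ?q) + J a ?q - (gen (e a) * p + J a p)"
      by (simp add: algebra_simps J_linear)
    ultimately show ?thesis
      using x qs ps by (simp add: vcl_eq_iff[OF reg_P] free_mult free_add)
  qed
  finally show ?thesis .
qed

end

section \<open>Restriction to the maps regular at both points\<close>

text \<open>The map of quotients induced by a map \<open>F\<close> of representatives, for \<open>F\<close> additive and compatible with
the two left ideals.\<close>

definition vac_lift :: "'g :: complex_lie_algebra mero set \<Rightarrow> 'g mero set \<Rightarrow> ('g mero ncpoly \<Rightarrow> 'g mero ncpoly) \<Rightarrow>
    'g vac \<Rightarrow> 'g vac" where
  "vac_lift M M' F Y = vcl M' (F (SOME p. p \<in> free M \<and> Y = vcl M p))"

lemma vac_lift_vcl:
  assumes M: "const_subalgebra M" "const_subalgebra M'"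
    and F: "\<And>p q. F (p - q) = F p - F q" "\<And>p. p \<in> free M \<Longrightarrow> F p \<in> free M'"
      "\<And>p. p \<in> vac_ideal M \<Longrightarrow> F p \<in> vac_ideal M'"
    and p: "p \<in> free M"
  shows "vac_lift M M' F (vcl M p) = vcl M' (F p)"
proof -
  define q where "q = (SOME q. q \<in> free M \<and> vcl M p = vcl M q)"
  have q: "q \<in> free M" "vcl M p = vcl M q"
    unfolding q_def using someI[of "\<lambda>q. q \<in> free M \<and> vcl M p = vcl M q" p] p by auto
  then have "q - p \<in> vac_ideal M"
    using p vcl_eq_iff[OF M(1), of q p] by simp
  then have "F q - F p \<in> vac_ideal M'"
    using F(3)[of "q - p"] by (simp add: F(1))
  then have "vcl M' (F q) = vcl M' (F p)"
    using p q F(2) by (simp add: vcl_eq_iff[OF M(2)])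
  then show ?thesis
    unfolding vac_lift_def q_def .
qed

lemma is_restriction_vac_lift:
  assumes M: "const_subalgebra M" "const_subalgebra M'"
    and L: "const_subalgebra L" "const_subalgebra L'" "M \<subseteq> L" "M' \<subseteq> L'"
    and F: "\<And>p q. F (p - q) = F p - F q" "\<And>p. p \<in> free M \<Longrightarrow> F p \<in> free M'"
      "\<And>p. p \<in> vac_ideal M \<Longrightarrow> F p \<in> vac_ideal M'"
    and T: "\<And>p. p \<in> free L \<Longrightarrow> T (vcl L p) = vcl L' (F p)"
  shows "is_restriction M M' L L' T (vac_lift M M' F) \<and>
    (\<forall>p\<in>free M. vac_lift M M' F (vcl M p) = vcl M' (F p))"
  unfolding is_restriction_def vac_eq[OF M(1)] vac_eq[OF M(2)]
proof (intro conjI ballI)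
  fix Y assume "Y \<in> vcl M ` free M"
  then obtain p where p: "p \<in> free M" "Y = vcl M p"
    by blast
  have Y: "vac_lift M M' F Y = vcl M' (F p)"
    unfolding p(2) by (rule vac_lift_vcl[OF M F p(1)])
  show "vac_lift M M' F Y \<in> vcl M' ` free M'"
    using F(2)[OF p(1)] unfolding Y by simp
  show "vac_map L' (vac_lift M M' F Y) = T (vac_map L Y)"
    using T[OF free_mono[OF L(3) p(1)]] vac_map_vcl[OF M(1) L(1,3) p(1)]
      vac_map_vcl[OF M(2) L(2,4) F(2)[OF p(1)]]
    unfolding Y by (simp add: p(2))
qed (rule vac_lift_vcl[OF M F])

context coordinate_operators
begin

lemma restrict_eps:
  assumes "P \<in> S" "z \<notin> S"
  shows "is_restriction (reg_maps S) (reg_maps S) (reg_maps {P}) (reg_maps {P}) (eps_vac P u z \<delta> a)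
      (vac_lift (reg_maps S) (reg_maps S) (\<lambda>p. gen (e a) * p)) \<and>
    (\<forall>p\<in>free (reg_maps S). vac_lift (reg_maps S) (reg_maps S) (\<lambda>p. gen (e a) * p) (vcl (reg_maps S) p) =
      vcl (reg_maps S) (gen (e a) * p))"
proof (rule is_restriction_vac_lift[OF reg_P reg_P reg_P reg_P])
  have e: "gen (e a) \<in> free (reg_maps S)"
    using assms by (intro free_gen e_in_reg_maps)
  show "gen (e a) * p \<in> free (reg_maps S)" if "p \<in> free (reg_maps S)" for p
    using e that by (rule free_mult)
  show "gen (e a) * p \<in> vac_ideal (reg_maps S)" if "p \<in> vac_ideal (reg_maps S)" for p
    using e that by (rule vac_ideal_left)
  show "reg_maps S \<subseteq> reg_maps {P}" "reg_maps S \<subseteq> reg_maps {P}"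
    by (rule reg_maps_mono; simp add: assms)+
qed (simp_all add: right_diff_distrib eps_vac_vcl)

lemma restrict_iota:
  assumes "P \<in> S" "z \<in> S"
  shows "is_restriction (reg_maps S) (reg_maps S) (reg_maps {P, z}) (reg_maps {P, z}) (iota_vac P u z \<delta> a)
      (vac_lift (reg_maps S) (reg_maps S) (J a)) \<and>
    (\<forall>p\<in>free (reg_maps S). vac_lift (reg_maps S) (reg_maps S) (J a) (vcl (reg_maps S) p) = vcl (reg_maps S) (J a p))"
proof (rule is_restriction_vac_lift[OF reg_P reg_P reg_P reg_P])
  show "reg_maps S \<subseteq> reg_maps {P, z}" "reg_maps S \<subseteq> reg_maps {P, z}"
    by (rule reg_maps_mono; simp add: assms)+
qed (use assms in \<open>simp_all add: J_linear J_free J_vac_ideal iota_vac_vcl\<close>)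

lemma restrict_jay:
  assumes "P \<in> S" "z \<notin> S"
  shows "is_restriction (reg_maps (insert z S)) (reg_maps S) (reg_maps {P, z}) (reg_maps {P}) (jay_vac P u z \<delta> a)
      (vac_lift (reg_maps (insert z S)) (reg_maps S) (\<lambda>p. gen (e a) * p + J a p)) \<and>
    (\<forall>p\<in>free (reg_maps (insert z S)).
      vac_lift (reg_maps (insert z S)) (reg_maps S) (\<lambda>p. gen (e a) * p + J a p) (vcl (reg_maps (insert z S)) p) =
      vcl (reg_maps S) (gen (e a) * p + J a p))"
proof (rule is_restriction_vac_lift[OF reg_P reg_P reg_P reg_P])
  have e: "gen (e a) \<in> free (reg_maps S)"
    using assms by (intro free_gen e_in_reg_maps)
  have sub: "reg_maps (insert z S) \<subseteq> (reg_maps S :: 'g mero set)"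
    by (rule reg_maps_mono) blast
  show "gen (e a) * p + J a p \<in> free (reg_maps S)" if "p \<in> free (reg_maps (insert z S))" for p
    using that free_mono[OF sub] e by (intro free_add free_mult) (auto intro: J_free)
  show "gen (e a) * p + J a p \<in> vac_ideal (reg_maps S)" if "p \<in> vac_ideal (reg_maps (insert z S))" for p
    using that vac_ideal_mono[OF _ sub] e by (intro vac_ideal.add vac_ideal_left) (auto intro: J_vac_ideal)
  show "reg_maps (insert z S) \<subseteq> reg_maps {P, z}" "reg_maps S \<subseteq> reg_maps {P}"
    by (rule reg_maps_mono; simp add: assms)+
qed (simp_all add: right_diff_distrib J_linear jay_vac_vcl)

end

section \<open>Kernels that differ by a constant\<close>

locale two_kernels =
  A: point_operators P z h \<delta> type_g + B: point_operators P' z h' \<delta> type_g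
  for P P' z :: sphere and h h' :: "complex mero" and \<delta> and type_g :: "'g :: metrized_lie_algebra itself" +
  fixes s :: complex
  assumes h': "h' = h - mconst s"
begin

lemma e_shift: "B.e a = A.e a - s *\<^sub>C mconst a"
proof -
  have "h' = h + mconst (- s)"
    by (simp add: h' mconst_uminus)
  moreover have "(- s) *\<^sub>C mconst a = - (s *\<^sub>C mconst a)"
    using scaleC_scaleC[of "- 1" s "mconst a"] by (simp add: scaleC_minus_one)
  ultimately have "h' \<odot> mconst a = h \<odot> mconst a - s *\<^sub>C mconst a"
    by (simp only: msmult_add_left msmult_const) simp
  then show ?thesis
    unfolding A.e_def B.e_def .
qed

lemma D_shift: "B.D a x = (A.D a x + s *\<^sub>C lie (mconst a) x) - s *\<^sub>C mconst (A.\<tau> a x)"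
proof -
  have "lie (A.e a - s *\<^sub>C mconst a) x = lie (A.e a) x - s *\<^sub>C lie (mconst a) x"
    using lie_add_left[of "A.e a - s *\<^sub>C mconst a" "s *\<^sub>C mconst a" x] by (simp add: lie_scaleC_left)
  then show ?thesis
    by (simp add: A.D_def B.D_def e_shift A.\<tau>_def)
qed

text \<open>Both sides have the same commutators with a letter \<open>x\<close>: the kernel shift contributes \<open>s [a, x]\<close>
and \<open>- s [a, x(z)]\<close> to \<open>D a x\<close>; the first is the commutator of \<open>s a\<close> with \<open>x\<close>, and the second is
compensated by the shift of \<open>J [a, x(z)]\<close>. On \<open>1\<close> the difference is \<open>- s a\<close>, which is in the left
ideal.\<close>

lemma J_shift:
  assumes "z \<in> S" "p \<in> free (reg_maps S)"
  shows "B.J a p - (A.J a p + scal s * gen (mconst a) * p) \<in> vac_ideal (reg_maps S)"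
  using assms(2)
proof (induction rule: linear_mod_induct[where F = "\<lambda>a p. B.J a p - (A.J a p + scal s * gen (mconst a) * p)"])
  case (scal a k p)
  then show ?case
    by (simp add: A.J_linear B.J_linear right_diff_distrib distrib_left scal_left_commute[of "_ * _" k])
next
  case (one a)
  have "- (scal s * gen (mconst a)) \<in> vac_ideal (reg_maps S)"
    by (intro vac_ideal_minus vac_ideal.scal vac_ideal.const)
  then show ?case
    by (simp add: A.J_linear B.J_linear)
next
  case (gen a x p)
  let ?L = "reg_maps S :: 'g mero set" and ?c = "mconst a" and ?t = "mconst (A.\<tau> a x)"
  let ?D = "A.D a x" and ?l = "lie (mconst a) x"
  have LD: "lie_subalgebra ?L" "\<And>b. mconst b \<in> ?L"
    by (rule const_subalgebra_D[OF lie_subalgebra_reg_maps])+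
  have closed: "v + w \<in> ?L" "k *\<^sub>C v \<in> ?L" "lie v w \<in> ?L" if "v \<in> ?L" "w \<in> ?L" for v w k
    using LD(1) that by (auto simp: lie_subalgebra_def)
  have in_L: "?D \<in> ?L" "?l \<in> ?L" "?c \<in> ?L" "?t \<in> ?L"
    using gen(1) A.D_in_reg_maps[OF assms(1)] LD(2) closed(3) by simp_all
  have D: "gen (B.D a x) - (gen ?D + scal s * gen ?l - scal s * gen ?t) \<in> rel_ideal ?L"
  proof -
    have "gen (B.D a x) - (gen ?D + scal s * gen ?l - scal s * gen ?t) =
        (gen ((?D + s *\<^sub>C ?l) - s *\<^sub>C ?t) - (gen (?D + s *\<^sub>C ?l) - gen (s *\<^sub>C ?t)))
        + (gen (?D + s *\<^sub>C ?l) - (gen ?D + gen (s *\<^sub>C ?l)))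
        + (gen (s *\<^sub>C ?l) - scal s * gen ?l) - (gen (s *\<^sub>C ?t) - scal s * gen ?t)"
      by (simp add: D_shift)
    then show ?thesis
      using in_L closed LD(1)
      by (simp only: rel_ideal.add rel_ideal_diff rel_ideal_gen_add rel_ideal_gen_diff rel_ideal_gen_scal)
  qed
  have "B.J a (gen x * p) - (A.J a (gen x * p) + scal s * gen ?c * (gen x * p)) =
      gen x * (B.J a p - (A.J a p + scal s * gen ?c * p))
      + (B.J (A.\<tau> a x) p - (A.J (A.\<tau> a x) p + scal s * gen ?t * p))
      + (gen (B.D a x) - (gen ?D + scal s * gen ?l - scal s * gen ?t)) * p
      - scal s * ((gen ?c * gen x - gen x * gen ?c - gen ?l) * p)"
  proof -
    have "B.c = A.c" "B.\<tau> = A.\<tau>"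
      by (simp_all add: fun_eq_iff A.c_def B.c_def A.\<tau>_def B.\<tau>_def)
    moreover have "gen x * (scal s * q) = scal s * (gen x * q)" for q
      by (rule scal_left_commute)
    ultimately show ?thesis
      by (simp add: A.J_gen_mult B.J_gen_mult left_diff_distrib right_diff_distrib distrib_left
          distrib_right mult.assoc)
  qed
  moreover have "gen x * (B.J a p - (A.J a p + scal s * gen ?c * p)) \<in> vac_ideal ?L"
    using gen by (intro vac_ideal.gen)
  moreover have "(gen (B.D a x) - (gen ?D + scal s * gen ?l - scal s * gen ?t)) * p \<in> vac_ideal ?L"
    by (intro vac_ideal.rel rel_ideal_right D gen(2))
  moreover have "scal s * ((gen ?c * gen x - gen x * gen ?c - gen ?l) * p) \<in> vac_ideal ?L"
    by (intro vac_ideal.rel rel_ideal.scal rel_ideal_right rel_ideal_gen_lie in_L gen(1,2))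
  ultimately show ?case
    using gen.IH by (simp only: vac_ideal.add vac_ideal_diff)
qed (simp_all add: A.J_linear B.J_linear distrib_left vac_ideal.intros)

lemma gen_e_shift:
  assumes "z \<notin> S"
  shows "gen (B.e a) - (gen (A.e a) - scal s * gen (mconst a)) \<in> rel_ideal (reg_maps S)"
proof -
  let ?L = "reg_maps S :: 'g mero set"
  have LD: "lie_subalgebra ?L" "\<And>b. mconst b \<in> ?L"
    by (rule const_subalgebra_D[OF lie_subalgebra_reg_maps])+
  have in_L: "A.e a \<in> ?L" "mconst a \<in> ?L" "s *\<^sub>C mconst a \<in> ?L"
    using A.e_in_reg_maps[OF assms] LD(1) LD(2)[of a] by (auto simp: lie_subalgebra_def)
  have "gen (B.e a) - (gen (A.e a) - scal s * gen (mconst a)) =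
      (gen (A.e a - s *\<^sub>C mconst a) - (gen (A.e a) - gen (s *\<^sub>C mconst a)))
      - (gen (s *\<^sub>C mconst a) - scal s * gen (mconst a))"
    by (simp add: e_shift)
  then show ?thesis
    using in_L LD(1) by (simp only: rel_ideal_diff rel_ideal_gen_diff rel_ideal_gen_scal)
qed

end

section \<open>Change of coordinate\<close>

theorem theorem11p6:
  fixes P P' z :: sphere
    and u u' :: "complex mero"
    and \<nu> :: "'g :: metrized_lie_algebra mero"
    and \<delta> :: "complex mero \<Rightarrow> complex"
  assumes "P \<noteq> P'"
    and "is_coordinate u" and "has_value u P' 0" and "has_pole u P"
    and "u' = minverse u"
    and "z \<noteq> P" and "z \<noteq> P'"
    and "regular \<nu> z"
    and "\<delta> \<in> tangent z"
  defines "M \<equiv> reg_maps {P, P'}" and "Mz \<equiv> reg_maps {P, P', z}"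
  shows "(\<exists>E E'.
      is_restriction M M (reg_maps {P}) (reg_maps {P}) (eps_vac P u z \<delta> (mval \<nu> z)) E \<and>
      is_restriction M M (reg_maps {P'}) (reg_maps {P'}) (eps_vac P' u' z \<delta> (mval \<nu> z)) E' \<and>
      (\<forall>Y\<in>vac M. E' Y = vac_diff M (E Y)
         (vac_act M (env_scal M (\<delta> u' / mval u' z) \<otimes>\<^bsub>env M\<^esub> env_gen M (mconst (mval \<nu> z))) Y))) \<and>
    (\<exists>I I'.
      is_restriction Mz Mz (reg_maps {P, z}) (reg_maps {P, z}) (iota_vac P u z \<delta> (mval \<nu> z)) I \<and>
      is_restriction Mz Mz (reg_maps {P', z}) (reg_maps {P', z}) (iota_vac P' u' z \<delta> (mval \<nu> z)) I' \<and>
      (\<forall>Y\<in>vac Mz. I' Y = vac_add Mz (I Y)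
         (vac_act Mz (env_scal Mz (\<delta> u' / mval u' z) \<otimes>\<^bsub>env Mz\<^esub> env_gen Mz (mconst (mval \<nu> z))) Y))) \<and>
    (\<exists>J J'.
      is_restriction Mz M (reg_maps {P, z}) (reg_maps {P}) (jay_vac P u z \<delta> (mval \<nu> z)) J \<and>
      is_restriction Mz M (reg_maps {P', z}) (reg_maps {P'}) (jay_vac P' u' z \<delta> (mval \<nu> z)) J' \<and>
      (\<forall>Y\<in>vac Mz. J' Y = J Y))"
proof -
  define a where "a = mval \<nu> z"
  obtain c d where c: "c \<noteq> 0" and u: "u = abs_mero (\<lambda>x. c * pole_fun P x + d)"
    using coordinate_normal_form[OF assms(2,4)] by blast
  have P': "P' \<noteq> P"
    using assms(1) by simp
  interpret C: coordinate_at P z c d u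
    using c u assms(6) by unfold_locales
  have "C.U P' = 0"
    using has_value_unique_complex[OF C.has_value_u[OF P'] assms(3)] .
  then interpret C: coordinate_with_zero P z c d u P'
    using P' assms(7) by unfold_locales
  note kernel = C.cauchy_kernel_coordinate
  note kernel' = C.cauchy_kernel_inverse_coordinate[folded assms(5)]
  define U where "U = C.U z"
  have U: "U \<noteq> 0"
    unfolding U_def by (rule C.U_z)
  have mval_u: "mval u z = U"
    unfolding U_def by (rule C.mval_u[OF assms(6)])
  have val_u': "has_value u' z (inverse U)"
    unfolding U_def assms(5) by (rule C.has_value_minverse_u)
  then have mval_u': "mval u' z = inverse U"
    by (rule mval_eq_complex)
  have reg: "regular u z" "regular u' z"
    using val_u' C.has_value_u[OF assms(6)] unfolding regular_def by blast+
  \<comment> \<open>The Leibniz rule for \<open>u u' = 1\<close>.\<close>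
  have \<delta>_u': "\<delta> u' = - \<delta> u / U\<^sup>2"
  proof -
    have "U * \<delta> u' + inverse U * \<delta> u = 0"
      using tangent_rules(2)[OF assms(9) reg] tangent_const[OF assms(9)]
        C.u_times_minverse[folded assms(5)]
      by (simp add: mval_u mval_u')
    then show ?thesis
      using U by (simp add: field_simps power2_eq_square eq_neg_iff_add_eq_0)
  qed
  \<comment> \<open>Equal to \<open>- \<delta> u / u(z)\<close>, the constant by which the kernels differ.\<close>
  define s where "s = \<delta> u' / mval u' z"
  define h where "h = \<delta> u *\<^sub>C minverse (u - mconst (mval u z))"
  define h' where "h' = \<delta> u' *\<^sub>C minverse (u' - mconst (mval u' z))"
  interpret A: coordinate_operators P z h \<delta> "TYPE('g)" u
    using kernel cauchy_kernel_scaleC[OF kernel] assms(9)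
    by (simp add: coordinate_operators_def coordinate_operators_axioms_def point_operators_def
        point_operators_axioms_def h_def)
  interpret B: coordinate_operators P' z h' \<delta> "TYPE('g)" u'
    using kernel' cauchy_kernel_scaleC[OF kernel'] assms(9)
    by (simp add: coordinate_operators_def coordinate_operators_axioms_def point_operators_def
        point_operators_axioms_def h'_def)
  have h'_h: "h' = h - mconst s"
  proof -
    have "h' = \<delta> u' *\<^sub>C ((- (U\<^sup>2)) *\<^sub>C minverse (u - mconst (mval u z)) - mconst U)"
      unfolding h'_def assms(5) U_def
      by (simp only: C.kernel_inverse_coordinate)
    also have "\<dots> = (\<delta> u' * (- (U\<^sup>2))) *\<^sub>C minverse (u - mconst (mval u z)) - mconst (\<delta> u' * U)"
      by (simp add: scaleC_diff_right scaleC_scaleC scaleC_complex_def flip: mconst_scaleC)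
    also have "\<delta> u' * (- (U\<^sup>2)) = \<delta> u"
      using U by (simp add: \<delta>_u')
    also have "\<delta> u' * U = s"
      using U by (simp add: s_def mval_u' divide_inverse)
    finally show ?thesis
      by (simp only: h_def)
  qed
  interpret T: two_kernels P P' z h h' \<delta> "TYPE('g)" s
    by unfold_locales (rule h'_h)
  have M: "const_subalgebra (M :: 'g mero set)" and Mz: "const_subalgebra (Mz :: 'g mero set)"
    by (simp_all add: M_def Mz_def lie_subalgebra_reg_maps)
  have sub: "(Mz :: 'g mero set) \<subseteq> M"
    unfolding M_def Mz_def by (rule reg_maps_mono) blast
  have z: "z \<notin> {P, P'}" "z \<in> {P, P', z}"
    using assms(6,7) by auto
  have Mz_eq: "(Mz :: 'g mero set) = reg_maps (insert z {P, P'})"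
    unfolding Mz_def by (rule arg_cong[of _ _ reg_maps]) blast
  have const: "env_scal L s \<otimes>\<^bsub>env L\<^esub> env_gen L (mconst a) = env_class L (scal s * gen (mconst a))"
    "scal s * gen (mconst a) \<in> free L" if "const_subalgebra L" for L :: "'g mero set"
    using const_subalgebra_D[OF that]
    by (simp_all add: env_scal_def env_gen_def env_class_mult free_gen free_mult)
  define E where "E = vac_lift M M (\<lambda>p. gen (A.e a) * p)"
  define E' where "E' = vac_lift M M (\<lambda>p. gen (B.e a) * p)"
  define I where "I = vac_lift Mz Mz (A.J a)"
  define I' where "I' = vac_lift Mz Mz (B.J a)"
  define F where "F = vac_lift Mz M (\<lambda>p. gen (A.e a) * p + A.J a p)"
  define F' where "F' = vac_lift Mz M (\<lambda>p. gen (B.e a) * p + B.J a p)"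
  have P: "P \<in> {P, P'}" "P' \<in> {P, P'}" "P \<in> {P, P', z}" "P' \<in> {P, P', z}"
    by simp_all
  note restr_E = A.restrict_eps[OF P(1) z(1), of a, folded M_def, folded E_def]
    B.restrict_eps[OF P(2) z(1), of a, folded M_def, folded E'_def]
  note restr_I = A.restrict_iota[OF P(3) z(2), of a, folded Mz_def, folded I_def]
    B.restrict_iota[OF P(4) z(2), of a, folded Mz_def, folded I'_def]
  note restr_F = A.restrict_jay[OF P(1) z(1), of a, folded Mz_eq M_def, folded F_def]
    B.restrict_jay[OF P(2) z(1), of a, folded Mz_eq M_def, folded F'_def]
  note E = restr_E[THEN conjunct2, THEN bspec]
  note I = restr_I[THEN conjunct2, THEN bspec]
  note F = restr_F[THEN conjunct2, THEN bspec]
  have e_free: "gen (A.e a) \<in> free M" "gen (B.e a) \<in> free M"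
    unfolding M_def using A.e_in_reg_maps[OF z(1)] B.e_in_reg_maps[OF z(1)] by (auto intro: free_gen)
  have J_free: "A.J a p \<in> free Mz" "B.J a p \<in> free Mz" if "p \<in> free Mz" for p
    using that A.J_free[OF z(2)] B.J_free[OF z(2)] by (simp_all add: Mz_def)
  have e_shift: "(gen (B.e a) - (gen (A.e a) - scal s * gen (mconst a))) * p \<in> vac_ideal M"
    if "p \<in> free M" for p
    by (rule vac_ideal.rel[OF rel_ideal_right[OF T.gen_e_shift[OF z(1), folded M_def] that]])
  have J_shift: "B.J a p - (A.J a p + scal s * gen (mconst a) * p) \<in> vac_ideal Mz" if "p \<in> free Mz" for p
    using T.J_shift[OF z(2) that[unfolded Mz_def], folded Mz_def] .
  have E'_E: "E' Y = vac_diff M (E Y) (vac_act M (env_scal M s \<otimes>\<^bsub>env M\<^esub> env_gen M (mconst a)) Y)"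
    if Y: "Y \<in> vac M" for Y
  proof -
    obtain p where p: "p \<in> free M" "Y = vcl M p"
      using Y unfolding vac_eq[OF M] by blast
    have "gen (B.e a) * p - (gen (A.e a) * p - scal s * gen (mconst a) * p) \<in> vac_ideal M"
      using e_shift[OF p(1)] by (simp add: left_diff_distrib)
    then show ?thesis
      using p const[OF M] e_free
      by (simp add: E vac_act_vcl[OF M] vac_diff_vcl[OF M] free_mult vcl_eq_iff[OF M] free_diff)
  qed
  have I'_I: "I' Y = vac_add Mz (I Y) (vac_act Mz (env_scal Mz s \<otimes>\<^bsub>env Mz\<^esub> env_gen Mz (mconst a)) Y)"
    if Y: "Y \<in> vac Mz" for Y
  proof -
    obtain p where p: "p \<in> free Mz" "Y = vcl Mz p"
      using Y unfolding vac_eq[OF Mz] by blast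
    then show ?thesis
      using J_shift[OF p(1)] const[OF Mz] J_free[OF p(1)]
      by (simp add: I vac_act_vcl[OF Mz] vac_add_vcl[OF Mz] free_mult vcl_eq_iff[OF Mz] free_add)
  qed
  have F'_F: "F' Y = F Y" if Y: "Y \<in> vac Mz" for Y
  proof -
    obtain p where p: "p \<in> free Mz" "Y = vcl Mz p"
      using Y unfolding vac_eq[OF Mz] by blast
    have pM: "p \<in> free M" "A.J a p \<in> free M" "B.J a p \<in> free M"
      using p(1) J_free[OF p(1)] free_mono[OF sub] by auto
    have "(gen (B.e a) * p + B.J a p) - (gen (A.e a) * p + A.J a p) =
        (gen (B.e a) - (gen (A.e a) - scal s * gen (mconst a))) * p
        + (B.J a p - (A.J a p + scal s * gen (mconst a) * p))"
      by (simp add: left_diff_distrib)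
    then have "(gen (B.e a) * p + B.J a p) - (gen (A.e a) * p + A.J a p) \<in> vac_ideal M"
      using e_shift[OF pM(1)] vac_ideal_mono[OF J_shift[OF p(1)] sub] by (simp only: vac_ideal.add)
    then show ?thesis
      using p pM e_free by (simp add: F vcl_eq_iff[OF M] free_add free_mult)
  qed
  show ?thesis
    unfolding a_def[symmetric] s_def[symmetric]
  proof (intro conjI)
    show "\<exists>E E'. is_restriction M M (reg_maps {P}) (reg_maps {P}) (eps_vac P u z \<delta> a) E \<and>
        is_restriction M M (reg_maps {P'}) (reg_maps {P'}) (eps_vac P' u' z \<delta> a) E' \<and>
        (\<forall>Y\<in>vac M. E' Y = vac_diff M (E Y)
          (vac_act M (env_scal M s \<otimes>\<^bsub>env M\<^esub> env_gen M (mconst a)) Y))"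
      by (rule exI[of _ E], rule exI[of _ E'], intro conjI ballI)
        (rule restr_E[THEN conjunct1] E'_E, assumption?)+
    show "\<exists>I I'. is_restriction Mz Mz (reg_maps {P, z}) (reg_maps {P, z}) (iota_vac P u z \<delta> a) I \<and>
        is_restriction Mz Mz (reg_maps {P', z}) (reg_maps {P', z}) (iota_vac P' u' z \<delta> a) I' \<and>
        (\<forall>Y\<in>vac Mz. I' Y = vac_add Mz (I Y)
          (vac_act Mz (env_scal Mz s \<otimes>\<^bsub>env Mz\<^esub> env_gen Mz (mconst a)) Y))"
      by (rule exI[of _ I], rule exI[of _ I'], intro conjI ballI)
        (rule restr_I[THEN conjunct1] I'_I, assumption?)+
    show "\<exists>J J'. is_restriction Mz M (reg_maps {P, z}) (reg_maps {P}) (jay_vac P u z \<delta> a) J \<and>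
        is_restriction Mz M (reg_maps {P', z}) (reg_maps {P'}) (jay_vac P' u' z \<delta> a) J' \<and>
        (\<forall>Y\<in>vac Mz. J' Y = J Y)"
      by (rule exI[of _ F], rule exI[of _ F'], intro conjI ballI)
        (rule restr_F[THEN conjunct1] F'_F, assumption?)+
  qed
qed

end
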